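(* Consider the symplectic vector space $(\mathcal{L}^2_{\mathbf z},\omega)$ with the group action $\mathbb{S}^1\times\mathcal{L}^2_{\mathbf z}\to\mathcal{L}^2_{\mathbf z}$, $(\zeta,\alpha)\mapsto\zeta\alpha$, and its associated moment map $\mathcal{C}:\mathcal{L}^2_{\mathbf z}\to\mathbb{R}$, $\mathcal{C}(\alpha)=\frac12\|\alpha\|^2_{\mathcal{L}^2_{\mathbf z}}$. Then $\frac12\in\mathbb{R}$ is a regular value of $\mathcal{C}$, and there is a unique symplectic form $\bar\omega$ on the smooth Hilbert manifold $\mathbb{S}^{\mathcal{L}^2_{\mathbf z}}/\mathbb{S}^1$ such that, for the embedding $\iota:\mathbb{S}^{\mathcal{L}^2_{\mathbf z}}\to\mathcal{L}^2_{\mathbf z}$ and the projection $\Pi:\mathbb{S}^{\mathcal{L}^2_{\mathbf z}}\to\mathbb{S}^{\mathcal{L}^2_{\mathbf z}}/\mathbb{S}^1$, $$\iota^*\omega=\Pi^*\bar\omega .$$ Moreover, given a smooth $\mathbb{S}^1$-invariant Hamiltonian $\mathcal{H}$ on $\mathcal{L}^2_{\mathbf z}$ and its push-forward $\bar{\mathcal{H}}$ on $\mathbb{S}^{\mathcal{L}^2_{\mathbf z}}/\mathbb{S}^1$ (i.e. $\mathcal{H}\circ\iota=\bar{\mathcal{H}}\circ\Pi$), the respective Hamiltonian vector fields satisfy $$\forall\alpha\in\mathbb{S}^{\mathcal{L}^2_{\mathbf z}}:\quad X_{\bar{\mathcal{H}}}(\Pi\alpha)=(\Pi_*X_{\mathcal{H}})(\Pi\alpha)=\mathrm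 d\Pi_\alpha\big(X_{\mathcal{H}}(\alpha)\big).$$
   Context: $\mathcal{L}^2_{\mathbf z}=L^2(\mathbb{R}^{2d};\mathbb{C})$ is regarded as a real Hilbert space with $\langle\alpha_1,\alpha_2\rangle=\int\alpha_1\bar\alpha_2\,\mathrm d\mathbf z$, real inner product $\operatorname{Re}\langle\cdot,\cdot\rangle$, and symplectic form $\omega(\alpha_1,\alpha_2)=\operatorname{Im}\langle\alpha_1,\alpha_2\rangle$. $\mathbb{S}^{\mathcal{L}^2_{\mathbf z}}=\{\alpha:\|\alpha\|_{\mathcal{L}^2_{\mathbf z}}=1\}$ is the unit sphere and $\mathbb{S}^1=\{\zeta\in\mathbb{C}:|\zeta|=1\}$. The Hamiltonian vector field $X_{\mathcal{H}}$ of a function $\mathcal{H}$ with respect to a symplectic form $\omega$ is defined by $\mathrm D\mathcal{H}(\alpha)(\delta\alpha)=-\omega(X_{\mathcal{H}}(\alpha),\delta\alpha)$ for all tangent vectors $\delta\alpha$; $X_{\bar{\mathcal{H}}}$ is defined likewise with respect to $\bar\omega$. *)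

theory Defs
  imports "HOL-Analysis.Analysis"
begin

section \<open>The Hilbert space of square-integrable complex functions\<close>

definition square_integrable :: "('a::euclidean_space \<Rightarrow> complex) \<Rightarrow> bool" where
  "square_integrable f \<longleftrightarrow>
     f \<in> borel_measurable lborel \<and> integrable lborel (\<lambda>z. (cmod (f z))\<^sup>2)"

lemma square_integrable_measurable [measurable_dest]:
  "square_integrable f \<Longrightarrow> f \<in> borel_measurable lborel"
  by (simp add: square_integrable_def)

lemma square_integrable_zero: "square_integrable (\<lambda>z. 0)"
  by (simp add: square_integrable_def)

lemma square_integrable_add:
  assumes "square_integrable f" "square_integrable g"
  shows "square_integrable (\<lambda>z. f z + g z)"
  unfolding square_integrable_def
proof (intro conjI)
  have [measurable]: "f \<in> borel_measurable lborel" "g \<in> borel_measurable lborel"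
    using assms by (auto simp: square_integrable_def)
  show "(\<lambda>z. f z + g z) \<in> borel_measurable lborel" by measurable
  have "integrable lborel (\<lambda>z. 2 * (cmod (f z))\<^sup>2 + 2 * (cmod (g z))\<^sup>2)"
    using assms by (auto simp: square_integrable_def)
  then show "integrable lborel (\<lambda>z. (cmod (f z + g z))\<^sup>2)"
  proof (rule Bochner_Integration.integrable_bound)
    show "AE z in lborel. norm ((cmod (f z + g z))\<^sup>2)
            \<le> norm (2 * (cmod (f z))\<^sup>2 + 2 * (cmod (g z))\<^sup>2)"
    proof (rule AE_I2)
      fix z
      have "(cmod (f z + g z))\<^sup>2 \<le> (cmod (f z) + cmod (g z))\<^sup>2"
        by (intro power_mono norm_triangle_ineq) auto
      also have "\<dots> \<le> 2 * (cmod (f z))\<^sup>2 + 2 * (cmod (g z))\<^sup>2"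
        using sum_squares_bound[of "cmod (f z)" "cmod (g z)"] by (simp add: power2_sum)
      finally show "norm ((cmod (f z + g z))\<^sup>2)
            \<le> norm (2 * (cmod (f z))\<^sup>2 + 2 * (cmod (g z))\<^sup>2)" by simp
    qed
  qed measurable
qed

lemma square_integrable_scale:
  assumes "square_integrable f"
  shows "square_integrable (\<lambda>z. c * f z)"
  using assms by (auto simp: square_integrable_def norm_mult power_mult_distrib)

lemma borel_measurable_cnj_comp [measurable (raw)]:
  "f \<in> borel_measurable M \<Longrightarrow> (\<lambda>x. cnj (f x)) \<in> borel_measurable M"
  by (rule borel_measurable_continuous_on[OF continuous_on_cnj[OF continuous_on_id]])

lemma integrable_mult_cnj:
  assumes "square_integrable f" "square_integrable g"
  shows "integrable lborel (\<lambda>z. f z * cnj (g z))"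
proof (rule Bochner_Integration.integrable_bound)
  have [measurable]: "f \<in> borel_measurable lborel" "g \<in> borel_measurable lborel"
    using assms by (auto simp: square_integrable_def)
  show "integrable lborel (\<lambda>z. (cmod (f z))\<^sup>2 + (cmod (g z))\<^sup>2)"
    using assms by (auto simp: square_integrable_def)
  show "(\<lambda>z. f z * cnj (g z)) \<in> borel_measurable lborel" by measurable
  show "AE z in lborel. norm (f z * cnj (g z)) \<le> norm ((cmod (f z))\<^sup>2 + (cmod (g z))\<^sup>2)"
  proof (rule AE_I2)
    fix z
    have "2 * (cmod (f z) * cmod (g z)) \<le> (cmod (f z))\<^sup>2 + (cmod (g z))\<^sup>2"
      using sum_squares_bound[of "cmod (f z)" "cmod (g z)"] by simp
    moreover have "0 \<le> cmod (f z) * cmod (g z)" by simp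
    ultimately have "cmod (f z) * cmod (g z) \<le> (cmod (f z))\<^sup>2 + (cmod (g z))\<^sup>2"
      by linarith
    then show "norm (f z * cnj (g z)) \<le> norm ((cmod (f z))\<^sup>2 + (cmod (g z))\<^sup>2)"
      by (simp add: norm_mult)
  qed
qed

quotient_type (overloaded) 'a L2 = "'a::euclidean_space \<Rightarrow> complex" / partial:
  "\<lambda>f g. square_integrable f \<and> square_integrable g \<and> (AE z in lborel. f z = g z)"
proof (rule part_equivpI)
  show "\<exists>f :: 'a \<Rightarrow> complex. square_integrable f \<and> square_integrable f \<and> (AE z in lborel. f z = f z)"
    using square_integrable_zero by auto
  show "symp (\<lambda>f g :: 'a \<Rightarrow> complex. square_integrable f \<and> square_integrable g \<and> (AE z in lborel. f z = g z))"
    by (auto intro!: sympI elim: eventually_mono)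
  show "transp (\<lambda>f g :: 'a \<Rightarrow> complex. square_integrable f \<and> square_integrable g \<and> (AE z in lborel. f z = g z))"
  proof (rule transpI, elim conjE, intro conjI)
    fix f g h :: "'a \<Rightarrow> complex"
    assume "AE z in lborel. f z = g z" "AE z in lborel. g z = h z"
    then show "AE z in lborel. f z = h z" by eventually_elim simp
  qed
qed

text \<open>Multiplication by complex scalars and the Hermitian inner product, linear in the first
  argument.\<close>

lift_definition scaleC :: "complex \<Rightarrow> 'a::euclidean_space L2 \<Rightarrow> 'a L2" (infixr "*\<^sub>C" 75)
  is "\<lambda>c f z. c * f z"
  by (auto intro: square_integrable_scale elim: eventually_mono)

lift_definition cinner :: "'a::euclidean_space L2 \<Rightarrow> 'a L2 \<Rightarrow> complex"
  is "\<lambda>f g. LINT z|lborel. f z * cnj (g z)"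
proof (elim conjE, rule integral_cong_AE)
  fix f f' g g' :: "'a \<Rightarrow> complex"
  assume sq: "square_integrable f" "square_integrable g"
    "square_integrable f'" "square_integrable g'"
  note [measurable] = sq[THEN square_integrable_measurable]
  show "(\<lambda>z. f z * cnj (g z)) \<in> borel_measurable lborel"
    "(\<lambda>z. f' z * cnj (g' z)) \<in> borel_measurable lborel"
    by measurable
  assume "AE z in lborel. f z = f' z" "AE z in lborel. g z = g' z"
  then show "AE z in lborel. f z * cnj (g z) = f' z * cnj (g' z)" 
    by eventually_elim simp
qed

instantiation L2 :: (euclidean_space) real_vector
begin

lift_definition zero_L2 :: "'a L2" is "\<lambda>z. 0"
  by (simp add: square_integrable_zero)

lift_definition plus_L2 :: "'a L2 \<Rightarrow> 'a L2 \<Rightarrow> 'a L2" is "\<lambda>f g z. f z + g z"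
proof (elim conjE, intro conjI)
  fix f f' g g' :: "'a \<Rightarrow> complex"
  assume "square_integrable f" "square_integrable g"
    "square_integrable f'" "square_integrable g'"
  then show "square_integrable (\<lambda>z. f z + g z)" "square_integrable (\<lambda>z. f' z + g' z)"
    by (auto intro: square_integrable_add)
  assume "AE z in lborel. f z = f' z" "AE z in lborel. g z = g' z"
  then show "AE z in lborel. f z + g z = f' z + g' z"
    by eventually_elim simp
qed

definition scaleR_L2 :: "real \<Rightarrow> 'a L2 \<Rightarrow> 'a L2" where
  "r *\<^sub>R \<alpha> = complex_of_real r *\<^sub>C \<alpha>"

definition uminus_L2 :: "'a L2 \<Rightarrow> 'a L2" where
  "- \<alpha> = (- 1) *\<^sub>C \<alpha>"

definition minus_L2 :: "'a L2 \<Rightarrow> 'a L2 \<Rightarrow> 'a L2" where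
  "\<alpha> - \<beta> = \<alpha> + (- \<beta> :: 'a L2)"

instance
proof
  fix a b c :: "'a L2" and r s :: real
  show "a + b + c = a + (b + c)"
    by transfer (auto intro!: square_integrable_add simp: add.assoc)
  show "a + b = b + a"
    by transfer (auto intro!: square_integrable_add simp: add.commute)
  show "0 + a = a"
    by transfer (auto intro!: square_integrable_add)
  show "- a + a = 0"
    unfolding uminus_L2_def
    by transfer (auto intro!: square_integrable_add square_integrable_zero dest: square_integrable_scale[where c = "- 1"])
  show "a - b = a + - b"
    by (rule minus_L2_def)
  show "r *\<^sub>R (a + b) = r *\<^sub>R a + r *\<^sub>R b"
    unfolding scaleR_L2_def
    by transfer (auto intro!: square_integrable_add square_integrable_scale simp: distrib_left)
  show "(r + s) *\<^sub>R a = r *\<^sub>R a + s *\<^sub>R a"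
    unfolding scaleR_L2_def
    by transfer (auto intro!: square_integrable_add square_integrable_scale simp: distrib_right
          dest: square_integrable_scale[where c = "complex_of_real r + complex_of_real s"])
  show "r *\<^sub>R s *\<^sub>R a = (r * s) *\<^sub>R a"
    unfolding scaleR_L2_def
    by transfer (auto intro!: square_integrable_scale simp: mult.assoc[symmetric]
          dest: square_integrable_scale[where c = "complex_of_real r * complex_of_real s"])
  show "1 *\<^sub>R a = a"
    unfolding scaleR_L2_def by transfer auto
qed

end

instantiation L2 :: (euclidean_space) real_inner
begin

definition inner_L2 :: "'a L2 \<Rightarrow> 'a L2 \<Rightarrow> real" where
  "inner \<alpha> \<beta> = Re (cinner \<alpha> \<beta>)"

definition norm_L2 :: "'a L2 \<Rightarrow> real" where
  "norm (\<alpha> :: 'a L2) = sqrt (inner \<alpha> \<alpha>)"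

definition sgn_L2 :: "'a L2 \<Rightarrow> 'a L2" where
  "sgn (\<alpha> :: 'a L2) = \<alpha> /\<^sub>R norm \<alpha>"

definition dist_L2 :: "'a L2 \<Rightarrow> 'a L2 \<Rightarrow> real" where
  "dist (\<alpha> :: 'a L2) \<beta> = norm (\<alpha> - \<beta>)"

definition uniformity_L2 :: "('a L2 \<times> 'a L2) filter" where
  "uniformity_L2 = (INF e\<in>{0<..}. principal {(\<alpha> :: 'a L2, \<beta>). dist \<alpha> \<beta> < e})"

definition open_L2 :: "'a L2 set \<Rightarrow> bool" where
  "open_L2 U = (\<forall>\<alpha>\<in>U. eventually (\<lambda>(\<alpha>', \<beta>). \<alpha>' = \<alpha> \<longrightarrow> \<beta> \<in> U) uniformity)"

instance
proof
  fix a b c :: "'a L2" and r :: real and U :: "'a L2 set"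
  show "norm a = sqrt (inner a a)"
    by (rule norm_L2_def)
  show "sgn a = a /\<^sub>R norm a"
    by (rule sgn_L2_def)
  show "dist a b = norm (a - b)"
    by (rule dist_L2_def)
  show "uniformity = (INF e\<in>{0<..}. principal {(x :: 'a L2, y). dist x y < e})"
    by (rule uniformity_L2_def)
  show "open U = (\<forall>x\<in>U. \<forall>\<^sub>F (x', y) in uniformity. x' = x \<longrightarrow> y \<in> U)"
    by (rule open_L2_def)
  have "cinner b a = cnj (cinner a b)"
  proof transfer
    fix f g :: "'a \<Rightarrow> complex"
    have "(LINT z|lborel. f z * cnj (g z)) = (LINT z|lborel. cnj (g z * cnj (f z)))"
      by (simp add: mult.commute)
    also have "\<dots> = cnj (LINT z|lborel. g z * cnj (f z))"
      by (rule Bochner_Integration.integral_cnj)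
    finally show "(LINT z|lborel. f z * cnj (g z)) = cnj (LINT z|lborel. g z * cnj (f z))" .
  qed
  then show "inner a b = inner b a"
    by (simp add: inner_L2_def)
  have "cinner (a + b) c = cinner a c + cinner b c"
    by transfer (simp add: distrib_right integrable_mult_cnj)
  then show "inner (a + b) c = inner a c + inner b c"
    by (simp add: inner_L2_def)
  have "cinner (r *\<^sub>R a) b = r * cinner a b"
    unfolding scaleR_L2_def by transfer (simp add: mult.assoc)
  then show "inner (r *\<^sub>R a) b = r * inner a b"
    by (simp add: inner_L2_def)
  have ip: "inner a a \<ge> 0 \<and> (inner a a = 0 \<longleftrightarrow> a = 0)"
    unfolding inner_L2_def
  proof transfer
    fix f :: "'a \<Rightarrow> complex"
    assume "square_integrable f \<and> square_integrable f \<and> (AE z in lborel. f z = f z)"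
    then have f: "square_integrable f" by simp
    have "(\<lambda>z. f z * cnj (f z)) = (\<lambda>z. complex_of_real ((cmod (f z))\<^sup>2))"
      by (simp only: complex_norm_square)
    then have *: "Re (LINT z|lborel. f z * cnj (f z)) = (LINT z|lborel. (cmod (f z))\<^sup>2)"
      by (simp del: of_real_power)
    have "(LINT z|lborel. (cmod (f z))\<^sup>2) = 0 \<longleftrightarrow> (AE z in lborel. f z = 0)"
      using f by (subst integral_nonneg_eq_0_iff_AE) (auto simp: square_integrable_def)
    then show "Re (LINT z|lborel. f z * cnj (f z)) \<ge> 0 \<and>
         (Re (LINT z|lborel. f z * cnj (f z)) = 0) =
           (square_integrable f \<and> square_integrable (\<lambda>z. 0 :: complex) \<and> (AE z in lborel. f z = 0))"
      using f square_integrable_zero unfolding * by auto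
  qed
  then show "inner a a \<ge> 0" "(inner a a = 0) = (a = 0)"
    by auto
qed

end

lemma norm_abs_L2_squared:
  assumes "square_integrable f"
  shows "(norm (abs_L2 f))\<^sup>2 = (LINT z|lborel. (cmod (f z))\<^sup>2)"
proof -
  have "(\<lambda>z. f z * cnj (f z)) = (\<lambda>z. complex_of_real ((cmod (f z))\<^sup>2))"
    by (simp only: complex_norm_square)
  then have "inner (abs_L2 f) (abs_L2 f) = (LINT z|lborel. (cmod (f z))\<^sup>2)"
    unfolding inner_L2_def using assms
    by (subst cinner.abs_eq) (auto simp del: of_real_power)
  then show ?thesis
    by (simp add: power2_norm_eq_inner)
qed

lemma abs_L2_diff:
  assumes "square_integrable f" "square_integrable g"
  shows "square_integrable (\<lambda>z. f z - g z)" "abs_L2 f - abs_L2 g = abs_L2 (\<lambda>z. f z - g z)"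
proof -
  have m: "square_integrable (\<lambda>z. - 1 * g z)"
    by (rule square_integrable_scale[OF assms(2)])
  show "square_integrable (\<lambda>z. f z - g z)"
    using square_integrable_add[OF assms(1) m] by simp
  have "- abs_L2 g = abs_L2 (\<lambda>z. - 1 * g z)"
    unfolding uminus_L2_def using assms by (subst scaleC.abs_eq) auto
  then have "abs_L2 f - abs_L2 g = abs_L2 f + abs_L2 (\<lambda>z. - 1 * g z)"
    by (simp add: minus_L2_def)
  also have "\<dots> = abs_L2 (\<lambda>z. f z + - 1 * g z)"
    using assms m by (subst plus_L2.abs_eq) auto
  finally show "abs_L2 f - abs_L2 g = abs_L2 (\<lambda>z. f z - g z)"
    by simp
qed

lemma L2_cases:
  obtains f where "square_integrable f" "\<alpha> = abs_L2 f"
proof -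
  have "square_integrable (rep_L2 \<alpha>) \<and> \<alpha> = abs_L2 (rep_L2 \<alpha>)"
    using Quotient_rep_abs[OF Quotient_L2] Quotient_abs_rep[OF Quotient_L2]
      Quotient_rep_reflp[OF Quotient_L2, of \<alpha>]
    by metis
  then show ?thesis
    using that by blast
qed

text \<open>Riesz--Fischer.\<close>

instance L2 :: (euclidean_space) complete_space
proof
  fix X :: "nat \<Rightarrow> 'a L2"
  assume X: "Cauchy X"
  have "\<exists>f. \<forall>n. square_integrable (f n) \<and> X n = abs_L2 (f n)"
    by (intro choice allI) (metis L2_cases)
  then obtain f where f: "\<And>n. square_integrable (f n)" and Xf: "\<And>n. X n = abs_L2 (f n)"
    by blast
  note f[THEN square_integrable_measurable, measurable]
  have norm_diff: "(norm (X i - X j))\<^sup>2 = (LINT z|lborel. (cmod (f i z - f j z))\<^sup>2)" for i j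
    unfolding Xf abs_L2_diff(2)[OF f f] by (rule norm_abs_L2_squared) (rule abs_L2_diff[OF f f])

  obtain w :: "'a \<Rightarrow> real" where [measurable]: "w \<in> borel_measurable lborel"
    and w: "\<And>z. w z > 0" "integrable lborel w"
    using sigma_finite_measure.obtain_positive_integrable_function[OF sigma_finite_lborel] by metis
  define u where "u z = complex_of_real (sqrt (w z))" for z
  have [measurable]: "u \<in> borel_measurable lborel"
    unfolding u_def by measurable
  have u_nz: "u z \<noteq> 0" for z
    using w(1)[of z] by (simp add: u_def)
  have u: "square_integrable u"
    using w by (auto simp: square_integrable_def u_def less_imp_le)
  define s where "s n z = u z * f n z" for n z
  have s_int: "integrable lborel (s n)" for n
  proof -
    have "integrable lborel (\<lambda>z. f n z * cnj (u z))"
      by (rule integrable_mult_cnj[OF f u])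
    then show ?thesis
      by (simp add: s_def[abs_def] u_def mult.commute)
  qed
  have s_diff: "(LINT z|lborel. norm (s i z - s j z)) \<le> norm (abs_L2 u) * norm (X i - X j)" for i j
  proof -
    define d where "d z = complex_of_real (cmod (f i z - f j z))" for z
    have d: "square_integrable d"
      using abs_L2_diff(1)[OF f f, of i j] by (auto simp: square_integrable_def d_def[abs_def])
    have "(\<lambda>z. u z * cnj (d z)) = (\<lambda>z. complex_of_real (norm (s i z - s j z)))"
      using w(1) by (auto simp: u_def d_def s_def norm_mult less_imp_le abs_of_pos simp flip: right_diff_distrib)
    then have "(LINT z|lborel. norm (s i z - s j z)) = inner (abs_L2 u) (abs_L2 d)"
      unfolding inner_L2_def using u d by (subst cinner.abs_eq) (auto simp: eq_onp_def)
    also have "\<dots> \<le> norm (abs_L2 u) * norm (abs_L2 d)"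
      by (rule norm_cauchy_schwarz)
    also have "(norm (abs_L2 d))\<^sup>2 = (norm (X i - X j))\<^sup>2"
      unfolding norm_diff norm_abs_L2_squared[OF d] by (simp add: d_def)
    then have "norm (abs_L2 d) = norm (X i - X j)"
      by (simp add: power2_eq_iff_nonneg)
    finally show ?thesis .
  qed
  have "\<exists>N. \<forall>i\<ge>N. \<forall>j\<ge>N. (LINT z|lborel. norm (s i z - s j z)) < e" if e: "e > 0" for e
  proof -
    define K where "K = norm (abs_L2 u) + 1"
    have K: "K > 0" "norm (abs_L2 u) \<le> K"
      by (auto simp: K_def intro: add_nonneg_pos)
    obtain N where N: "\<And>i j. i \<ge> N \<Longrightarrow> j \<ge> N \<Longrightarrow> norm (X i - X j) < e / K"
      using X[unfolded Cauchy_iff, rule_format, OF divide_pos_pos[OF e K(1)]] by blast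
    have "(LINT z|lborel. norm (s i z - s j z)) < e" if "i \<ge> N" "j \<ge> N" for i j
    proof -
      have "(LINT z|lborel. norm (s i z - s j z)) \<le> K * norm (X i - X j)"
        using s_diff[of i j] mult_right_mono[OF K(2), of "norm (X i - X j)"] by simp
      also have "\<dots> < e"
        using N[OF that] K(1) by (simp add: field_simps)
      finally show ?thesis .
    qed
    then show ?thesis by blast
  qed
  from cauchy_L1_AE_cauchy_subseq[OF s_int this]
  obtain r where r: "strict_mono r" and r_Cauchy: "AE z in lborel. Cauchy (\<lambda>i. s (r i) z)"
    by blast
  define g where "g z = lim (\<lambda>i. f (r i) z)" for z
  have [measurable]: "g \<in> borel_measurable lborel"
    unfolding g_def[abs_def] by measurable
  have lim_g: "AE z in lborel. (\<lambda>i. f (r i) z) \<longlonglongrightarrow> g z"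
    using r_Cauchy
  proof eventually_elim
    fix z
    assume "Cauchy (\<lambda>i. s (r i) z)"
    then have "convergent (\<lambda>i. s (r i) z)"
      by (rule Cauchy_convergent)
    then obtain l where "(\<lambda>i. s (r i) z) \<longlonglongrightarrow> l"
      by (auto simp: convergent_def)
    then have "(\<lambda>i. s (r i) z / u z) \<longlonglongrightarrow> l / u z"
      by (intro tendsto_intros u_nz)
    then have "(\<lambda>i. f (r i) z) \<longlonglongrightarrow> l / u z"
      using u_nz by (simp add: s_def)
    then show "(\<lambda>i. f (r i) z) \<longlonglongrightarrow> g z"
      by (simp add: g_def limI)
  qed

  have close: "\<exists>N. \<forall>n\<ge>N. (\<integral>\<^sup>+z. ennreal ((cmod (f n z - g z))\<^sup>2) \<partial>lborel) \<le> ennreal (e\<^sup>2)"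
    if e: "e > 0" for e :: real
  proof -
    obtain N where N: "\<And>i j. i \<ge> N \<Longrightarrow> j \<ge> N \<Longrightarrow> norm (X i - X j) < e"
      using X[unfolded Cauchy_iff, rule_format, OF e] by blast
    have "(\<integral>\<^sup>+z. ennreal ((cmod (f n z - g z))\<^sup>2) \<partial>lborel) \<le> ennreal (e\<^sup>2)" if n: "n \<ge> N" for n
    proof -
      have "(\<integral>\<^sup>+z. ennreal ((cmod (f n z - g z))\<^sup>2) \<partial>lborel)
          = (\<integral>\<^sup>+z. liminf (\<lambda>i. ennreal ((cmod (f n z - f (r i) z))\<^sup>2)) \<partial>lborel)"
      proof (rule nn_integral_cong_AE, use lim_g in eventually_elim)
        fix z
        assume "(\<lambda>i. f (r i) z) \<longlonglongrightarrow> g z"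
        then have "(\<lambda>i. ennreal ((cmod (f n z - f (r i) z))\<^sup>2)) \<longlonglongrightarrow> ennreal ((cmod (f n z - g z))\<^sup>2)"
          by (intro tendsto_intros tendsto_ennrealI)
        then show "ennreal ((cmod (f n z - g z))\<^sup>2) = liminf (\<lambda>i. ennreal ((cmod (f n z - f (r i) z))\<^sup>2))"
          by (rule lim_imp_Liminf[OF sequentially_bot, symmetric])
      qed
      also have "\<dots> \<le> liminf (\<lambda>i. \<integral>\<^sup>+z. ennreal ((cmod (f n z - f (r i) z))\<^sup>2) \<partial>lborel)"
        by (rule nn_integral_liminf) measurable
      also have "\<dots> \<le> ennreal (e\<^sup>2)"
      proof -
        have "(\<integral>\<^sup>+z. ennreal ((cmod (f n z - f (r i) z))\<^sup>2) \<partial>lborel) \<le> ennreal (e\<^sup>2)" if "i \<ge> N" for i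
        proof -
          have "r i \<ge> N"
            using seq_suble[OF r, of i] that by linarith
          then have "(norm (X n - X (r i)))\<^sup>2 \<le> e\<^sup>2"
            using N[OF n, of "r i"] by (intro power_mono) auto
          moreover have "integrable lborel (\<lambda>z. (cmod (f n z - f (r i) z))\<^sup>2)"
            using abs_L2_diff(1)[OF f f] by (simp add: square_integrable_def)
          ultimately show ?thesis
            unfolding norm_diff by (subst nn_integral_eq_integral) (auto intro: ennreal_leI)
        qed
        then have ev: "eventually (\<lambda>i. (\<integral>\<^sup>+z. ennreal ((cmod (f n z - f (r i) z))\<^sup>2) \<partial>lborel) \<le> ennreal (e\<^sup>2)) sequentially"
          by (auto simp: eventually_sequentially)
        have "liminf (\<lambda>i. \<integral>\<^sup>+z. ennreal ((cmod (f n z - f (r i) z))\<^sup>2) \<partial>lborel)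
            \<le> limsup (\<lambda>i. \<integral>\<^sup>+z. ennreal ((cmod (f n z - f (r i) z))\<^sup>2) \<partial>lborel)"
          by (rule Liminf_le_Limsup) simp
        also have "\<dots> \<le> ennreal (e\<^sup>2)"
          by (rule Limsup_bounded[OF ev])
        finally show ?thesis .
      qed
      finally show ?thesis .
    qed
    then show ?thesis by blast
  qed
  have int_close: "square_integrable (\<lambda>z. f n z - g z)"
    if "(\<integral>\<^sup>+z. ennreal ((cmod (f n z - g z))\<^sup>2) \<partial>lborel) \<le> ennreal (e\<^sup>2)" for n and e :: real
    unfolding square_integrable_def
  proof
    show "(\<lambda>z. f n z - g z) \<in> borel_measurable lborel" by measurable
    have "(\<integral>\<^sup>+z. ennreal ((cmod (f n z - g z))\<^sup>2) \<partial>lborel) < \<infinity>"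
      using that by (metis ennreal_less_top infinity_ennreal_def order_le_less_trans)
    then show "integrable lborel (\<lambda>z. (cmod (f n z - g z))\<^sup>2)"
      by (intro integrableI_nonneg) auto
  qed
  have g: "square_integrable g"
  proof -
    obtain N where "\<forall>n\<ge>N. (\<integral>\<^sup>+z. ennreal ((cmod (f n z - g z))\<^sup>2) \<partial>lborel) \<le> ennreal (1\<^sup>2)"
      using close[of 1] by auto
    then have "square_integrable (\<lambda>z. f N z - g z)"
      by (intro int_close[of N 1]) auto
    from abs_L2_diff(1)[OF f[of N] this] show ?thesis by simp
  qed
  have "X \<longlonglongrightarrow> abs_L2 g"
  proof (rule LIMSEQ_I)
    fix e :: real
    assume "e > 0"
    then obtain N where N: "\<And>n. n \<ge> N \<Longrightarrow>
        (\<integral>\<^sup>+z. ennreal ((cmod (f n z - g z))\<^sup>2) \<partial>lborel) \<le> ennreal ((e/2)\<^sup>2)"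
      using close[of "e/2"] by auto
    have "norm (X n - abs_L2 g) < e" if "n \<ge> N" for n
    proof -
      note sq = int_close[OF N[OF that]]
      have "ennreal (LINT z|lborel. (cmod (f n z - g z))\<^sup>2)
          = (\<integral>\<^sup>+z. ennreal ((cmod (f n z - g z))\<^sup>2) \<partial>lborel)"
        using sq by (subst nn_integral_eq_integral) (auto simp: square_integrable_def)
      with N[OF that] have "ennreal (LINT z|lborel. (cmod (f n z - g z))\<^sup>2) \<le> ennreal ((e/2)\<^sup>2)"
        by (simp only:)
      then have "(LINT z|lborel. (cmod (f n z - g z))\<^sup>2) \<le> (e/2)\<^sup>2"
        by (subst (asm) ennreal_le_iff) auto
      then have "(norm (X n - abs_L2 g))\<^sup>2 \<le> (e/2)\<^sup>2"
        unfolding Xf abs_L2_diff(2)[OF f g] norm_abs_L2_squared[OF sq] .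
      then have "norm (X n - abs_L2 g) \<le> e/2"
        using \<open>e > 0\<close> by - (rule power2_le_imp_le, auto)
      then show ?thesis
        using \<open>e > 0\<close> by simp
    qed
    then show "\<exists>N. \<forall>n\<ge>N. norm (X n - abs_L2 g) < e" by blast
  qed
  then show "convergent X"
    by (auto simp: convergent_def)
qed


section \<open>Smooth maps between subsets of normed spaces\<close>

text \<open>
  Smoothness (class \<open>C\<^sup>\<infinity>\<close> in the sense of Frechet) of \<open>f\<close> on a relatively open subset \<open>U\<close> of a
  linear subspace \<open>E\<close>.  The value \<open>D x [v\<^sub>1, \<dots>, v\<^sub>n]\<close> is the \<open>n\<close>-th derivative of \<open>f\<close> at \<open>x\<close>, applied
  to \<open>v\<^sub>1, \<dots>, v\<^sub>n \<in> E\<close>: each \<open>D x\<close> is a bounded \<open>n\<close>-linear map on lists of length \<open>n\<close>, and the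
  \<open>(n + 1)\<close>-st derivative is the Frechet derivative of the \<open>n\<close>-th one with respect to the operator
  norm on bounded \<open>n\<close>-linear maps, the new direction being put in front.
\<close>

definition bounded_multilinear_on ::
    "'a::real_normed_vector set \<Rightarrow> nat \<Rightarrow> ('a list \<Rightarrow> 'b::real_normed_vector) \<Rightarrow> bool" where
  "bounded_multilinear_on E n L \<longleftrightarrow>
     (\<forall>us ws. \<forall>v\<in>E. \<forall>v'\<in>E. set us \<subseteq> E \<and> set ws \<subseteq> E \<and> length us + 1 + length ws = n \<longrightarrow>
        L (us @ (v + v') # ws) = L (us @ v # ws) + L (us @ v' # ws)) \<and>
     (\<forall>us ws r. \<forall>v\<in>E. set us \<subseteq> E \<and> set ws \<subseteq> E \<and> length us + 1 + length ws = n \<longrightarrow>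
        L (us @ (r *\<^sub>R v) # ws) = r *\<^sub>R L (us @ v # ws)) \<and>
     (\<exists>B. \<forall>vs. set vs \<subseteq> E \<and> length vs = n \<longrightarrow> norm (L vs) \<le> B * prod_list (map norm vs))"

definition smooth_on ::
    "'a::real_normed_vector set \<Rightarrow> 'a set \<Rightarrow> ('a \<Rightarrow> 'b::real_normed_vector) \<Rightarrow> bool" where
  "smooth_on E U f \<longleftrightarrow>
     (\<exists>D :: 'a \<Rightarrow> 'a list \<Rightarrow> 'b. \<forall>x\<in>U.
        D x [] = f x \<and>
        (\<forall>n. bounded_multilinear_on E n (D x) \<and>
          (\<forall>\<epsilon>>0. \<exists>\<delta>>0. \<forall>y\<in>U. norm (y - x) < \<delta> \<longrightarrow>
            (\<forall>vs. set vs \<subseteq> E \<and> length vs = n \<longrightarrow>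
              norm (D y vs - D x vs - D x ((y - x) # vs))
                \<le> \<epsilon> * norm (y - x) * prod_list (map norm vs)))))"


section \<open>Hilbert manifolds\<close>

text \<open>
  A chart maps its domain \<open>cdom\<close> bijectively onto a relatively open subset of a closed linear
  subspace \<open>cmodel\<close> (itself a Hilbert space) of the Hilbert space \<open>'e\<close>.  A manifold is given by an
  atlas; its topology and smooth structure are the ones induced by the atlas.
\<close>

datatype ('m, 'e) chart =
  Chart (cdom: "'m set") (cmodel: "'e set") (ccoord: "'m \<Rightarrow> 'e")

definition cinv :: "('m, 'e) chart \<Rightarrow> 'e \<Rightarrow> 'm" where
  "cinv c = inv_into (cdom c) (ccoord c)"

definition crange :: "('m, 'e) chart \<Rightarrow> 'e set" where
  "crange c = ccoord c ` cdom c"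

definition points :: "('m, 'e) chart set \<Rightarrow> 'm set" where
  "points A = (\<Union>c\<in>A. cdom c)"

definition charts_at :: "('m, 'e) chart set \<Rightarrow> 'm \<Rightarrow> ('m, 'e) chart set" where
  "charts_at A p = {c\<in>A. p \<in> cdom c}"

definition smooth_atlas :: "('m, 'e::{real_inner,complete_space}) chart set \<Rightarrow> bool" where
  "smooth_atlas A \<longleftrightarrow>
     (\<forall>c\<in>A. subspace (cmodel c) \<and> closed (cmodel c) \<and> inj_on (ccoord c) (cdom c) \<and>
        openin (top_of_set (cmodel c)) (crange c)) \<and>
     (\<forall>c\<in>A. \<forall>d\<in>A. openin (top_of_set (cmodel c)) (ccoord c ` (cdom c \<inter> cdom d)) \<and>
        smooth_on (cmodel c) (ccoord c ` (cdom c \<inter> cdom d)) (ccoord d \<circ> cinv c))"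

definition manifold_open :: "('m, 'e::topological_space) chart set \<Rightarrow> 'm set \<Rightarrow> bool" where
  "manifold_open A U \<longleftrightarrow> U \<subseteq> points A \<and>
     (\<forall>c\<in>A. openin (top_of_set (cmodel c)) (ccoord c ` (U \<inter> cdom c)))"

definition hilbert_manifold :: "'m set \<Rightarrow> ('m, 'e::{real_inner,complete_space}) chart set \<Rightarrow> bool" where
  "hilbert_manifold M A \<longleftrightarrow> smooth_atlas A \<and> points A = M \<and>
     (\<forall>p\<in>M. \<forall>q\<in>M. p \<noteq> q \<longrightarrow>
        (\<exists>U V. manifold_open A U \<and> manifold_open A V \<and> p \<in> U \<and> q \<in> V \<and> U \<inter> V = {}))"

definition smooth_function ::
    "('m, 'e::real_normed_vector) chart set \<Rightarrow> ('m \<Rightarrow> 'b::real_normed_vector) \<Rightarrow> bool" where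
  "smooth_function A f \<longleftrightarrow> (\<forall>c\<in>A. smooth_on (cmodel c) (crange c) (f \<circ> cinv c))"

definition smooth_map ::
    "('m, 'e::real_normed_vector) chart set \<Rightarrow> ('n, 'f::real_normed_vector) chart set
      \<Rightarrow> ('m \<Rightarrow> 'n) \<Rightarrow> bool" where
  "smooth_map A B f \<longleftrightarrow> f ` points A \<subseteq> points B \<and>
     (\<forall>c\<in>A. \<forall>d\<in>B. openin (top_of_set (cmodel c)) (ccoord c ` (cdom c \<inter> f -` cdom d)) \<and>
        smooth_on (cmodel c) (ccoord c ` (cdom c \<inter> f -` cdom d)) (ccoord d \<circ> f \<circ> cinv c))"


subsection \<open>Tangent vectors and differentials\<close>

text \<open>
  A tangent vector at \<open>p\<close> is the family of its coordinate vectors in all charts around \<open>p\<close>, related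
  by the derivatives of the chart transitions (and \<open>0\<close> at the charts that do not contain \<open>p\<close>).
  Derivatives are taken within the model space; \<^const>\<open>frechet_derivative\<close> is then only
  determined on the model space, and it is only applied to vectors of the model space.
\<close>

type_synonym ('m, 'e) tangent = "('m, 'e) chart \<Rightarrow> 'e"

definition chart_deriv ::
    "('m, 'e::real_normed_vector) chart \<Rightarrow> ('m \<Rightarrow> 'b::real_normed_vector) \<Rightarrow> 'm \<Rightarrow> 'e \<Rightarrow> 'b" where
  "chart_deriv c f p = frechet_derivative (f \<circ> cinv c) (at (ccoord c p) within cmodel c)"

definition tangent_space ::
    "('m, 'e::real_normed_vector) chart set \<Rightarrow> 'm \<Rightarrow> ('m, 'e) tangent set" where
  "tangent_space A p =
     {v. (\<forall>c\<in>charts_at A p. v c \<in> cmodel c) \<and>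
         (\<forall>c\<in>charts_at A p. \<forall>d\<in>charts_at A p. v d = chart_deriv c (ccoord d) p (v c)) \<and>
         (\<forall>c. c \<notin> charts_at A p \<longrightarrow> v c = 0)}"

definition tangent_of_coord ::
    "('m, 'e::real_normed_vector) chart set \<Rightarrow> ('m, 'e) chart \<Rightarrow> 'm \<Rightarrow> 'e \<Rightarrow> ('m, 'e) tangent" where
  "tangent_of_coord A c p u =
     (\<lambda>d. if d \<in> charts_at A p then chart_deriv c (ccoord d) p u else 0)"

definition tangent_add :: "('m, 'e::real_vector) tangent \<Rightarrow> ('m, 'e) tangent \<Rightarrow> ('m, 'e) tangent" where
  "tangent_add v w = (\<lambda>c. v c + w c)"

definition tangent_scale :: "real \<Rightarrow> ('m, 'e::real_vector) tangent \<Rightarrow> ('m, 'e) tangent" where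
  "tangent_scale r v = (\<lambda>c. r *\<^sub>R v c)"

text \<open>
  The differential at \<open>p\<close> of a function with values in a normed space, and of a map between
  manifolds.  For tangent vectors \<open>v\<close> at \<open>p\<close> it does not depend on the choice of the chart.
\<close>

definition dfun ::
    "('m, 'e::real_normed_vector) chart set \<Rightarrow> ('m \<Rightarrow> 'b::real_normed_vector)
      \<Rightarrow> 'm \<Rightarrow> ('m, 'e) tangent \<Rightarrow> 'b" where
  "dfun A f p v = (let c = (SOME c. c \<in> charts_at A p) in chart_deriv c f p (v c))"

definition dmap ::
    "('m, 'e::real_normed_vector) chart set \<Rightarrow> ('n, 'f::real_normed_vector) chart set
      \<Rightarrow> ('m \<Rightarrow> 'n) \<Rightarrow> 'm \<Rightarrow> ('m, 'e) tangent \<Rightarrow> ('n, 'f) tangent" where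
  "dmap A B f p v = (\<lambda>d. if d \<in> charts_at B (f p) then dfun A (ccoord d \<circ> f) p v else 0)"

text \<open>In Hilbert spaces closed subspaces are complemented, so no splitting condition is needed for
  immersions with closed range, submersions, and (below) regular values.\<close>

definition smooth_embedding ::
    "('m, 'e::real_normed_vector) chart set \<Rightarrow> ('m \<Rightarrow> 'b::real_normed_vector) \<Rightarrow> bool" where
  "smooth_embedding A f \<longleftrightarrow> smooth_function A f \<and> inj_on f (points A) \<and>
     (\<forall>U. manifold_open A U \<longleftrightarrow> (\<exists>V. open V \<and> U = points A \<inter> f -` V)) \<and>
     (\<forall>p\<in>points A. inj_on (dfun A f p) (tangent_space A p) \<and>
        closed (dfun A f p ` tangent_space A p))"

definition smooth_submersion ::
    "('m, 'e::real_normed_vector) chart set \<Rightarrow> ('n, 'f::real_normed_vector) chart set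
      \<Rightarrow> ('m \<Rightarrow> 'n) \<Rightarrow> bool" where
  "smooth_submersion A B f \<longleftrightarrow> smooth_map A B f \<and>
     (\<forall>p\<in>points A. dmap A B f p ` tangent_space A p = tangent_space B (f p))"

text \<open>Vector fields are taken to vanish off the manifold, so that equality of vector fields is
  equality on the manifold.\<close>

definition vector_field ::
    "('m, 'e::real_normed_vector) chart set \<Rightarrow> ('m \<Rightarrow> ('m, 'e) tangent) \<Rightarrow> bool" where
  "vector_field A X \<longleftrightarrow>
     (\<forall>p\<in>points A. X p \<in> tangent_space A p) \<and> (\<forall>p. p \<notin> points A \<longrightarrow> X p = (\<lambda>_. 0))"

definition pushforward_field ::
    "('m, 'e::real_normed_vector) chart set \<Rightarrow> ('n, 'f::real_normed_vector) chart set
      \<Rightarrow> ('m \<Rightarrow> 'n) \<Rightarrow> ('m \<Rightarrow> ('m, 'e) tangent) \<Rightarrow> 'n \<Rightarrow> ('n, 'f) tangent" where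
  "pushforward_field A B f X q =
     (let p = (SOME p. p \<in> points A \<and> f p = q) in dmap A B f p (X p))"


subsection \<open>Differential 2-forms\<close>

text \<open>Forms are taken to vanish outside the tangent spaces, so that equality of forms is equality
  on the tangent spaces.\<close>

type_synonym ('m, 'e) form2 = "'m \<Rightarrow> ('m, 'e) tangent \<Rightarrow> ('m, 'e) tangent \<Rightarrow> real"

definition local_form ::
    "('m, 'e::real_normed_vector) chart set \<Rightarrow> ('m, 'e) form2 \<Rightarrow> ('m, 'e) chart
      \<Rightarrow> 'e \<Rightarrow> 'e \<Rightarrow> 'e \<Rightarrow> real" where
  "local_form A \<omega> c x u v =
     \<omega> (cinv c x) (tangent_of_coord A c (cinv c x) u) (tangent_of_coord A c (cinv c x) v)"

definition smooth_2form :: "('m, 'e::real_normed_vector) chart set \<Rightarrow> ('m, 'e) form2 \<Rightarrow> bool" where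
  "smooth_2form A \<omega> \<longleftrightarrow>
     (\<forall>p v w. \<not> (p \<in> points A \<and> v \<in> tangent_space A p \<and> w \<in> tangent_space A p) \<longrightarrow> \<omega> p v w = 0) \<and>
     (\<forall>p\<in>points A. \<forall>u\<in>tangent_space A p. \<forall>v\<in>tangent_space A p. \<forall>w\<in>tangent_space A p. \<forall>r.
        \<omega> p v w = - \<omega> p w v \<and>
        \<omega> p (tangent_add u v) w = \<omega> p u w + \<omega> p v w \<and>
        \<omega> p (tangent_scale r v) w = r * \<omega> p v w) \<and>
     (\<forall>c\<in>A. smooth_on (cmodel c \<times> cmodel c \<times> cmodel c) (crange c \<times> cmodel c \<times> cmodel c)
        (\<lambda>(x, u, v). local_form A \<omega> c x u v))"

text \<open>The exterior derivative in a chart, on constant vector fields.\<close>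

definition local_ext_deriv ::
    "('m, 'e::real_normed_vector) chart set \<Rightarrow> ('m, 'e) form2 \<Rightarrow> ('m, 'e) chart
      \<Rightarrow> 'e \<Rightarrow> 'e \<Rightarrow> 'e \<Rightarrow> 'e \<Rightarrow> real" where
  "local_ext_deriv A \<omega> c x u v w =
     frechet_derivative (\<lambda>y. local_form A \<omega> c y v w) (at x within cmodel c) u
     - frechet_derivative (\<lambda>y. local_form A \<omega> c y u w) (at x within cmodel c) v
     + frechet_derivative (\<lambda>y. local_form A \<omega> c y u v) (at x within cmodel c) w"

definition closed_2form :: "('m, 'e::real_normed_vector) chart set \<Rightarrow> ('m, 'e) form2 \<Rightarrow> bool" where
  "closed_2form A \<omega> \<longleftrightarrow>
     (\<forall>c\<in>A. \<forall>x\<in>crange c. \<forall>u\<in>cmodel c. \<forall>v\<in>cmodel c. \<forall>w\<in>cmodel c.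
        local_ext_deriv A \<omega> c x u v w = 0)"

definition symplectic_form :: "('m, 'e::real_normed_vector) chart set \<Rightarrow> ('m, 'e) form2 \<Rightarrow> bool" where
  "symplectic_form A \<omega> \<longleftrightarrow> smooth_2form A \<omega> \<and> closed_2form A \<omega> \<and>
     (\<forall>p\<in>points A. \<forall>v\<in>tangent_space A p.
        (\<forall>w\<in>tangent_space A p. \<omega> p v w = 0) \<longrightarrow> v = (\<lambda>_. 0))"

definition pullback_form ::
    "('m, 'e::real_normed_vector) chart set \<Rightarrow> ('n, 'f::real_normed_vector) chart set
      \<Rightarrow> ('m \<Rightarrow> 'n) \<Rightarrow> ('n, 'f) form2 \<Rightarrow> ('m, 'e) form2" where
  "pullback_form A B f \<omega> = (\<lambda>p v w.
     if p \<in> points A \<and> v \<in> tangent_space A p \<and> w \<in> tangent_space A p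
     then \<omega> (f p) (dmap A B f p v) (dmap A B f p w) else 0)"

text \<open>The pull-back of a constant form \<open>\<omega>\<close> on a vector space.\<close>

definition pullback_const_form ::
    "('m, 'e::real_normed_vector) chart set \<Rightarrow> ('m \<Rightarrow> 'b::real_normed_vector)
      \<Rightarrow> ('b \<Rightarrow> 'b \<Rightarrow> real) \<Rightarrow> ('m, 'e) form2" where
  "pullback_const_form A f \<omega> = (\<lambda>p v w.
     if p \<in> points A \<and> v \<in> tangent_space A p \<and> w \<in> tangent_space A p
     then \<omega> (dfun A f p v) (dfun A f p w) else 0)"

definition hamiltonian_field ::
    "('m, 'e::real_normed_vector) chart set \<Rightarrow> ('m, 'e) form2 \<Rightarrow> ('m \<Rightarrow> real)
      \<Rightarrow> ('m \<Rightarrow> ('m, 'e) tangent) \<Rightarrow> bool" where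
  "hamiltonian_field A \<omega> H X \<longleftrightarrow> vector_field A X \<and>
     (\<forall>p\<in>points A. \<forall>v\<in>tangent_space A p. dfun A H p v = - \<omega> p (X p) v)"


section \<open>Symplectic vector spaces\<close>

definition symplectic_vector_space :: "('v::real_normed_vector \<Rightarrow> 'v \<Rightarrow> real) \<Rightarrow> bool" where
  "symplectic_vector_space \<omega> \<longleftrightarrow> bounded_bilinear \<omega> \<and> (\<forall>v w. \<omega> v w = - \<omega> w v) \<and>
     (\<forall>v. (\<forall>w. \<omega> v w = 0) \<longrightarrow> v = 0)"

definition hamiltonian_field_vs ::
    "('v::real_normed_vector \<Rightarrow> 'v \<Rightarrow> real) \<Rightarrow> ('v \<Rightarrow> real) \<Rightarrow> ('v \<Rightarrow> 'v) \<Rightarrow> bool" where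
  "hamiltonian_field_vs \<omega> H X \<longleftrightarrow> (\<forall>v. (H has_derivative (\<lambda>w. - \<omega> (X v) w)) (at v))"

text \<open>
  \<open>J\<close> is a moment map of an action of the circle group: the Hamiltonian vector field of \<open>\<xi> J\<close> is the
  infinitesimal generator of \<open>\<xi>\<close>, for every \<open>\<xi>\<close> in the Lie algebra, and \<open>J\<close> is equivariant (which
  means invariant, as the group is abelian).  The Lie algebra \<open>\<i>\<real>\<close> of the circle is identified with
  \<open>\<real>\<close> via \<open>\<xi> \<mapsto> - \<i> \<xi>\<close>; with the sign convention for Hamiltonian vector fields used here, this
  is the identification for which \<open>\<parallel>\<alpha>\<parallel>\<^sup>2 / 2\<close> rather than its negative is a moment map of
  \<open>\<alpha> \<mapsto> \<zeta> \<alpha>\<close>.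
\<close>

definition circle_moment_map ::
    "('v::real_normed_vector \<Rightarrow> 'v \<Rightarrow> real) \<Rightarrow> (complex \<Rightarrow> 'v \<Rightarrow> 'v) \<Rightarrow> ('v \<Rightarrow> real) \<Rightarrow> bool" where
  "circle_moment_map \<omega> act J \<longleftrightarrow> smooth_on UNIV UNIV J \<and>
     (\<forall>\<zeta> v. cmod \<zeta> = 1 \<longrightarrow> J (act \<zeta> v) = J v) \<and>
     (\<forall>\<xi>. \<exists>Z. (\<forall>v. ((\<lambda>t. act (exp (- \<i> * complex_of_real (t * \<xi>))) v) has_vector_derivative Z v) (at 0)) \<and>
        hamiltonian_field_vs \<omega> (\<lambda>v. \<xi> * J v) Z)"

definition regular_value :: "('v::real_normed_vector \<Rightarrow> 'b::real_normed_vector) \<Rightarrow> 'b \<Rightarrow> bool" where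
  "regular_value f y \<longleftrightarrow> (\<forall>x. f x = y \<longrightarrow> (\<exists>D. (f has_derivative D) (at x) \<and> surj D))"


section \<open>The unit sphere of \<open>L\<^sup>2\<close> and its quotient by the circle action\<close>

definition omega :: "'a::euclidean_space L2 \<Rightarrow> 'a L2 \<Rightarrow> real" where
  "omega \<alpha> \<beta> = Im (cinner \<alpha> \<beta>)"

definition orbit :: "'a::euclidean_space L2 \<Rightarrow> 'a L2 set" where
  "orbit \<alpha> = (\<lambda>\<zeta>. \<zeta> *\<^sub>C \<alpha>) ` {\<zeta>. cmod \<zeta> = 1}"

type_synonym 'd L2z = "((real ^ 'd) \<times> (real ^ 'd)) L2"

definition half_norm_sq :: "'a::euclidean_space L2 \<Rightarrow> real" where
  "half_norm_sq \<alpha> = 1 / 2 * (norm \<alpha>)\<^sup>2"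

text \<open>Orthogonal projection of an open hemisphere onto the real hyperplane orthogonal to its
  pole \<open>\<phi>\<close>.\<close>

definition sphere_chart :: "'a::euclidean_space L2 \<Rightarrow> ('a L2, 'a L2) chart" where
  "sphere_chart \<phi> = Chart {\<alpha>\<in>sphere 0 1. inner \<alpha> \<phi> > 0} {v. inner v \<phi> = 0}
     (\<lambda>\<alpha>. \<alpha> - inner \<alpha> \<phi> *\<^sub>R \<phi>)"

definition sphere_atlas :: "('a::euclidean_space L2, 'a L2) chart set" where
  "sphere_atlas = sphere_chart ` sphere 0 1"

text \<open>The affine charts of projective space: the orbit of \<open>\<alpha>\<close> is mapped to
  \<open>\<langle>\<alpha>, \<phi>\<rangle>\<^sup>-\<^sup>1 \<alpha> - \<phi>\<close>, which does not depend on the choice of \<open>\<alpha>\<close> in its orbit and lies in the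
  complex hyperplane orthogonal to \<open>\<phi>\<close>.\<close>

definition quotient_chart :: "'a::euclidean_space L2 \<Rightarrow> ('a L2 set, 'a L2) chart" where
  "quotient_chart \<phi> = Chart (orbit ` {\<alpha>\<in>sphere 0 1. cinner \<alpha> \<phi> \<noteq> 0}) {v. cinner v \<phi> = 0}
     (\<lambda>p. let \<alpha> = (SOME \<alpha>. \<alpha> \<in> p) in (1 / cinner \<alpha> \<phi>) *\<^sub>C \<alpha> - \<phi>)"

definition quotient_atlas :: "('a::euclidean_space L2 set, 'a L2) chart set" where
  "quotient_atlas = quotient_chart ` sphere 0 1"

end

theory Submission
  imports Defs
begin

text \<open>
  The quotient is projective Hilbert space, and \<open>\<omega>'\<close> is the Fubini--Study form.  Fix a point \<open>\<alpha>\<close> of the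
  sphere.  Its tangent space there is the real hyperplane \<open>{w. Re \<langle>w, \<alpha>\<rangle> = 0}\<close>, which is the direct sum of
  the direction \<open>\<real> \<i> \<alpha>\<close> of the orbit and of the complex hyperplane \<open>{w. \<langle>w, \<alpha>\<rangle> = 0}\<close> of horizontal
  vectors.  The differential of the projection kills the first summand and maps the second one
  isomorphically onto the tangent space of the quotient, while \<open>\<omega>\<close>, restricted to the sphere, has exactly
  the first summand as its kernel.  So \<open>\<iota>\<^sup>* \<omega> = \<Pi>\<^sup>* \<omega>'\<close> says that \<open>\<omega>'\<close> is \<open>\<omega>\<close> on horizontal lifts.  This
  leaves at most one \<open>\<omega>'\<close> (\<open>form_unique_by_pullback\<close>); it does define one, because a change of the point in
  the orbit multiplies both lifts by the same unit scalar (\<open>reduced_form_eq\<close>, \<open>reduced_form_pullback\<close>).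
  The form is nondegenerate because the horizontal space is invariant under \<open>\<i>\<close> and
  \<open>\<omega>(w, \<i> w) = - \<parallel>w\<parallel>\<^sup>2\<close> (\<open>reduced_form_nondegenerate\<close>).  In the affine chart with pole \<open>\<phi>\<close> it is
  \<open>Im \<langle>u, v\<rangle> / (1 + \<parallel>x\<parallel>\<^sup>2) - Im (\<langle>u, x\<rangle> \<langle>x, v\<rangle>) / (1 + \<parallel>x\<parallel>\<^sup>2)\<^sup>2\<close>, which is visibly smooth; the terms of
  the cyclic sum of its derivatives cancel, so it is closed (\<open>local_reduced_form\<close>, \<open>closed_reduced_form\<close>).

  For the second half, the invariance of \<open>H\<close> gives \<open>DH(\<alpha>)(\<i> \<alpha>) = 0\<close>, that is \<open>Re \<langle>X \<alpha>, \<alpha>\<rangle> = 0\<close>: the field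
  \<open>X\<close> is tangent to the sphere (\<open>hamiltonian_field_tangent\<close>).  Restricted to horizontal \<open>w\<close>, the equation
  \<open>DH(\<alpha>) w = - \<omega>(X \<alpha>, w)\<close> is the Hamiltonian equation of the quotient for the vector \<open>d\<Pi>(X \<alpha>)\<close>
  (\<open>reduced_hamiltonian_equation\<close>).  Since \<open>\<omega>'\<close> is nondegenerate, this vector is the value of the reduced
  Hamiltonian field, whichever \<open>\<alpha>\<close> in the orbit was used
  (\<open>reduced_hamiltonian_field_unique\<close>).  The field \<open>X\<close> exists by the Riesz representation theorem.

  Two devices keep the analysis short.  Smoothness is established once, for maps on open subsets of the
  whole Hilbert space, from the chain rule \<open>smooth_on_compose\<close>; every local expression on the two
  manifolds is the restriction of such a map to the model space of a chart.  Tangent vectors are handled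
  as velocities of curves, here of \<open>t \<mapsto> sgn (\<alpha> + t w)\<close> and of its projection, so that the
  differentials of all the maps involved are derivatives of explicit functions of one real variable and
  the chart transitions never have to be differentiated.
\<close>

section \<open>Multilinear maps and the product rule\<close>

abbreviation norm_prod :: "'a::real_normed_vector list \<Rightarrow> real" where
  "norm_prod vs \<equiv> prod_list (map norm vs)"

lemma norm_prod_nonneg: "0 \<le> norm_prod vs"
  by (rule prod_list_nonneg) auto

text \<open>The slots selected by \<open>B\<close> and the remaining ones are fed to two different factors of a product; this
  makes the bounds of the factors multiply to a bound of the product.\<close>

lemma norm_prod_nths: "norm_prod (nths vs B) * norm_prod (nths vs (- B)) = norm_prod vs"
proof (induction vs arbitrary: B)
  case (Cons v vs)
  have "{j. Suc j \<in> - B} = - {j. Suc j \<in> B}" by auto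
  with Cons[of "{j. Suc j \<in> B}"] show ?case
    by (auto simp: nths_Cons algebra_simps)
qed simp

definition multilinear :: "nat \<Rightarrow> ('a::real_vector list \<Rightarrow> 'b::real_vector) \<Rightarrow> bool" where
  "multilinear n L \<longleftrightarrow> (\<forall>us ws. length us + 1 + length ws = n \<longrightarrow> linear (\<lambda>v. L (us @ v # ws)))"

lemma bounded_multilinear_on_UNIV:
  "bounded_multilinear_on UNIV n L \<longleftrightarrow>
     multilinear n L \<and> (\<exists>B. \<forall>vs. length vs = n \<longrightarrow> norm (L vs) \<le> B * norm_prod vs)"
  unfolding bounded_multilinear_on_def multilinear_def linear_iff by auto

lemma multilinear_Cons:
  assumes "multilinear (Suc n) L"
  shows "multilinear n (\<lambda>ws. L (c # ws))"
  unfolding multilinear_def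
proof (intro allI impI)
  fix us ws :: "'a list" assume "length us + 1 + length ws = n"
  with assms[unfolded multilinear_def, rule_format, of "c # us" ws]
  show "linear (\<lambda>v. L (c # us @ v # ws))" by simp
qed

lemma multilinear_hd:
  assumes "multilinear (Suc n) L" "length ws = n"
  shows "linear (\<lambda>c. L (c # ws))"
  using assms(1)[unfolded multilinear_def, rule_format, of "[]" ws] assms(2) by simp

lemma multilinear_add:
  "multilinear n L \<Longrightarrow> multilinear n L' \<Longrightarrow> multilinear n (\<lambda>vs. L vs + L' vs)"
  unfolding multilinear_def by (simp add: linear_compose_add)

text \<open>Each slot of the composite is a slot of exactly one of \<open>A\<close> and \<open>L\<close>, and the composite is linear in it for
  that reason.  The order of the slots is preserved within both factors, so that no permutations occur.\<close>

lemma multilinear_nths: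
  assumes A: "\<And>m. multilinear m A"
    and L1: "\<And>vs. length vs = card {i. i < n \<and> i \<in> - B} \<Longrightarrow> linear (\<lambda>c. L c vs)"
    and L2: "\<And>c. multilinear (card {i. i < n \<and> i \<in> - B}) (L c)"
  shows "multilinear n (\<lambda>vs. L (A (nths vs B)) (nths vs (- B)))"
  unfolding multilinear_def
proof (intro allI impI)
  fix us ws :: "'a list"
  assume len: "length us + 1 + length ws = n"
  define us1 us2 ws1 ws2 where d: "us1 = nths us (- B)" "us2 = nths us B"
    "ws1 = nths ws {j. Suc (j + length us) \<in> - B}" "ws2 = nths ws {j. Suc (j + length us) \<in> B}"
  have len': "length (nths (us @ v # ws) (- B)) = card {i. i < n \<and> i \<in> - B}" for v
    using len by (simp add: length_nths)
  show "linear (\<lambda>v. L (A (nths (us @ v # ws) B)) (nths (us @ v # ws) (- B)))"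
  proof (cases "length us \<in> B")
    case True
    then have split: "nths (us @ v # ws) B = us2 @ v # ws2" "nths (us @ v # ws) (- B) = us1 @ ws1" for v
      by (simp_all add: d nths_append nths_Cons)
    have "linear (\<lambda>v. A (us2 @ v # ws2))" using A unfolding multilinear_def by blast
    from linear_compose[OF this L1[OF len'[unfolded split]]] show ?thesis by (simp add: split o_def)
  next
    case False
    then have split: "nths (us @ v # ws) B = us2 @ ws2" "nths (us @ v # ws) (- B) = us1 @ v # ws1" for v
      by (simp_all add: d nths_append nths_Cons)
    have "length us1 + 1 + length ws1 = card {i. i < n \<and> i \<in> - B}"
      using len'[unfolded split] by simp
    then show ?thesis using L2 unfolding multilinear_def split by blast
  qed
qed

text \<open>Maps into bounded multilinear maps with two kinds of slots.  The \<open>k\<close> slots \<open>ws\<close> are still to be filled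
  with derivatives of an inner function, the \<open>n\<close> slots \<open>vs\<close> take directions in the domain.\<close>

definition multi_bounded ::
    "'a::real_normed_vector set \<Rightarrow> nat \<Rightarrow> nat
      \<Rightarrow> ('a \<Rightarrow> 'c::real_normed_vector list \<Rightarrow> 'a list \<Rightarrow> 'b::real_normed_vector) \<Rightarrow> bool" where
  "multi_bounded U k n L \<longleftrightarrow> (\<forall>x\<in>U.
     (\<forall>vs. length vs = n \<longrightarrow> multilinear k (\<lambda>ws. L x ws vs)) \<and>
     (\<forall>ws. length ws = k \<longrightarrow> multilinear n (L x ws)) \<and>
     (\<exists>B\<ge>0. \<forall>ws vs. length ws = k \<longrightarrow> length vs = n \<longrightarrow>
        norm (L x ws vs) \<le> B * (norm_prod ws * norm_prod vs)))"

text \<open>Differentiability in the operator norm, the new direction being put in front of \<open>vs\<close>.\<close>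

definition multi_deriv ::
    "'a::real_normed_vector set \<Rightarrow> nat \<Rightarrow> nat
      \<Rightarrow> ('a \<Rightarrow> 'c::real_normed_vector list \<Rightarrow> 'a list \<Rightarrow> 'b::real_normed_vector)
      \<Rightarrow> ('a \<Rightarrow> 'c list \<Rightarrow> 'a list \<Rightarrow> 'b) \<Rightarrow> bool" where
  "multi_deriv U k n L L' \<longleftrightarrow> (\<forall>x\<in>U. \<forall>\<epsilon>>0. \<exists>\<delta>>0. \<forall>y\<in>U. norm (y - x) < \<delta> \<longrightarrow>
     (\<forall>ws vs. length ws = k \<longrightarrow> length vs = n \<longrightarrow>
        norm (L y ws vs - L x ws vs - L' x ws ((y - x) # vs))
          \<le> \<epsilon> * norm (y - x) * (norm_prod ws * norm_prod vs)))"

lemma multi_bounded_add: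
  assumes "multi_bounded U k n L" "multi_bounded U k n L'"
  shows "multi_bounded U k n (\<lambda>x ws vs. L x ws vs + L' x ws vs)"
  unfolding multi_bounded_def
proof (intro ballI conjI allI impI)
  fix x assume x: "x \<in> U"
  from assms(1) x obtain B where B: "B \<ge> 0" "\<And>ws vs. length ws = k \<Longrightarrow> length vs = n \<Longrightarrow>
        norm (L x ws vs) \<le> B * (norm_prod ws * norm_prod vs)"
    unfolding multi_bounded_def by blast
  from assms(2) x obtain B' where B': "B' \<ge> 0" "\<And>ws vs. length ws = k \<Longrightarrow> length vs = n \<Longrightarrow>
        norm (L' x ws vs) \<le> B' * (norm_prod ws * norm_prod vs)"
    unfolding multi_bounded_def by blast
  show "\<exists>B\<ge>0. \<forall>ws vs. length ws = k \<longrightarrow> length vs = n \<longrightarrow>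
        norm (L x ws vs + L' x ws vs) \<le> B * (norm_prod ws * norm_prod vs)"
    using B B' by (intro exI[of _ "B + B'"]) (auto simp: distrib_right intro!: norm_triangle_mono)
qed (use assms in \<open>auto simp: multi_bounded_def intro: multilinear_add\<close>)

lemma multi_deriv_add:
  assumes "multi_deriv U k n L1 L1'" "multi_deriv U k n L2 L2'"
  shows "multi_deriv U k n (\<lambda>x ws vs. L1 x ws vs + L2 x ws vs) (\<lambda>x ws vs. L1' x ws vs + L2' x ws vs)"
  unfolding multi_deriv_def
proof (intro ballI allI impI)
  fix x and \<epsilon> :: real assume x: "x \<in> U" and "\<epsilon> > 0"
  then have e2: "\<epsilon> / 2 > 0" by simp
  from assms(1)[unfolded multi_deriv_def, rule_format, OF x e2] obtain d1 where d1: "d1 > 0"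
    "\<And>y ws vs. y \<in> U \<Longrightarrow> norm (y - x) < d1 \<Longrightarrow> length ws = k \<Longrightarrow> length vs = n \<Longrightarrow>
        norm (L1 y ws vs - L1 x ws vs - L1' x ws ((y - x) # vs)) \<le> \<epsilon> / 2 * norm (y - x) * (norm_prod ws * norm_prod vs)"
    by blast
  from assms(2)[unfolded multi_deriv_def, rule_format, OF x e2] obtain d2 where d2: "d2 > 0"
    "\<And>y ws vs. y \<in> U \<Longrightarrow> norm (y - x) < d2 \<Longrightarrow> length ws = k \<Longrightarrow> length vs = n \<Longrightarrow>
        norm (L2 y ws vs - L2 x ws vs - L2' x ws ((y - x) # vs)) \<le> \<epsilon> / 2 * norm (y - x) * (norm_prod ws * norm_prod vs)"
    by blast
  show "\<exists>\<delta>>0. \<forall>y\<in>U. norm (y - x) < \<delta> \<longrightarrow> (\<forall>ws vs. length ws = k \<longrightarrow> length vs = n \<longrightarrow>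
        norm (L1 y ws vs + L2 y ws vs - (L1 x ws vs + L2 x ws vs) -
              (L1' x ws ((y - x) # vs) + L2' x ws ((y - x) # vs)))
          \<le> \<epsilon> * norm (y - x) * (norm_prod ws * norm_prod vs))"
  proof (intro exI[of _ "min d1 d2"] conjI ballI allI impI)
    fix y :: 'a and ws :: "'b list" and vs :: "'a list"
    assume a: "y \<in> U" "norm (y - x) < min d1 d2" "length ws = k" "length vs = n"
    let ?P = "norm_prod ws * norm_prod vs"
    let ?a = "L1 y ws vs - L1 x ws vs - L1' x ws ((y - x) # vs)"
    let ?b = "L2 y ws vs - L2 x ws vs - L2' x ws ((y - x) # vs)"
    have "norm (?a + ?b) \<le> \<epsilon> / 2 * norm (y - x) * ?P + \<epsilon> / 2 * norm (y - x) * ?P"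
      by (intro norm_triangle_mono d1 d2) (use a in auto)
    then show "norm (L1 y ws vs + L2 y ws vs - (L1 x ws vs + L2 x ws vs) -
              (L1' x ws ((y - x) # vs) + L2' x ws ((y - x) # vs))) \<le> \<epsilon> * norm (y - x) * ?P"
      by (simp add: algebra_simps)
  qed (use d1 d2 in auto)
qed

text \<open>The first open slot is filled with the derivative \<open>A\<close> of the inner function in the directions of \<open>vs\<close>
  selected by \<open>B\<close>; the other directions go to \<open>L\<close>.\<close>

definition plug ::
    "('a \<Rightarrow> 'a list \<Rightarrow> 'c) \<Rightarrow> nat set \<Rightarrow> ('a \<Rightarrow> 'c list \<Rightarrow> 'a list \<Rightarrow> 'b) \<Rightarrow> 'a \<Rightarrow> 'c list \<Rightarrow> 'a list \<Rightarrow> 'b"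
  where "plug A B L x ws vs = L x (A x (nths vs B) # ws) (nths vs (- B))"

text \<open>The sequence of all derivatives of a smooth function, as in the definition of \<open>smooth_on\<close> for the full
  space; bounds are normalised to be nonnegative.\<close>

definition smooth_jet :: "'a::real_normed_vector set \<Rightarrow> ('a \<Rightarrow> 'a list \<Rightarrow> 'b::real_normed_vector) \<Rightarrow> bool" where
  "smooth_jet U D \<longleftrightarrow> (\<forall>x\<in>U. \<forall>n. multilinear n (D x) \<and>
     (\<exists>B\<ge>0. \<forall>vs. length vs = n \<longrightarrow> norm (D x vs) \<le> B * norm_prod vs) \<and>
     (\<forall>\<epsilon>>0. \<exists>\<delta>>0. \<forall>y\<in>U. norm (y - x) < \<delta> \<longrightarrow> (\<forall>vs. length vs = n \<longrightarrow>
        norm (D y vs - D x vs - D x ((y - x) # vs)) \<le> \<epsilon> * norm (y - x) * norm_prod vs)))"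

lemma smooth_jet_multilinear: "smooth_jet U D \<Longrightarrow> x \<in> U \<Longrightarrow> multilinear n (D x)"
  unfolding smooth_jet_def by blast

lemma smooth_jet_bound:
  assumes "smooth_jet U D" "x \<in> U"
  obtains B where "B \<ge> 0" "\<And>vs. length vs = n \<Longrightarrow> norm (D x vs) \<le> B * norm_prod vs"
  using bspec[OF assms[unfolded smooth_jet_def], THEN spec, of n] by blast

lemma smooth_jet_deriv:
  assumes "smooth_jet U D" "x \<in> U" "\<epsilon> > 0"
  obtains \<delta> where "\<delta> > 0" "\<And>y vs. y \<in> U \<Longrightarrow> norm (y - x) < \<delta> \<Longrightarrow> length vs = n \<Longrightarrow>
    norm (D y vs - D x vs - D x ((y - x) # vs)) \<le> \<epsilon> * norm (y - x) * norm_prod vs"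
  using bspec[OF assms(1,2)[unfolded smooth_jet_def], THEN spec, of n] assms(3) by blast

lemma nonneg_bound:
  assumes "\<And>vs. P vs \<Longrightarrow> f vs \<le> (B::real) * norm_prod vs"
  shows "\<exists>B\<ge>0. \<forall>vs. P vs \<longrightarrow> f vs \<le> B * norm_prod vs"
proof (intro exI[of _ "\<bar>B\<bar>"] conjI allI impI)
  fix vs assume "P vs"
  then have "f vs \<le> B * norm_prod vs" by (rule assms)
  also have "\<dots> \<le> \<bar>B\<bar> * norm_prod vs" by (intro mult_right_mono norm_prod_nonneg) simp
  finally show "f vs \<le> \<bar>B\<bar> * norm_prod vs" .
qed simp

lemma smooth_on_iff_jet: "smooth_on UNIV U f \<longleftrightarrow> (\<exists>D. smooth_jet U D \<and> (\<forall>x\<in>U. D x [] = f x))"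
proof -
  have *: "bounded_multilinear_on UNIV n L \<longleftrightarrow>
     multilinear n L \<and> (\<exists>B\<ge>0. \<forall>vs. length vs = n \<longrightarrow> norm (L vs) \<le> B * norm_prod vs)"
    for n and L :: "'a list \<Rightarrow> 'b"
    unfolding bounded_multilinear_on_UNIV
    using nonneg_bound[of "\<lambda>vs. length vs = n" "\<lambda>vs. norm (L vs)"] by blast
  show ?thesis
    unfolding smooth_on_def smooth_jet_def * by (intro ex_cong1) auto
qed

lemma multi_bounded_plug:
  assumes A: "smooth_jet U A" and L: "multi_bounded U (Suc k) (card {i. i < n \<and> i \<in> - B}) L"
  shows "multi_bounded U k n (plug A B L)"
  unfolding multi_bounded_def
proof (intro ballI conjI allI impI)
  fix x assume x: "x \<in> U"
  let ?m = "card {i. i < n \<and> i \<in> B}" and ?m' = "card {i. i < n \<and> i \<in> - B}"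
  show "multilinear k (\<lambda>ws. plug A B L x ws vs)" if "length vs = n" for vs
  proof -
    have "length (nths vs (- B)) = ?m'" using that by (simp add: length_nths)
    then show ?thesis
      using L x unfolding multi_bounded_def plug_def by (intro multilinear_Cons) auto
  qed
  show "multilinear n (plug A B L x ws)" if "length ws = k" for ws
    unfolding plug_def
  proof (rule multilinear_nths)
    show "multilinear m (A x)" for m using A x by (auto simp: smooth_jet_def)
    show "linear (\<lambda>c. L x (c # ws) vs)" if "length vs = ?m'" for vs
      by (rule multilinear_hd[of k]) (use L x that \<open>length ws = k\<close> in \<open>auto simp: multi_bounded_def\<close>)
    show "multilinear ?m' (L x (c # ws))" for c
      using L x that by (auto simp: multi_bounded_def)
  qed
  from A x obtain BA where BA: "BA \<ge> 0" "\<And>vs. length vs = ?m \<Longrightarrow> norm (A x vs) \<le> BA * norm_prod vs"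
    unfolding smooth_jet_def by meson
  from L x obtain BL where BL: "BL \<ge> 0" "\<And>ws vs. length ws = Suc k \<Longrightarrow> length vs = ?m' \<Longrightarrow>
        norm (L x ws vs) \<le> BL * (norm_prod ws * norm_prod vs)"
    unfolding multi_bounded_def by blast
  show "\<exists>BB\<ge>0. \<forall>ws vs. length ws = k \<longrightarrow> length vs = n \<longrightarrow>
        norm (plug A B L x ws vs) \<le> BB * (norm_prod ws * norm_prod vs)"
  proof (intro exI[of _ "BL * BA"] conjI allI impI)
    fix ws :: "'b list" and vs :: "'a list" assume l: "length ws = k" "length vs = n"
    have "norm (plug A B L x ws vs) \<le> BL * ((norm (A x (nths vs B)) * norm_prod ws) * norm_prod (nths vs (- B)))"
      unfolding plug_def using BL(2)[of "A x (nths vs B) # ws" "nths vs (- B)"] l by (simp add: length_nths)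
    also have "\<dots> \<le> BL * (((BA * norm_prod (nths vs B)) * norm_prod ws) * norm_prod (nths vs (- B)))"
      using l BL(1) by (intro mult_left_mono mult_right_mono BA norm_prod_nonneg) (auto simp: length_nths)
    also have "\<dots> = BL * BA * (norm_prod ws * (norm_prod (nths vs B) * norm_prod (nths vs (- B))))"
      by simp
    finally show "norm (plug A B L x ws vs) \<le> BL * BA * (norm_prod ws * norm_prod vs)"
      by (simp only: norm_prod_nths)
  qed (use BA BL in auto)
qed

text \<open>The product rule for the bilinear pairing of \<open>L\<close> and \<open>A\<close>.  The new direction comes first, so the old
  selection \<open>B\<close> becomes \<open>Suc ` B\<close>; the new index \<open>0\<close> belongs to it precisely in the term in which \<open>A\<close>
  has been differentiated.\<close>

lemma multi_deriv_plug:
  assumes A: "smooth_jet U A"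
    and L: "multi_bounded U (Suc k) (card {i. i < n \<and> i \<in> - B}) L"
    and L': "multi_bounded U (Suc k) (Suc (card {i. i < n \<and> i \<in> - B})) L'"
    and LL': "multi_deriv U (Suc k) (card {i. i < n \<and> i \<in> - B}) L L'"
  shows "multi_deriv U k n (plug A B L)
    (\<lambda>x ws vs. plug A (Suc ` B) L' x ws vs + plug A (insert 0 (Suc ` B)) L x ws vs)"
  unfolding multi_deriv_def
proof (intro ballI allI impI)
  fix x and \<epsilon> :: real assume x: "x \<in> U" and e: "\<epsilon> > 0"
  let ?m = "card {i. i < n \<and> i \<in> B}" and ?m' = "card {i. i < n \<and> i \<in> - B}"
  let ?q = "\<lambda>c ws vs. norm c * (norm_prod ws * norm_prod vs)"
  from A x obtain a where a: "a \<ge> 0" "\<And>vs. length vs = ?m \<Longrightarrow> norm (A x vs) \<le> a * norm_prod vs"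
    unfolding smooth_jet_def by meson
  from A x obtain a' where a': "a' \<ge> 0" "\<And>vs. length vs = Suc ?m \<Longrightarrow> norm (A x vs) \<le> a' * norm_prod vs"
    unfolding smooth_jet_def by meson
  from L x obtain b where b: "b \<ge> 0" "\<And>ws vs. length ws = Suc k \<Longrightarrow> length vs = ?m' \<Longrightarrow>
        norm (L x ws vs) \<le> b * (norm_prod ws * norm_prod vs)"
    unfolding multi_bounded_def by blast
  from L' x obtain b' where b': "b' \<ge> 0" "\<And>ws vs. length ws = Suc k \<Longrightarrow> length vs = Suc ?m' \<Longrightarrow>
        norm (L' x ws vs) \<le> b' * (norm_prod ws * norm_prod vs)"
    unfolding multi_bounded_def by blast
  \<comment> \<open>\<open>e1\<close> and \<open>d\<close> are chosen so that the error terms below, \<open>e1 (b + b' + 1 + a)\<close> from the linear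
    approximations and \<open>d (b' + 1) a'\<close> from the product of two increments, are at most \<open>\<epsilon> / 2\<close> each.\<close>
  define e1 where "e1 = min 1 (\<epsilon> / (2 * (b + b' + 1 + a)))"
  have e1: "e1 > 0" "e1 \<le> 1" "e1 * (b + b' + 1 + a) \<le> \<epsilon> / 2"
  proof -
    have p: "b + b' + 1 + a > 0" using a b b' by linarith
    show "e1 > 0" "e1 \<le> 1" using p e by (auto simp: e1_def)
    have "e1 * (b + b' + 1 + a) \<le> \<epsilon> / (2 * (b + b' + 1 + a)) * (b + b' + 1 + a)"
      using p by (intro mult_right_mono) (auto simp: e1_def)
    also have "\<dots> = \<epsilon> / 2" using p by (simp add: field_simps)
    finally show "e1 * (b + b' + 1 + a) \<le> \<epsilon> / 2" .
  qed
  from LL'[unfolded multi_deriv_def, rule_format, OF x e1(1)] obtain d1 where d1: "d1 > 0"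
    "\<And>y ws vs. y \<in> U \<Longrightarrow> norm (y - x) < d1 \<Longrightarrow> length ws = Suc k \<Longrightarrow> length vs = ?m' \<Longrightarrow>
        norm (L y ws vs - L x ws vs - L' x ws ((y - x) # vs)) \<le> e1 * norm (y - x) * (norm_prod ws * norm_prod vs)"
    by blast
  from A x e1(1) obtain d2 where d2: "d2 > 0"
    "\<And>y vs. y \<in> U \<Longrightarrow> norm (y - x) < d2 \<Longrightarrow> length vs = ?m \<Longrightarrow>
        norm (A y vs - A x vs - A x ((y - x) # vs)) \<le> e1 * norm (y - x) * norm_prod vs"
    unfolding smooth_jet_def by meson
  define d where "d = min (min d1 d2) (min 1 (\<epsilon> / (2 * ((b' + 1) * a' + 1))))"
  have p: "(b' + 1) * a' + 1 > 0" using a' b' by (simp add: add_nonneg_pos)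
  have d: "d > 0" "d \<le> d1" "d \<le> d2" "d \<le> 1" "d * ((b' + 1) * a') \<le> \<epsilon> / 2"
  proof -
    show "d > 0" "d \<le> d1" "d \<le> d2" "d \<le> 1" using p e d1 d2 by (auto simp: d_def)
    then have "d * ((b' + 1) * a') \<le> d * ((b' + 1) * a' + 1)" by (intro mult_left_mono) auto
    also have "\<dots> \<le> \<epsilon> / (2 * ((b' + 1) * a' + 1)) * ((b' + 1) * a' + 1)"
      using p by (intro mult_right_mono) (auto simp: d_def)
    also have "\<dots> = \<epsilon> / 2" using p by (simp add: field_simps)
    finally show "d * ((b' + 1) * a') \<le> \<epsilon> / 2" .
  qed
  show "\<exists>\<delta>>0. \<forall>y\<in>U. norm (y - x) < \<delta> \<longrightarrow> (\<forall>ws vs. length ws = k \<longrightarrow> length vs = n \<longrightarrow>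
        norm (plug A B L y ws vs - plug A B L x ws vs -
           (plug A (Suc ` B) L' x ws ((y - x) # vs) + plug A (insert 0 (Suc ` B)) L x ws ((y - x) # vs)))
          \<le> \<epsilon> * norm (y - x) * (norm_prod ws * norm_prod vs))"
  proof (intro exI[of _ d] conjI ballI allI impI)
    show "d > 0" by (rule d)
    fix y :: 'a and ws :: "'b list" and vs :: "'a list"
    assume y: "y \<in> U" "norm (y - x) < d" and len: "length ws = k" "length vs = n"
    define h where "h = y - x"
    define s where "s = nths vs B"
    define t where "t = nths vs (- B)"
    define P where "P = norm_prod ws * norm_prod t"
    define S where "S = norm_prod s"
    have P: "P \<ge> 0" "S \<ge> 0" by (simp_all add: P_def S_def norm_prod_nonneg)
    have ls: "length s = ?m" "length t = ?m'"
      using len by (simp_all add: s_def t_def length_nths)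
    have plug1: "plug A (Suc ` B) L' x ws (h # vs) = L' x (A x s # ws) (h # t)"
    proof -
      have "{j. Suc j \<in> Suc ` B} = B" "{j. Suc j \<in> - Suc ` B} = - B" by auto
      then show ?thesis by (auto simp: plug_def nths_Cons s_def t_def)
    qed
    have plug2: "plug A (insert 0 (Suc ` B)) L x ws (h # vs) = L x (A x (h # s) # ws) t"
    proof -
      have "{j. Suc j \<in> Suc ` B} = B" "{j. Suc j \<in> - insert 0 (Suc ` B)} = - B" by auto
      then show ?thesis by (auto simp: plug_def nths_Cons s_def t_def)
    qed
    have h: "norm h < d" "norm h < d1" "norm h < d2" "norm h \<le> 1" using y d by (auto simp: h_def)
    have lin: "linear (\<lambda>c. L z (c # ws) t)" if "z \<in> U" for z
    proof (rule multilinear_hd[of k])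
      show "multilinear (Suc k) (\<lambda>ws. L z ws t)" using L that ls by (auto simp: multi_bounded_def)
    qed (rule len)
    have Lerr: "norm (L y (c # ws) t - L x (c # ws) t - L' x (c # ws) (h # t)) \<le> e1 * norm h * (norm c * P)" for c
      using d1(2)[of y "c # ws" t] y h len ls by (simp add: h_def P_def mult.assoc)
    have Lbd: "norm (L x (c # ws) t) \<le> b * (norm c * P)" for c
      using b(2)[of "c # ws" t] len ls by (simp add: P_def mult.assoc)
    have L'bd: "norm (L' x (c # ws) (h # t)) \<le> b' * norm h * (norm c * P)" for c
      using b'(2)[of "c # ws" "h # t"] len ls by (simp add: P_def mult_ac)
    have Ldiff: "norm (L y (c # ws) t - L x (c # ws) t) \<le> (b' + 1) * norm h * (norm c * P)" for c
    proof -
      have "norm (L y (c # ws) t - L x (c # ws) t) =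
        norm ((L y (c # ws) t - L x (c # ws) t - L' x (c # ws) (h # t)) + L' x (c # ws) (h # t))" by simp
      also have "\<dots> \<le> e1 * norm h * (norm c * P) + b' * norm h * (norm c * P)"
        by (rule norm_triangle_mono[OF Lerr L'bd])
      also have "\<dots> \<le> 1 * norm h * (norm c * P) + b' * norm h * (norm c * P)"
        using P e1 by (intro add_right_mono mult_right_mono) auto
      finally show ?thesis by (simp add: algebra_simps)
    qed
    have Ly: "norm (L y (c # ws) t) \<le> (b + b' + 1) * (norm c * P)" for c
    proof -
      have "norm (L y (c # ws) t) = norm ((L y (c # ws) t - L x (c # ws) t) + L x (c # ws) t)" by simp
      also have "\<dots> \<le> (b' + 1) * norm h * (norm c * P) + b * (norm c * P)"
        by (rule norm_triangle_mono[OF Ldiff Lbd])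
      also have "\<dots> \<le> (b' + 1) * 1 * (norm c * P) + b * (norm c * P)"
        using P h b' by (intro add_right_mono mult_right_mono mult_left_mono) auto
      finally show ?thesis by (simp add: algebra_simps)
    qed
    have Aerr: "norm (A y s - A x s - A x (h # s)) \<le> e1 * norm h * S"
      using d2(2)[of y s] y h ls by (simp add: h_def S_def)
    have Abd: "norm (A x s) \<le> a * S" using a(2)[of s] ls by (simp add: S_def)
    have A'bd: "norm (A x (h # s)) \<le> a' * norm h * S" using a'(2)[of "h # s"] ls by (simp add: S_def mult_ac)
    have "L y ((A y s - A x s - A x (h # s)) # ws) t =
        L y (A y s # ws) t - L y (A x s # ws) t - L y (A x (h # s) # ws) t"
      by (simp add: linear_diff[OF lin[OF y(1)]])
    then have "L y (A y s # ws) t - L x (A x s # ws) t - (L' x (A x s # ws) (h # t) + L x (A x (h # s) # ws) t) =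
      L y ((A y s - A x s - A x (h # s)) # ws) t +
      ((L y (A x (h # s) # ws) t - L x (A x (h # s) # ws) t) +
      (L y (A x s # ws) t - L x (A x s # ws) t - L' x (A x s # ws) (h # t)))"
      by simp
    \<comment> \<open>In this order: the error of \<open>A\<close> seen through \<open>L y\<close>, the increment of \<open>L\<close> on that of \<open>A\<close>, the error of \<open>L\<close>.\<close>
    also have "norm \<dots> \<le> (b + b' + 1) * (e1 * norm h * S * P) +
       ((b' + 1) * norm h * (a' * norm h * S * P) + e1 * norm h * (a * S * P))"
    proof (intro norm_triangle_mono)
      show "norm (L y ((A y s - A x s - A x (h # s)) # ws) t) \<le> (b + b' + 1) * (e1 * norm h * S * P)"
        by (rule order_trans[OF Ly]) (use P b b' Aerr in \<open>intro mult_left_mono mult_right_mono, auto\<close>)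
      show "norm (L y (A x (h # s) # ws) t - L x (A x (h # s) # ws) t) \<le> (b' + 1) * norm h * (a' * norm h * S * P)"
        by (rule order_trans[OF Ldiff]) (use P b' A'bd in \<open>intro mult_left_mono mult_right_mono, auto\<close>)
      show "norm (L y (A x s # ws) t - L x (A x s # ws) t - L' x (A x s # ws) (h # t)) \<le> e1 * norm h * (a * S * P)"
        by (rule order_trans[OF Lerr]) (use P e1 Abd in \<open>intro mult_left_mono mult_right_mono, auto\<close>)
    qed
    also have "\<dots> = (e1 * (b + b' + 1 + a) + norm h * ((b' + 1) * a')) * (norm h * (S * P))"
      by (simp add: algebra_simps)
    also have "\<dots> \<le> (\<epsilon> / 2 + \<epsilon> / 2) * (norm h * (S * P))"
    proof (intro mult_right_mono add_mono e1)
      have "norm h * ((b' + 1) * a') \<le> d * ((b' + 1) * a')"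
        using h a' b' by (intro mult_right_mono) auto
      then show "norm h * ((b' + 1) * a') \<le> \<epsilon> / 2" using d by linarith
    qed (use P in auto)
    also have "S * P = norm_prod ws * norm_prod vs"
      using norm_prod_nths[of vs B] by (simp add: S_def P_def s_def t_def mult_ac)
    finally show "norm (plug A B L y ws vs - plug A B L x ws vs -
           (plug A (Suc ` B) L' x ws ((y - x) # vs) + plug A (insert 0 (Suc ` B)) L x ws ((y - x) # vs)))
          \<le> \<epsilon> * norm (y - x) * (norm_prod ws * norm_prod vs)"
      unfolding plug1[unfolded h_def] plug2[unfolded h_def]
      by (simp add: plug_def s_def t_def h_def mult.assoc)
  qed
qed

section \<open>The chain rule for smooth maps\<close>

text \<open>The terms of the formula of Faa di Bruno for the derivatives of a composition with inner function \<open>f\<close>,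
  where \<open>A\<close> and \<open>G\<close> are the derivatives of the inner and of the outer function.  Only the closure under
  differentiation matters, so the formula itself is never written down: a term is a sum of
  derivatives of the outer function at \<open>f x\<close>, with slots filled one after the other by derivatives of
  the inner one.\<close>

inductive chain_term ::
    "('a::real_normed_vector \<Rightarrow> 'c::real_normed_vector) \<Rightarrow> ('a \<Rightarrow> 'a list \<Rightarrow> 'c)
      \<Rightarrow> ('c \<Rightarrow> 'c list \<Rightarrow> 'b::real_normed_vector)
      \<Rightarrow> nat \<Rightarrow> nat \<Rightarrow> ('a \<Rightarrow> 'c list \<Rightarrow> 'a list \<Rightarrow> 'b) \<Rightarrow> bool"
  for f A G where
  base: "chain_term f A G k 0 (\<lambda>x ws vs. G (f x) ws)"
| plug: "chain_term f A G (Suc k) (card {i. i < n \<and> i \<in> - B}) L \<Longrightarrow> chain_term f A G k n (plug A B L)"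
| add: "chain_term f A G k n L \<Longrightarrow> chain_term f A G k n L' \<Longrightarrow>
    chain_term f A G k n (\<lambda>x ws vs. L x ws vs + L' x ws vs)"

context
  fixes U :: "'a::real_normed_vector set" and V :: "'c::real_normed_vector set"
    and f :: "'a \<Rightarrow> 'c" and A :: "'a \<Rightarrow> 'a list \<Rightarrow> 'c" and G :: "'c \<Rightarrow> 'c list \<Rightarrow> 'b::real_normed_vector"
  assumes A: "smooth_jet U A" and Af: "\<And>x. x \<in> U \<Longrightarrow> A x [] = f x"
    and G: "smooth_jet V G" and fV: "f ` U \<subseteq> V"
begin

lemma chain_term_bounded: "chain_term f A G k n L \<Longrightarrow> multi_bounded U k n L"
proof (induction rule: chain_term.induct)
  case (base k)
  show ?case
    unfolding multi_bounded_def
  proof (intro ballI conjI allI impI)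
    fix x assume "x \<in> U"
    then have "f x \<in> V" using fV by auto
    with G have "multilinear k (G (f x)) \<and> (\<exists>B\<ge>0. \<forall>ws. length ws = k \<longrightarrow> norm (G (f x) ws) \<le> B * norm_prod ws)"
      unfolding smooth_jet_def by blast
    then show "multilinear k (\<lambda>ws. G (f x) ws)"
      "\<exists>B\<ge>0. \<forall>ws vs. length ws = k \<longrightarrow> length (vs :: 'a list) = 0 \<longrightarrow> norm (G (f x) ws) \<le> B * (norm_prod ws * norm_prod vs)"
      by auto
  qed (simp add: multilinear_def)
next
  case (plug k n B L)
  then show ?case by (intro multi_bounded_plug A)
next
  case (add k n L L')
  then show ?case by (intro multi_bounded_add)
qed


text \<open>The chain rule of first order: differentiating the \<open>k\<close>-th derivative of the outer function at \<open>f x\<close>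
  opens a new slot, which receives the derivative of \<open>f\<close> in the new direction.\<close>

lemma base_term_deriv:
  "multi_deriv U k 0 (\<lambda>x ws vs. G (f x) ws) (plug A {0} (\<lambda>x ws vs. G (f x) ws))"
  unfolding multi_deriv_def
proof (intro ballI allI impI)
  fix x and \<epsilon> :: real assume x: "x \<in> U" and e: "\<epsilon> > 0"
  from x fV have fx: "f x \<in> V" by auto
  from G fx have lin1: "multilinear (Suc k) (G (f x))" unfolding smooth_jet_def by blast
  from A x obtain a where a: "a \<ge> 0" "\<And>vs. length vs = 1 \<Longrightarrow> norm (A x vs) \<le> a * norm_prod vs"
    unfolding smooth_jet_def by meson
  from G fx obtain b where b: "b \<ge> 0" "\<And>ws. length ws = Suc k \<Longrightarrow> norm (G (f x) ws) \<le> b * norm_prod ws"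
    unfolding smooth_jet_def by meson
  \<comment> \<open>\<open>e1\<close> and \<open>e2\<close> are the accuracies for the inner and the outer function; the inner increment is at most
    \<open>(a + 1) \<parallel>h\<parallel>\<close>, so the total error is at most \<open>(b e1 + e2 (a + 1)) \<parallel>h\<parallel>\<close>.\<close>
  define e1 where "e1 = min 1 (\<epsilon> / (2 * (b + 1)))"
  have e1: "e1 > 0" "e1 \<le> 1" "b * e1 \<le> \<epsilon> / 2"
  proof -
    show "e1 > 0" "e1 \<le> 1" using b e by (auto simp: e1_def)
    then have "b * e1 \<le> (b + 1) * e1" by (intro mult_right_mono) auto
    also have "\<dots> \<le> (b + 1) * (\<epsilon> / (2 * (b + 1)))"
      using b by (intro mult_left_mono) (auto simp: e1_def)
    also have "\<dots> = \<epsilon> / 2" using b by (simp add: field_simps)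
    finally show "b * e1 \<le> \<epsilon> / 2" .
  qed
  define e2 where "e2 = \<epsilon> / (2 * (a + 1))"
  have e2: "e2 > 0" "e2 * (a + 1) = \<epsilon> / 2" using a e by (auto simp: e2_def field_simps)
  from A x e1(1) obtain d1 where d1: "d1 > 0"
    "\<And>y vs. y \<in> U \<Longrightarrow> norm (y - x) < d1 \<Longrightarrow> length vs = 0 \<Longrightarrow>
        norm (A y vs - A x vs - A x ((y - x) # vs)) \<le> e1 * norm (y - x) * norm_prod vs"
    unfolding smooth_jet_def by meson
  from G fx e2(1) obtain d2 where d2: "d2 > 0"
    "\<And>y ws. y \<in> V \<Longrightarrow> norm (y - f x) < d2 \<Longrightarrow> length ws = k \<Longrightarrow>
        norm (G y ws - G (f x) ws - G (f x) ((y - f x) # ws)) \<le> e2 * norm (y - f x) * norm_prod ws"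
    unfolding smooth_jet_def by meson
  define d where "d = min d1 (d2 / (a + 1))"
  have d: "d > 0" "d \<le> d1" "d * (a + 1) \<le> d2"
  proof -
    show "d > 0" "d \<le> d1" using a d1 d2 by (auto simp: d_def)
    have "d * (a + 1) \<le> d2 / (a + 1) * (a + 1)" using a by (intro mult_right_mono) (auto simp: d_def)
    then show "d * (a + 1) \<le> d2" using a by simp
  qed
  show "\<exists>\<delta>>0. \<forall>y\<in>U. norm (y - x) < \<delta> \<longrightarrow> (\<forall>ws vs. length ws = k \<longrightarrow> length vs = 0 \<longrightarrow>
        norm (G (f y) ws - G (f x) ws - plug A {0} (\<lambda>x ws vs. G (f x) ws) x ws ((y - x) # vs))
          \<le> \<epsilon> * norm (y - x) * (norm_prod ws * norm_prod vs))"
  proof (intro exI[of _ d] conjI ballI allI impI)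
    show "d > 0" by (rule d)
    fix y and ws :: "'c list" and vs :: "'a list"
    assume y: "y \<in> U" "norm (y - x) < d" and len: "length ws = k" "length vs = 0"
    then have fy: "f y \<in> V" using fV by auto
    define h where "h = y - x"
    define P where "P = norm_prod ws"
    have P: "P \<ge> 0" by (simp add: P_def norm_prod_nonneg)
    have Aerr: "norm (f y - f x - A x [h]) \<le> e1 * norm h"
      using d1(2)[of y "[]"] y d x by (simp add: h_def Af)
    have "norm (f y - f x) = norm ((f y - f x - A x [h]) + A x [h])" by simp
    also have "\<dots> \<le> e1 * norm h + a * norm h"
      by (rule norm_triangle_mono[OF Aerr]) (use a(2)[of "[h]"] in simp)
    also have "\<dots> \<le> (a + 1) * norm h" using mult_right_mono[of e1 1 "norm h"] e1 by (simp add: distrib_right)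
    finally have fdiff: "norm (f y - f x) \<le> (a + 1) * norm h" .
    also have "\<dots> < (a + 1) * d" using a y by (intro mult_strict_left_mono) (auto simp: h_def)
    also have "\<dots> \<le> d2" using d(3) by (simp add: mult.commute)
    finally have near: "norm (f y - f x) < d2" .
    have lin: "linear (\<lambda>c. G (f x) (c # ws))" by (rule multilinear_hd[OF lin1 len(1)])
    have "G (f x) ((f y - f x - A x [h]) # ws) = G (f x) ((f y - f x) # ws) - G (f x) (A x [h] # ws)"
      by (simp only: linear_diff[OF lin])
    then have "G (f y) ws - G (f x) ws - G (f x) (A x [h] # ws) =
      (G (f y) ws - G (f x) ws - G (f x) ((f y - f x) # ws)) + G (f x) ((f y - f x - A x [h]) # ws)"
      by simp
    also have "norm \<dots> \<le> e2 * ((a + 1) * norm h) * P + b * ((e1 * norm h) * P)"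
    proof (rule norm_triangle_mono)
      have "norm (G (f y) ws - G (f x) ws - G (f x) ((f y - f x) # ws)) \<le> e2 * norm (f y - f x) * P"
        using d2(2)[OF fy near len(1)] by (simp add: P_def)
      also have "\<dots> \<le> e2 * ((a + 1) * norm h) * P"
        using e2 P fdiff by (intro mult_left_mono mult_right_mono) auto
      finally show "norm (G (f y) ws - G (f x) ws - G (f x) ((f y - f x) # ws)) \<le> e2 * ((a + 1) * norm h) * P" .
      have "norm (G (f x) ((f y - f x - A x [h]) # ws)) \<le> b * (norm (f y - f x - A x [h]) * P)"
        using b(2)[of "(f y - f x - A x [h]) # ws"] len by (simp add: P_def)
      also have "\<dots> \<le> b * ((e1 * norm h) * P)"
        using b P Aerr by (intro mult_left_mono mult_right_mono) auto
      finally show "norm (G (f x) ((f y - f x - A x [h]) # ws)) \<le> b * ((e1 * norm h) * P)" .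
    qed
    also have "\<dots> = (e2 * (a + 1) + b * e1) * (norm h * P)" by (simp add: algebra_simps)
    also have "\<dots> \<le> \<epsilon> * (norm h * P)" using e1 e2 P by (intro mult_right_mono) auto
    finally show "norm (G (f y) ws - G (f x) ws - plug A {0} (\<lambda>x ws vs. G (f x) ws) x ws ((y - x) # vs))
          \<le> \<epsilon> * norm (y - x) * (norm_prod ws * norm_prod vs)"
      using len by (simp add: plug_def h_def P_def nths_Cons mult.assoc)
  qed
qed

lemma chain_term_deriv:
  "chain_term f A G k n L \<Longrightarrow> \<exists>L'. chain_term f A G k (Suc n) L' \<and> multi_deriv U k n L L'"
proof (induction rule: chain_term.induct)
  case (base k)
  have "chain_term f A G k (Suc 0) (plug A {0} (\<lambda>x ws vs. G (f x) ws))"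
  proof (rule chain_term.plug)
    have "{i. i < Suc 0 \<and> i \<in> - {0}} = {}" by auto
    then show "chain_term f A G (Suc k) (card {i. i < Suc 0 \<and> i \<in> - {0}}) (\<lambda>x ws vs. G (f x) ws)"
      by (simp only: card.empty chain_term.base)
  qed
  then show ?case using base_term_deriv by auto
next
  case (plug k n B L)
  then obtain L' where L': "chain_term f A G (Suc k) (Suc (card {i. i < n \<and> i \<in> - B})) L'"
    "multi_deriv U (Suc k) (card {i. i < n \<and> i \<in> - B}) L L'" by blast
  have "{i. i < Suc n \<and> i \<in> - Suc ` B} = insert 0 (Suc ` {i. i < n \<and> i \<in> - B})"
    by (auto simp: image_iff less_Suc_eq_0_disj)
  then have c1: "card {i. i < Suc n \<and> i \<in> - Suc ` B} = Suc (card {i. i < n \<and> i \<in> - B})"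
    by (simp add: card_image)
  have "{i. i < Suc n \<and> i \<in> - insert 0 (Suc ` B)} = Suc ` {i. i < n \<and> i \<in> - B}"
    by (auto simp: image_iff less_Suc_eq_0_disj)
  then have c2: "card {i. i < Suc n \<and> i \<in> - insert 0 (Suc ` B)} = card {i. i < n \<and> i \<in> - B}"
    by (simp add: card_image)
  have "chain_term f A G k (Suc n) (\<lambda>x ws vs. plug A (Suc ` B) L' x ws vs + plug A (insert 0 (Suc ` B)) L x ws vs)"
    by (intro chain_term.add chain_term.plug) (use plug L' in \<open>auto simp only: c1 c2\<close>)
  moreover have "multi_deriv U k n (plug A B L)
      (\<lambda>x ws vs. plug A (Suc ` B) L' x ws vs + plug A (insert 0 (Suc ` B)) L x ws vs)"
    by (rule multi_deriv_plug[OF A _ _ L'(2)]) (use chain_term_bounded L' plug in auto)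
  ultimately show ?case by blast
next
  case (add k n L1 L2)
  then obtain L1' L2' where "chain_term f A G k (Suc n) L1'" "multi_deriv U k n L1 L1'"
    "chain_term f A G k (Suc n) L2'" "multi_deriv U k n L2 L2'" by blast
  then show ?case
    by (intro exI[of _ "\<lambda>x ws vs. L1' x ws vs + L2' x ws vs"] conjI chain_term.add multi_deriv_add)
qed

text \<open>Since every term has a derivative that is again a term, dependent choice yields all derivatives of the
  composition, starting with the composition itself.\<close>

lemma smooth_jet_compose: "\<exists>D. smooth_jet U D \<and> (\<forall>x\<in>U. D x [] = G (f x) [])"
proof -
  have "\<exists>S. \<forall>n. (chain_term f A G 0 n (S n) \<and> (n = 0 \<longrightarrow> S n = (\<lambda>x ws vs. G (f x) ws))) \<and>
      multi_deriv U 0 n (S n) (S (Suc n))"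
  proof (rule dependent_nat_choice)
    show "\<exists>L. chain_term f A G 0 0 L \<and> ((0::nat) = 0 \<longrightarrow> L = (\<lambda>x ws vs. G (f x) ws))"
      using chain_term.base by blast
    fix L n assume "chain_term f A G 0 n L \<and> (n = 0 \<longrightarrow> L = (\<lambda>x ws vs. G (f x) ws))"
    then have "\<exists>L'. chain_term f A G 0 (Suc n) L' \<and> multi_deriv U 0 n L L'"
      by (intro chain_term_deriv) simp
    then show "\<exists>L'. (chain_term f A G 0 (Suc n) L' \<and> (Suc n = 0 \<longrightarrow> L' = (\<lambda>x ws vs. G (f x) ws))) \<and>
        multi_deriv U 0 n L L'" by simp
  qed
  then obtain S where S: "\<And>n. chain_term f A G 0 n (S n)" "S 0 = (\<lambda>x ws vs. G (f x) ws)"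
      "\<And>n. multi_deriv U 0 n (S n) (S (Suc n))" by blast
  have "smooth_jet U (\<lambda>x vs. S (length vs) x [] vs)"
    unfolding smooth_jet_def
  proof (intro ballI allI conjI impI)
    fix x n assume x: "x \<in> U"
    have b: "multi_bounded U 0 n (S n)" using chain_term_bounded S(1) by blast
    then have "multilinear n (S n x [])" using x by (auto simp: multi_bounded_def)
    then show "multilinear n (\<lambda>vs. S (length vs) x [] vs)"
      unfolding multilinear_def by auto
    show "\<exists>B\<ge>0. \<forall>vs. length vs = n \<longrightarrow> norm (S (length vs) x [] vs) \<le> B * norm_prod vs"
      using b x unfolding multi_bounded_def by fastforce
    fix \<epsilon> :: real assume "\<epsilon> > 0"
    then show "\<exists>\<delta>>0. \<forall>y\<in>U. norm (y - x) < \<delta> \<longrightarrow> (\<forall>vs. length vs = n \<longrightarrow>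
        norm (S (length vs) y [] vs - S (length vs) x [] vs - S (length ((y - x) # vs)) x [] ((y - x) # vs))
          \<le> \<epsilon> * norm (y - x) * norm_prod vs)"
      using S(3)[of n] x unfolding multi_deriv_def by fastforce
  qed
  then show ?thesis using S(2) by (intro exI[of _ "\<lambda>x vs. S (length vs) x [] vs"]) auto
qed

end

theorem smooth_on_compose:
  assumes "smooth_on UNIV U f" "smooth_on UNIV V g" "f ` U \<subseteq> V"
  shows "smooth_on UNIV U (\<lambda>x. g (f x))"
proof -
  from assms obtain A G where "smooth_jet U A" "\<forall>x\<in>U. A x [] = f x" "smooth_jet V G" "\<forall>y\<in>V. G y [] = g y"
    unfolding smooth_on_iff_jet by blast
  with smooth_jet_compose[of U A f V G] assms(3) show ?thesis
    unfolding smooth_on_iff_jet by (metis image_subset_iff)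
qed

lemma smooth_on_restrict:
  assumes "smooth_on E U f" "E' \<subseteq> E" "U' \<subseteq> U" and eq: "\<And>x. x \<in> U' \<Longrightarrow> f x = g x"
  shows "smooth_on E' U' g"
proof -
  from assms(1) obtain D where D: "\<forall>x\<in>U. D x [] = f x \<and>
        (\<forall>n. bounded_multilinear_on E n (D x) \<and>
          (\<forall>\<epsilon>>0. \<exists>\<delta>>0. \<forall>y\<in>U. norm (y - x) < \<delta> \<longrightarrow>
            (\<forall>vs. set vs \<subseteq> E \<and> length vs = n \<longrightarrow>
              norm (D y vs - D x vs - D x ((y - x) # vs)) \<le> \<epsilon> * norm (y - x) * norm_prod vs)))"
    unfolding smooth_on_def by (rule exE)
  show ?thesis
    unfolding smooth_on_def
  proof (intro exI[of _ D] ballI conjI allI impI)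
    fix x n assume x': "x \<in> U'"
    then have x: "x \<in> U" using assms by auto
    then show "D x [] = g x" using D eq[OF x'] by auto
    from D x have "bounded_multilinear_on E n (D x)" by blast
    then show "bounded_multilinear_on E' n (D x)"
      using assms(2) unfolding bounded_multilinear_on_def by (meson subset_iff)
    fix \<epsilon> :: real assume e: "\<epsilon> > 0"
    from bspec[OF D x, THEN conjunct2, rule_format, of n, THEN conjunct2, rule_format, OF e]
    obtain d where "d > 0" "\<forall>y\<in>U. norm (y - x) < d \<longrightarrow>
            (\<forall>vs. set vs \<subseteq> E \<and> length vs = n \<longrightarrow>
              norm (D y vs - D x vs - D x ((y - x) # vs)) \<le> \<epsilon> * norm (y - x) * norm_prod vs)"
      by auto
    then show "\<exists>\<delta>>0. \<forall>y\<in>U'. norm (y - x) < \<delta> \<longrightarrow>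
            (\<forall>vs. set vs \<subseteq> E' \<and> length vs = n \<longrightarrow>
              norm (D y vs - D x vs - D x ((y - x) # vs)) \<le> \<epsilon> * norm (y - x) * norm_prod vs)"
      using assms(2,3) by (intro exI[of _ d]) auto
  qed
qed

lemma smooth_on_cong: "smooth_on E U f \<Longrightarrow> (\<And>x. x \<in> U \<Longrightarrow> f x = g x) \<Longrightarrow> smooth_on E U g"
  using smooth_on_restrict[of E U f E U g] by blast

lemma smooth_on_subset: "smooth_on E U f \<Longrightarrow> E' \<subseteq> E \<Longrightarrow> U' \<subseteq> U \<Longrightarrow> smooth_on E' U' f"
  using smooth_on_restrict[of E U f E' U' f] by blast

section \<open>Smooth functions on open sets\<close>

lemma multilinear_0: "multilinear 0 L"
  by (simp add: multilinear_def)

lemma multilinear_1: "multilinear (Suc 0) L \<longleftrightarrow> linear (\<lambda>v. L [v])"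
  unfolding multilinear_def by auto

lemma multilinear_zero: "(\<And>vs. length vs = n \<Longrightarrow> L vs = 0) \<Longrightarrow> multilinear n L"
  unfolding multilinear_def by (simp add: linear_iff)

lemma smooth_on_affine:
  assumes "bounded_linear f"
  shows "smooth_on UNIV U (\<lambda>x. c + f x)"
proof -
  interpret bounded_linear f by (rule assms)
  define D where "D x vs = (case vs of [] \<Rightarrow> c + f x | [v] \<Rightarrow> f v | _ \<Rightarrow> 0)" for x :: 'a and vs :: "'a list"
  have D: "D x [] = c + f x" "D x [v] = f v" "D x (v # w # vs) = 0" for x v w vs by (auto simp: D_def)
  have "smooth_jet U D"
    unfolding smooth_jet_def
  proof (intro ballI conjI allI impI)
    fix x and n :: nat
    consider "n = 0" | "n = 1" | "n > 1" by linarith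
    then show "multilinear n (D x)"
    proof cases
      case 3
      then show ?thesis by (intro multilinear_zero) (auto simp: D_def split: list.split)
    qed (auto simp: multilinear_0 multilinear_1 D linear_axioms)
    show "\<exists>B\<ge>0. \<forall>vs. length vs = n \<longrightarrow> norm (D x vs) \<le> B * norm_prod vs"
    proof (rule nonneg_bound)
      fix vs :: "'a list" assume "length vs = n"
      show "norm (D x vs) \<le> (norm (c + f x) + onorm f) * norm_prod vs"
      proof (cases vs rule: remdups_adj.cases)
        case (2 v)
        have "norm (f v) \<le> onorm f * norm v" by (rule onorm[OF assms])
        also have "\<dots> \<le> (norm (c + f x) + onorm f) * norm v" by (intro mult_right_mono) auto
        finally show ?thesis using 2 by (simp add: D)
      next
        case (3 v w us)
        then show ?thesis using norm_prod_nonneg[of vs] onorm_pos_le[OF assms]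
          by (simp only: D norm_zero) (intro mult_nonneg_nonneg add_nonneg_nonneg, auto)
      qed (use onorm_pos_le[OF assms] in \<open>auto simp: D\<close>)
    qed
    fix \<epsilon> :: real assume "\<epsilon> > 0"
    then show "\<exists>\<delta>>0. \<forall>y\<in>U. norm (y - x) < \<delta> \<longrightarrow> (\<forall>vs. length vs = n \<longrightarrow>
       norm (D y vs - D x vs - D x ((y - x) # vs)) \<le> \<epsilon> * norm (y - x) * norm_prod vs)"
    proof (intro exI[of _ 1] conjI ballI allI impI)
      fix y vs
      have "D y vs - D x vs - D x ((y - x) # vs) = 0"
        by (cases vs rule: remdups_adj.cases) (auto simp: D diff)
      then show "norm (D y vs - D x vs - D x ((y - x) # vs)) \<le> \<epsilon> * norm (y - x) * norm_prod vs"
        using \<open>\<epsilon> > 0\<close> norm_prod_nonneg[of vs] by simp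
    qed auto
  qed
  then show ?thesis unfolding smooth_on_iff_jet by (intro exI[of _ D]) (auto simp: D)
qed

lemma smooth_on_const: "smooth_on UNIV U (\<lambda>x. c)"
  using smooth_on_affine[OF bounded_linear_zero] by simp

lemma smooth_on_linear: "bounded_linear f \<Longrightarrow> smooth_on UNIV U f"
  using smooth_on_affine[of f U 0] by simp

lemma smooth_on_bilinear:
  assumes "bounded_bilinear b"
  shows "smooth_on UNIV U (\<lambda>z. b (fst z) (snd z))"
proof -
  interpret bounded_bilinear b by (rule assms)
  obtain K where K: "K > 0" "\<And>x y. norm (b x y) \<le> norm x * norm y * K"
    using pos_bounded by blast
  have bnd: "norm (b (fst p) (snd q)) \<le> K * (norm p * norm q)" for p :: "'a \<times> 'b" and q :: "'a \<times> 'b"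
  proof -
    have norm_le: "norm (fst r) \<le> norm r" "norm (snd r) \<le> norm r" for r :: "'a \<times> 'b"
      by (metis norm_fst_le norm_snd_le prod.collapse)+
    have "norm (b (fst p) (snd q)) \<le> norm (fst p) * norm (snd q) * K" by (rule K)
    also have "\<dots> \<le> norm p * norm q * K"
      using K by (intro mult_right_mono mult_mono norm_le) auto
    finally show ?thesis by (simp add: mult_ac)
  qed
  define D where "D z vs = (case vs of [] \<Rightarrow> b (fst z) (snd z) | [p] \<Rightarrow> b (fst z) (snd p) + b (fst p) (snd z)
      | [p, q] \<Rightarrow> b (fst p) (snd q) + b (fst q) (snd p) | _ \<Rightarrow> 0)" for z :: "'a \<times> 'b" and vs
  have D: "D z [] = b (fst z) (snd z)" "D z [p] = b (fst z) (snd p) + b (fst p) (snd z)"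
      "D z [p, q] = b (fst p) (snd q) + b (fst q) (snd p)" "D z (p # q # r # vs) = 0" for z p q r vs
    by (auto simp: D_def)
  have cases: "(P :: bool)" if "vs = [] \<Longrightarrow> P" "\<And>p. vs = [p] \<Longrightarrow> P" "\<And>p q. vs = [p, q] \<Longrightarrow> P"
    "\<And>p q r us. vs = p # q # r # us \<Longrightarrow> P" for vs :: "('a \<times> 'b) list" and P
    using that by (metis list.exhaust)
  have "smooth_jet U D"
    unfolding smooth_jet_def
  proof (intro ballI conjI allI impI)
    fix z n
    show "multilinear n (D z)"
      unfolding multilinear_def linear_iff
    proof (intro conjI allI impI)
      fix us ws p p' and r :: real
      show "D z (us @ (p + p') # ws) = D z (us @ p # ws) + D z (us @ p' # ws)"
        by (rule cases[of us]; rule cases[of ws]; simp add: D add_left add_right; simp add: D_def)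
      show "D z (us @ (r *\<^sub>R p) # ws) = r *\<^sub>R D z (us @ p # ws)"
        by (rule cases[of us]; rule cases[of ws]; simp add: D scaleR_left scaleR_right scaleR_add_right; simp add: D_def)
    qed
    show "\<exists>B\<ge>0. \<forall>vs. length vs = n \<longrightarrow> norm (D z vs) \<le> B * norm_prod vs"
    proof (rule nonneg_bound)
      fix vs :: "('a \<times> 'b) list" assume "length vs = n"
      define B where "B = norm (b (fst z) (snd z)) + 2 * K * norm z + 2 * K"
      have B: "norm (b (fst z) (snd z)) \<le> B" "2 * K * norm z \<le> B" "2 * K \<le> B" "B \<ge> 0"
        using K by (auto simp: B_def)
      show "norm (D z vs) \<le> B * norm_prod vs"
      proof (rule cases[of vs])
        fix p assume "vs = [p]"
        have "norm (b (fst z) (snd p) + b (fst p) (snd z)) \<le> K * (norm z * norm p) + K * (norm p * norm z)"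
          by (rule norm_triangle_mono[OF bnd bnd])
        also have "\<dots> = 2 * K * norm z * norm p" by simp
        also have "\<dots> \<le> B * norm p" using B by (intro mult_right_mono) auto
        finally show ?thesis using \<open>vs = [p]\<close> by (simp add: D)
      next
        fix p q assume "vs = [p, q]"
        have "norm (b (fst p) (snd q) + b (fst q) (snd p)) \<le> K * (norm p * norm q) + K * (norm q * norm p)"
          by (rule norm_triangle_mono[OF bnd bnd])
        also have "\<dots> = 2 * K * (norm p * norm q)" by simp
        also have "\<dots> \<le> B * (norm p * norm q)" using B by (intro mult_right_mono) auto
        finally show ?thesis using \<open>vs = [p, q]\<close> by (simp add: D)
      next
        fix p q r us assume "vs = p # q # r # us"
        then show ?thesis using B norm_prod_nonneg[of vs] by (simp only: D norm_zero) (intro mult_nonneg_nonneg)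
      qed (use B in \<open>auto simp: D\<close>)
    qed
    fix \<epsilon> :: real assume e: "\<epsilon> > 0"
    show "\<exists>\<delta>>0. \<forall>y\<in>U. norm (y - z) < \<delta> \<longrightarrow> (\<forall>vs. length vs = n \<longrightarrow>
       norm (D y vs - D z vs - D z ((y - z) # vs)) \<le> \<epsilon> * norm (y - z) * norm_prod vs)"
    proof (intro exI[of _ "\<epsilon> / K"] conjI ballI allI impI)
      show "\<epsilon> / K > 0" using e K by simp
      fix y and vs :: "('a \<times> 'b) list" assume y: "norm (y - z) < \<epsilon> / K"
      have rhs: "0 \<le> \<epsilon> * norm (y - z) * norm_prod vs" using e norm_prod_nonneg[of vs] by simp
      show "norm (D y vs - D z vs - D z ((y - z) # vs)) \<le> \<epsilon> * norm (y - z) * norm_prod vs"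
      proof (rule cases[of vs])
        assume "vs = []"
        have "D y [] - D z [] - D z [y - z] = b (fst (y - z)) (snd (y - z))"
          by (simp add: D diff_left diff_right algebra_simps)
        also have "norm \<dots> \<le> K * (norm (y - z) * norm (y - z))" by (rule bnd)
        also have "\<dots> = (K * norm (y - z)) * norm (y - z)" by simp
        also have "\<dots> \<le> \<epsilon> * norm (y - z)" using y K by (intro mult_right_mono) (auto simp: field_simps)
        finally show ?thesis using \<open>vs = []\<close> by simp
      next
        fix p assume "vs = [p]"
        then have "D y vs - D z vs - D z ((y - z) # vs) = 0"
          by (simp add: D diff_left diff_right algebra_simps)
        then show ?thesis using rhs by simp
      next
        fix p q assume "vs = [p, q]"
        then have "D y vs - D z vs - D z ((y - z) # vs) = 0" by (simp add: D)
        then show ?thesis using rhs by simp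
      next
        fix p q r us assume "vs = p # q # r # us"
        then have "D y vs - D z vs - D z ((y - z) # vs) = 0" by (simp add: D)
        then show ?thesis using rhs by simp
      qed
    qed
  qed
  then show ?thesis unfolding smooth_on_iff_jet by (intro exI[of _ D]) (auto simp: D)
qed

lemma smooth_on_Pair:
  assumes "smooth_on UNIV U f" "smooth_on UNIV U g"
  shows "smooth_on UNIV U (\<lambda>x. (f x, g x))"
proof -
  from assms obtain A G where A: "smooth_jet U A" "\<forall>x\<in>U. A x [] = f x" and G: "smooth_jet U G" "\<forall>x\<in>U. G x [] = g x"
    unfolding smooth_on_iff_jet by blast
  have "smooth_jet U (\<lambda>x vs. (A x vs, G x vs))"
    unfolding smooth_jet_def
  proof (intro ballI conjI allI impI)
    fix x and n :: nat assume x: "x \<in> U"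
    show "multilinear n (\<lambda>vs. (A x vs, G x vs))"
      using smooth_jet_multilinear[OF A(1) x, of n] smooth_jet_multilinear[OF G(1) x, of n]
      unfolding multilinear_def linear_iff by simp
    obtain a where a: "a \<ge> 0" "\<And>vs. length vs = n \<Longrightarrow> norm (A x vs) \<le> a * norm_prod vs"
      using smooth_jet_bound[OF A(1) x, of n] by blast
    obtain b where b: "b \<ge> 0" "\<And>vs. length vs = n \<Longrightarrow> norm (G x vs) \<le> b * norm_prod vs"
      using smooth_jet_bound[OF G(1) x, of n] by blast
    show "\<exists>B\<ge>0. \<forall>vs. length vs = n \<longrightarrow> norm (A x vs, G x vs) \<le> B * norm_prod vs"
    proof (intro exI[of _ "a + b"] conjI allI impI)
      fix vs assume "length (vs :: 'a list) = n"
      then have "norm (A x vs) + norm (G x vs) \<le> a * norm_prod vs + b * norm_prod vs"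
        by (intro add_mono a b)
      then show "norm (A x vs, G x vs) \<le> (a + b) * norm_prod vs"
        using norm_Pair_le[of "A x vs" "G x vs"] by (simp add: distrib_right)
    qed (use a b in auto)
    fix \<epsilon> :: real assume "\<epsilon> > 0"
    then have e2: "\<epsilon> / 2 > 0" by simp
    obtain d1 where d1: "d1 > 0"
      "\<And>y vs. y \<in> U \<Longrightarrow> norm (y - x) < d1 \<Longrightarrow> length vs = n \<Longrightarrow>
        norm (A y vs - A x vs - A x ((y - x) # vs)) \<le> \<epsilon> / 2 * norm (y - x) * norm_prod vs"
      using smooth_jet_deriv[OF A(1) x e2, of n] by blast
    obtain d2 where d2: "d2 > 0"
      "\<And>y vs. y \<in> U \<Longrightarrow> norm (y - x) < d2 \<Longrightarrow> length vs = n \<Longrightarrow>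
        norm (G y vs - G x vs - G x ((y - x) # vs)) \<le> \<epsilon> / 2 * norm (y - x) * norm_prod vs"
      using smooth_jet_deriv[OF G(1) x e2, of n] by blast
    show "\<exists>\<delta>>0. \<forall>y\<in>U. norm (y - x) < \<delta> \<longrightarrow> (\<forall>vs. length vs = n \<longrightarrow>
       norm ((A y vs, G y vs) - (A x vs, G x vs) - (A x ((y - x) # vs), G x ((y - x) # vs)))
         \<le> \<epsilon> * norm (y - x) * norm_prod vs)"
    proof (intro exI[of _ "min d1 d2"] conjI ballI allI impI)
      fix y and vs :: "'a list" assume y: "y \<in> U" "norm (y - x) < min d1 d2" "length vs = n"
      have "norm (A y vs - A x vs - A x ((y - x) # vs)) + norm (G y vs - G x vs - G x ((y - x) # vs))
          \<le> \<epsilon> / 2 * norm (y - x) * norm_prod vs + \<epsilon> / 2 * norm (y - x) * norm_prod vs"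
        using y by (intro add_mono d1 d2) auto
      then show "norm ((A y vs, G y vs) - (A x vs, G x vs) - (A x ((y - x) # vs), G x ((y - x) # vs)))
         \<le> \<epsilon> * norm (y - x) * norm_prod vs"
        using norm_Pair_le[of "A y vs - A x vs - A x ((y - x) # vs)" "G y vs - G x vs - G x ((y - x) # vs)"]
        by (simp add: algebra_simps)
    qed (use d1 d2 in auto)
  qed
  then show ?thesis
    unfolding smooth_on_iff_jet using A G by (intro exI[of _ "\<lambda>x vs. (A x vs, G x vs)"]) auto
qed

lemma smooth_on_bounded_linear:
  assumes "bounded_linear T" "smooth_on UNIV U f"
  shows "smooth_on UNIV U (\<lambda>x. T (f x))"
  by (rule smooth_on_compose[OF assms(2) smooth_on_linear[OF assms(1), of UNIV]]) simp

lemma smooth_on_bounded_bilinear: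
  assumes "bounded_bilinear b" "smooth_on UNIV U f" "smooth_on UNIV U g"
  shows "smooth_on UNIV U (\<lambda>x. b (f x) (g x))"
  using smooth_on_compose[OF smooth_on_Pair[OF assms(2,3)] smooth_on_bilinear[OF assms(1), of UNIV]] by simp

lemma smooth_on_id: "smooth_on UNIV U (\<lambda>x. x)"
  by (rule smooth_on_linear[OF bounded_linear_ident])

lemma smooth_on_add:
  assumes "smooth_on UNIV U f" "smooth_on UNIV U g"
  shows "smooth_on UNIV U (\<lambda>x. f x + g x)"
  using smooth_on_bounded_linear[OF bounded_linear_add[OF bounded_linear_fst bounded_linear_snd]
      smooth_on_Pair[OF assms]] by simp

lemma smooth_on_diff:
  assumes "smooth_on UNIV U f" "smooth_on UNIV U g"
  shows "smooth_on UNIV U (\<lambda>x. f x - g x)"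
  using smooth_on_bounded_linear[OF bounded_linear_sub[OF bounded_linear_fst bounded_linear_snd]
      smooth_on_Pair[OF assms]] by simp

lemmas smooth_on_scaleR = smooth_on_bounded_bilinear[OF bounded_bilinear_scaleR]
  and smooth_on_mult = smooth_on_bounded_bilinear[OF bounded_bilinear_mult]
  and smooth_on_inner = smooth_on_bounded_bilinear[OF bounded_bilinear_inner]

text \<open>In a field, \<open>n\<close>-linear maps over the field are multiplications: the \<open>n\<close>-th derivative is
  \<open>g n x\<close> times the product of the \<open>n\<close> directions.\<close>

lemma smooth_on_field_derivatives:
  fixes g :: "nat \<Rightarrow> 'k::real_normed_field \<Rightarrow> 'k"
  assumes g: "\<And>n x. x \<in> U \<Longrightarrow> (g n has_field_derivative g (Suc n) x) (at x)"
  shows "smooth_on UNIV U (g 0)"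
proof -
  define D where "D x vs = g (length vs) x * prod_list vs" for x and vs :: "'k list"
  have norm_prod_list: "norm (prod_list vs) = norm_prod vs" for vs :: "'k list"
    by (induction vs) (auto simp: norm_mult)
  have "smooth_jet U D"
    unfolding smooth_jet_def
  proof (intro ballI conjI allI impI)
    fix x n assume x: "x \<in> U"
    show "multilinear n (D x)"
      unfolding multilinear_def linear_iff by (simp add: D_def distrib_left distrib_right)
    show "\<exists>B\<ge>0. \<forall>vs. length vs = n \<longrightarrow> norm (D x vs) \<le> B * norm_prod vs"
      by (rule exI[of _ "norm (g n x)"]) (simp add: D_def norm_mult norm_prod_list)
    fix \<epsilon> :: real assume e: "\<epsilon> > 0"
    have "(g n has_derivative (\<lambda>h. g (Suc n) x * h)) (at x)"
      using g[OF x] by (simp add: has_field_derivative_def)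
    with e obtain d where d: "d > 0"
      "\<And>y. norm (y - x) < d \<Longrightarrow> norm (g n y - g n x - g (Suc n) x * (y - x)) \<le> \<epsilon> * norm (y - x)"
      unfolding has_derivative_at_alt by blast
    show "\<exists>\<delta>>0. \<forall>y\<in>U. norm (y - x) < \<delta> \<longrightarrow> (\<forall>vs. length vs = n \<longrightarrow>
       norm (D y vs - D x vs - D x ((y - x) # vs)) \<le> \<epsilon> * norm (y - x) * norm_prod vs)"
    proof (intro exI[of _ d] conjI ballI allI impI)
      fix y and vs :: "'k list" assume y: "norm (y - x) < d" "length vs = n"
      have "D y vs - D x vs - D x ((y - x) # vs) = (g n y - g n x - g (Suc n) x * (y - x)) * prod_list vs"
        using y by (simp add: D_def algebra_simps)
      then have "norm (D y vs - D x vs - D x ((y - x) # vs)) =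
          norm (g n y - g n x - g (Suc n) x * (y - x)) * norm_prod vs"
        by (simp add: norm_mult norm_prod_list)
      also have "\<dots> \<le> \<epsilon> * norm (y - x) * norm_prod vs"
        by (intro mult_right_mono d y norm_prod_nonneg)
      finally show "norm (D y vs - D x vs - D x ((y - x) # vs)) \<le> \<epsilon> * norm (y - x) * norm_prod vs" .
    qed (rule d)
  qed
  then show ?thesis unfolding smooth_on_iff_jet by (intro exI[of _ D]) (auto simp: D_def)
qed

lemma smooth_on_inverse:
  fixes f :: "'a::real_normed_vector \<Rightarrow> 'k::real_normed_field"
  assumes "smooth_on UNIV U f" "\<And>x. x \<in> U \<Longrightarrow> f x \<noteq> 0"
  shows "smooth_on UNIV U (\<lambda>x. inverse (f x))"
proof -
  define g :: "nat \<Rightarrow> 'k \<Rightarrow> 'k" where "g n x = (- 1) ^ n * fact n * inverse x ^ Suc n" for n x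
  have "smooth_on UNIV (- {0}) (g 0)"
  proof (rule smooth_on_field_derivatives)
    fix n and x :: 'k assume "x \<in> - {0}"
    then have "((\<lambda>x. inverse x ^ Suc n) has_field_derivative
        of_nat (Suc n) * (inverse x ^ n * - (inverse x * inverse x))) (at x)"
      using DERIV_power[OF DERIV_inverse', of "\<lambda>x. x" 1 x UNIV "Suc n"] by (simp add: mult_ac)
    then show "(g n has_field_derivative g (Suc n) x) (at x)"
      unfolding g_def by (rule DERIV_cmult[THEN DERIV_cong]) (simp add: algebra_simps)
  qed
  then have "smooth_on UNIV U (\<lambda>x. g 0 (f x))"
    by (rule smooth_on_compose[OF assms(1)]) (use assms(2) in auto)
  then show ?thesis by (simp add: g_def)
qed

lemma smooth_on_sqrt:
  assumes "smooth_on UNIV U f" "\<And>x. x \<in> U \<Longrightarrow> f x > 0"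
  shows "smooth_on UNIV U (\<lambda>x. sqrt (f x))"
proof -
  \<comment> \<open>The \<open>n\<close>-th derivative of \<open>x powr (1 / 2)\<close> is \<open>c n * x powr (1 / 2 - n)\<close>.\<close>
  define c :: "nat \<Rightarrow> real" where "c n = (\<Prod>i<n. 1 / 2 - real i)" for n
  define g where "g n x = c n * x powr (1 / 2 - real n)" for n x
  have "smooth_on UNIV {0<..} (g 0)"
  proof (rule smooth_on_field_derivatives)
    fix n and x :: real assume "x \<in> {0<..}"
    then have "(g n has_field_derivative c n * ((1 / 2 - real n) * x powr (1 / 2 - real n - 1))) (at x)"
      unfolding g_def by (intro DERIV_cmult has_real_derivative_powr) simp
    then show "(g n has_field_derivative g (Suc n) x) (at x)"
      by (simp add: g_def c_def algebra_simps)
  qed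
  then have "smooth_on UNIV {0<..} sqrt"
    by (rule smooth_on_cong) (auto simp: g_def c_def powr_half_sqrt)
  from smooth_on_compose[OF assms(1) this] assms(2) show ?thesis by force
qed

lemma smooth_on_imp_differentiable:
  assumes "smooth_on UNIV U f" "open U" "x \<in> U"
  shows "f differentiable (at x)"
proof -
  from assms obtain D where D: "smooth_jet U D" "\<forall>x\<in>U. D x [] = f x"
    unfolding smooth_on_iff_jet by blast
  obtain B where B: "\<And>vs. length vs = Suc 0 \<Longrightarrow> norm (D x vs) \<le> B * norm_prod vs"
    using smooth_jet_bound[OF D(1) assms(3), of "Suc 0"] by blast
  have "bounded_linear (\<lambda>v. D x [v])"
    unfolding bounded_linear_def bounded_linear_axioms_def
  proof (intro conjI exI[of _ B] allI)
    show "linear (\<lambda>v. D x [v])"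
      using smooth_jet_multilinear[OF D(1) assms(3), of "Suc 0"] by (simp add: multilinear_1)
    show "norm (D x [v]) \<le> norm v * B" for v using B[of "[v]"] by (simp add: mult.commute)
  qed
  moreover have "\<exists>d>0. \<forall>y. norm (y - x) < d \<longrightarrow> norm (f y - f x - D x [y - x]) \<le> e * norm (y - x)"
    if "e > 0" for e
  proof -
    obtain d where d: "d > 0" "\<And>y vs. y \<in> U \<Longrightarrow> norm (y - x) < d \<Longrightarrow> length vs = 0 \<Longrightarrow>
        norm (D y vs - D x vs - D x ((y - x) # vs)) \<le> e * norm (y - x) * norm_prod vs"
      using smooth_jet_deriv[OF D(1) assms(3) \<open>e > 0\<close>, of 0] by blast
    from assms(2,3) obtain d' where d': "d' > 0" "\<And>y. dist y x < d' \<Longrightarrow> y \<in> U"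
      unfolding open_dist by blast
    show ?thesis
    proof (intro exI[of _ "min d d'"] conjI allI impI)
      fix y assume "norm (y - x) < min d d'"
      then have "y \<in> U" "norm (y - x) < d" using d'(2)[of y] by (auto simp: dist_norm)
      with d(2)[of y "[]"] D(2) assms(3) show "norm (f y - f x - D x [y - x]) \<le> e * norm (y - x)" by simp
    qed (use d d' in auto)
  qed
  ultimately have "(f has_derivative (\<lambda>v. D x [v])) (at x)"
    unfolding has_derivative_at_alt by blast
  then show ?thesis by (auto simp: differentiable_def)
qed

lemma smooth_on_imp_continuous_on: "smooth_on UNIV U f \<Longrightarrow> open U \<Longrightarrow> continuous_on U f"
  using smooth_on_imp_differentiable differentiable_imp_continuous_within
  by (metis continuous_at_imp_continuous_on)


text \<open>The bridge between the smoothness calculus on the whole space and local expressions in a chart with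
  model space \<open>E\<close>: such an expression is smooth and differentiable within \<open>E\<close> as soon as it is the
  restriction of a smooth function on an open subset of the whole space.\<close>

lemma restriction_of_smooth:
  assumes "smooth_on UNIV V F" "open V" "S = E \<inter> V" "\<And>x. x \<in> S \<Longrightarrow> f x = F x"
  shows "smooth_on E S f" and "openin (top_of_set E) S"
    and "x \<in> S \<Longrightarrow> f differentiable (at x within E)"
proof -
  have "smooth_on E S F" by (rule smooth_on_subset[OF assms(1)]) (use assms in auto)
  then show "smooth_on E S f" by (rule smooth_on_cong) (simp add: assms)
  show "openin (top_of_set E) S" using assms by (simp add: openin_open_Int)
  assume x: "x \<in> S"
  then have "F differentiable (at x)" using assms smooth_on_imp_differentiable by blast
  then obtain D where "(F has_derivative D) (at x within E)"
    unfolding differentiable_def using has_derivative_at_withinI by blast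
  moreover from assms x obtain d where d: "d > 0" "ball x d \<subseteq> V" by (auto simp: open_contains_ball)
  ultimately have "(f has_derivative D) (at x within E)"
    using assms(3,4) x
    by (elim has_derivative_transform_within) (auto simp: dist_commute subset_iff)
  then show "f differentiable (at x within E)" by (auto simp: differentiable_def)
qed

section \<open>Tangent vectors as velocities of curves\<close>

text \<open>A derivative within a subspace is determined on this subspace, since it can be computed along lines.\<close>

lemma frechet_derivative_within_subspace:
  assumes E: "subspace E" "x \<in> E" "u \<in> E" and f: "(f has_derivative D) (at x within E)"
  shows "frechet_derivative f (at x within E) u = D u"
proof -
  have deriv_line: "((\<lambda>t. f (x + t *\<^sub>R u)) has_vector_derivative F u) (at 0)"
    if "(f has_derivative F) (at x within E)" for F
  proof -
    interpret F: bounded_linear F by (rule has_derivative_bounded_linear[OF that])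
    have line: "((\<lambda>t. x + t *\<^sub>R u) has_derivative (\<lambda>t. t *\<^sub>R u)) (at 0)"
      by (auto intro!: derivative_eq_intros)
    have "(\<lambda>t. x + t *\<^sub>R u) ` UNIV \<subseteq> E"
      using E by (auto intro: subspace_add subspace_scale)
    then have "((\<lambda>t. f (x + t *\<^sub>R u)) has_derivative (\<lambda>t. F (t *\<^sub>R u))) (at 0)"
      using that by (intro has_derivative_in_compose[OF line]) (auto intro: has_derivative_subset)
    then show ?thesis by (simp add: has_vector_derivative_def F.scaleR)
  qed
  have "(f has_derivative frechet_derivative f (at x within E)) (at x within E)"
    using f frechet_derivative_works differentiable_def by blast
  from vector_derivative_unique_at[OF deriv_line[OF this] deriv_line[OF f]] show ?thesis .
qed

lemma has_vector_derivative_in_closed_subspace: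
  assumes E: "subspace E" "closed E" and g: "(g has_vector_derivative v) (at 0)"
    and ev: "eventually (\<lambda>t. g t \<in> E) (nhds (0::real))"
  shows "v \<in> E"
proof -
  from g have "((\<lambda>t. norm (g t - g 0 - t *\<^sub>R v) / norm t) \<longlongrightarrow> 0) (at 0)"
    by (simp add: has_vector_derivative_def has_derivative_at)
  moreover have "norm (g t - g 0 - t *\<^sub>R v) / norm t = norm ((g t - g 0) /\<^sub>R t - v)" if "t \<noteq> 0" for t
  proof -
    have "(g t - g 0) /\<^sub>R t - v = (g t - g 0 - t *\<^sub>R v) /\<^sub>R t"
      using that by (simp add: scaleR_diff_right)
    then show ?thesis by (simp add: divide_inverse mult.commute)
  qed
  ultimately have "((\<lambda>t. norm ((g t - g 0) /\<^sub>R t - v)) \<longlongrightarrow> 0) (at 0)"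
    by (elim Lim_transform_eventually) (auto simp: eventually_at_filter)
  then have "((\<lambda>t. (g t - g 0) /\<^sub>R t) \<longlongrightarrow> v) (at 0)"
    using Lim_null tendsto_norm_zero_iff by blast
  moreover have ev': "eventually (\<lambda>t. (g t - g 0) /\<^sub>R t \<in> E) (at 0)"
  proof -
    have g0: "g 0 \<in> E" using ev by (rule eventually_nhds_x_imp_x)
    then show ?thesis
      using ev E(1) unfolding eventually_at_filter
      by eventually_elim (simp add: subspace_scale[OF E(1)] subspace_diff[OF E(1)] g0)
  qed
  ultimately show ?thesis by (intro Lim_in_closed_set[OF E(2) ev']) (simp_all add: trivial_limit_at)
qed

lemma cinv_ccoord: "inj_on (ccoord c) (cdom c) \<Longrightarrow> p \<in> cdom c \<Longrightarrow> cinv c (ccoord c p) = p"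
  by (simp add: cinv_def)

lemma cinv_in_cdom: "x \<in> crange c \<Longrightarrow> cinv c x \<in> cdom c"
  by (simp add: cinv_def crange_def inv_into_into)

lemma ccoord_image:
  "inj_on (ccoord c) (cdom c) \<Longrightarrow> ccoord c ` (cdom c \<inter> P) = {x \<in> crange c. cinv c x \<in> P}"
  by (auto simp: cinv_ccoord cinv_in_cdom crange_def image_iff)

definition differentiable_at_point ::
    "('m, 'e::real_normed_vector) chart set \<Rightarrow> ('m \<Rightarrow> 'b::real_normed_vector) \<Rightarrow> 'm \<Rightarrow> bool" where
  "differentiable_at_point A f p \<longleftrightarrow>
     (\<forall>c\<in>charts_at A p. (f \<circ> cinv c) differentiable (at (ccoord c p) within cmodel c))"

text \<open>What is used of a smooth atlas below.  Differentiability within the model space is a separate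
  requirement because it asks for a derivative that is defined on the whole ambient space.\<close>

definition differentiable_atlas :: "('m, 'e::real_normed_vector) chart set \<Rightarrow> bool" where
  "differentiable_atlas A \<longleftrightarrow>
     (\<forall>c\<in>A. subspace (cmodel c) \<and> closed (cmodel c) \<and> inj_on (ccoord c) (cdom c) \<and>
        crange c \<subseteq> cmodel c) \<and>
     (\<forall>p. \<forall>d\<in>charts_at A p. differentiable_at_point A (ccoord d) p)"

lemma differentiable_atlasI:
  assumes "smooth_atlas A" "\<And>p d. d \<in> charts_at A p \<Longrightarrow> differentiable_at_point A (ccoord d) p"
  shows "differentiable_atlas A"
  unfolding differentiable_atlas_def
proof (intro conjI ballI allI assms(2))
  fix c assume "c \<in> A"
  with assms(1) show "subspace (cmodel c)" "closed (cmodel c)" "inj_on (ccoord c) (cdom c)" "crange c \<subseteq> cmodel c"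
    unfolding smooth_atlas_def by (meson openin_imp_subset)+
qed

definition differentiable_curve :: "('m, 'e::real_normed_vector) chart set \<Rightarrow> (real \<Rightarrow> 'm) \<Rightarrow> bool" where
  "differentiable_curve A \<gamma> \<longleftrightarrow> \<gamma> 0 \<in> points A \<and> (\<forall>c\<in>charts_at A (\<gamma> 0).
     eventually (\<lambda>t. \<gamma> t \<in> cdom c) (nhds 0) \<and> (\<lambda>t. ccoord c (\<gamma> t)) differentiable (at 0))"

text \<open>The tangent vector represented by a curve, at the parameter \<open>0\<close>.\<close>

definition velocity ::
    "('m, 'e::real_normed_vector) chart set \<Rightarrow> (real \<Rightarrow> 'm) \<Rightarrow> ('m, 'e) tangent" where
  "velocity A \<gamma> =
     (\<lambda>c. if c \<in> charts_at A (\<gamma> 0) then vector_derivative (\<lambda>t. ccoord c (\<gamma> t)) (at 0) else 0)"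

lemma tangent_transition:
  "v \<in> tangent_space A p \<Longrightarrow> c \<in> charts_at A p \<Longrightarrow> d \<in> charts_at A p \<Longrightarrow>
    v d = chart_deriv c (ccoord d) p (v c)"
  unfolding tangent_space_def by blast

lemma tangent_outside: "v \<in> tangent_space A p \<Longrightarrow> c \<notin> charts_at A p \<Longrightarrow> v c = 0"
  unfolding tangent_space_def by blast

text \<open>A tangent vector is determined by its coordinates in a single chart.\<close>

lemma tangent_eqI:
  assumes "v \<in> tangent_space A p" "w \<in> tangent_space A p" "c \<in> charts_at A p" "v c = w c"
  shows "v = w"
proof
  fix d
  show "v d = w d"
    using assms(4) tangent_transition[OF assms(1,3), of d] tangent_transition[OF assms(2,3), of d]
      tangent_outside[OF assms(1), of d] tangent_outside[OF assms(2), of d] by metis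
qed

lemma tangent_of_coord_eq:
  "v \<in> tangent_space A p \<Longrightarrow> c \<in> charts_at A p \<Longrightarrow> tangent_of_coord A c p (v c) = v"
  using tangent_transition[of v A p c] tangent_outside[of v A p]
  by (intro ext) (metis tangent_of_coord_def)

lemma tangent_in_model: "v \<in> tangent_space A p \<Longrightarrow> c \<in> charts_at A p \<Longrightarrow> v c \<in> cmodel c"
  unfolding tangent_space_def by blast

lemma charts_at_nonempty: "p \<in> points A \<longleftrightarrow> charts_at A p \<noteq> {}"
  by (auto simp: points_def charts_at_def)

context
  fixes A :: "('m, 'e::real_normed_vector) chart set"
  assumes A: "differentiable_atlas A"
begin

text \<open>The chain rule applied to \<open>f \<circ> \<gamma> = (f \<circ> cinv c) \<circ> (ccoord c \<circ> \<gamma>)\<close>.  This gives the derivative of a chart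
  expression in the direction of the velocity of a curve without differentiating the expression.\<close>

lemma chart_deriv_along_curve:
  assumes \<gamma>: "differentiable_curve A \<gamma>" and c: "c \<in> charts_at A (\<gamma> 0)"
    and f: "differentiable_at_point A f (\<gamma> 0)"
  shows "((\<lambda>t. f (\<gamma> t)) has_vector_derivative chart_deriv c f (\<gamma> 0) (velocity A \<gamma> c)) (at 0)"
proof -
  let ?D = "chart_deriv c f (\<gamma> 0)" and ?g = "\<lambda>t. ccoord c (\<gamma> t)"
  from c A have inj: "inj_on (ccoord c) (cdom c)" and sub: "crange c \<subseteq> cmodel c"
    by (auto simp: charts_at_def differentiable_atlas_def)
  from \<gamma> c have "eventually (\<lambda>t. \<gamma> t \<in> cdom c) (nhds 0)" by (simp add: differentiable_curve_def)
  then obtain S where S: "open S" "0 \<in> S" "\<And>t. t \<in> S \<Longrightarrow> \<gamma> t \<in> cdom c"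
    by (auto simp: eventually_nhds)
  have "?g differentiable (at 0)" using \<gamma> c by (simp add: differentiable_curve_def)
  then have "(?g has_vector_derivative velocity A \<gamma> c) (at 0)"
    using c by (simp add: velocity_def vector_derivative_works)
  then have g: "(?g has_derivative (\<lambda>t. t *\<^sub>R velocity A \<gamma> c)) (at 0 within S)"
    by (simp add: has_vector_derivative_def has_derivative_at_withinI)
  have D: "((f \<circ> cinv c) has_derivative ?D) (at (?g 0) within cmodel c)"
    using f c by (auto simp: differentiable_at_point_def chart_deriv_def frechet_derivative_works)
  moreover have "?g ` S \<subseteq> cmodel c" using S sub by (auto simp: crange_def)
  ultimately have "((\<lambda>t. (f \<circ> cinv c) (?g t)) has_derivative (\<lambda>t. ?D (t *\<^sub>R velocity A \<gamma> c))) (at 0 within S)"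
    by (intro has_derivative_in_compose[OF g]) (rule has_derivative_subset)
  then have "((\<lambda>t. f (\<gamma> t)) has_derivative (\<lambda>t. ?D (t *\<^sub>R velocity A \<gamma> c))) (at 0 within S)"
    by (rule has_derivative_transform[rotated 2]) (use S in \<open>auto simp: cinv_ccoord[OF inj]\<close>)
  moreover have "(\<lambda>t. ?D (t *\<^sub>R velocity A \<gamma> c)) = (\<lambda>t. t *\<^sub>R ?D (velocity A \<gamma> c))"
    by (simp only: linear_scale[OF has_derivative_linear[OF D]])
  moreover have "at 0 within S = at 0" using S by (simp only: at_within_open)
  ultimately show ?thesis unfolding has_vector_derivative_def by (simp only:)
qed

lemma velocity_in_tangent_space:
  assumes \<gamma>: "differentiable_curve A \<gamma>"
  shows "velocity A \<gamma> \<in> tangent_space A (\<gamma> 0)"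
  unfolding tangent_space_def
proof (intro CollectI conjI ballI allI impI)
  fix c assume c: "c \<in> charts_at A (\<gamma> 0)"
  then have 1: "subspace (cmodel c)" "closed (cmodel c)" "crange c \<subseteq> cmodel c"
    using A by (auto simp: charts_at_def differentiable_atlas_def)
  have "(\<lambda>t. ccoord c (\<gamma> t)) differentiable (at 0)" using \<gamma> c by (simp add: differentiable_curve_def)
  then have 2: "((\<lambda>t. ccoord c (\<gamma> t)) has_vector_derivative velocity A \<gamma> c) (at 0)"
    using c by (simp add: velocity_def vector_derivative_works)
  have "eventually (\<lambda>t. \<gamma> t \<in> cdom c) (nhds 0)" using \<gamma> c by (simp add: differentiable_curve_def)
  then have "eventually (\<lambda>t. ccoord c (\<gamma> t) \<in> cmodel c) (nhds 0)"
    by eventually_elim (use 1 in \<open>auto simp: crange_def\<close>)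
  then show "velocity A \<gamma> c \<in> cmodel c"
    by (rule has_vector_derivative_in_closed_subspace[OF 1(1,2) 2])
  fix d assume d: "d \<in> charts_at A (\<gamma> 0)"
  then have "differentiable_at_point A (ccoord d) (\<gamma> 0)" using A by (simp add: differentiable_atlas_def)
  from chart_deriv_along_curve[OF \<gamma> c this]
  show "velocity A \<gamma> d = chart_deriv c (ccoord d) (\<gamma> 0) (velocity A \<gamma> c)"
    using d by (simp add: velocity_def vector_derivative_at)
qed (simp add: velocity_def)

lemma dfun_velocity:
  assumes \<gamma>: "differentiable_curve A \<gamma>" and f: "differentiable_at_point A f (\<gamma> 0)"
  shows "((\<lambda>t. f (\<gamma> t)) has_vector_derivative dfun A f (\<gamma> 0) (velocity A \<gamma>)) (at 0)"
proof -
  have "charts_at A (\<gamma> 0) \<noteq> {}" using \<gamma> unfolding differentiable_curve_def charts_at_nonempty by blast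
  then have "(SOME c. c \<in> charts_at A (\<gamma> 0)) \<in> charts_at A (\<gamma> 0)" by (simp add: some_in_eq)
  from chart_deriv_along_curve[OF \<gamma> this f] show ?thesis by (simp add: dfun_def Let_def)
qed

lemma dmap_velocity:
  assumes \<gamma>: "differentiable_curve A \<gamma>"
    and f: "\<And>d. d \<in> charts_at B (f (\<gamma> 0)) \<Longrightarrow> differentiable_at_point A (ccoord d \<circ> f) (\<gamma> 0)"
  shows "dmap A B f (\<gamma> 0) (velocity A \<gamma>) = velocity B (f \<circ> \<gamma>)"
proof
  fix d
  show "dmap A B f (\<gamma> 0) (velocity A \<gamma>) d = velocity B (f \<circ> \<gamma>) d"
    using vector_derivative_at[OF dfun_velocity[OF \<gamma> f, of d]]
    by (simp add: dmap_def velocity_def[of B] comp_def)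
qed

end

section \<open>The complex structure and the Riesz representation theorem\<close>

lemma cinner_add_left: "cinner (a + b) c = cinner a c + cinner b c"
  by transfer (simp add: distrib_right integrable_mult_cnj)

lemma cinner_scaleC_left: "cinner (\<zeta> *\<^sub>C a) b = \<zeta> * cinner a b"
  by transfer (simp add: mult.assoc)

lemma cinner_commute: "cinner b a = cnj (cinner a b)"
proof transfer
  fix f g :: "'a \<Rightarrow> complex"
  have "(LINT z|lborel. f z * cnj (g z)) = (LINT z|lborel. cnj (g z * cnj (f z)))"
    by (simp add: mult.commute)
  also have "\<dots> = cnj (LINT z|lborel. g z * cnj (f z))"
    by (rule Bochner_Integration.integral_cnj)
  finally show "(LINT z|lborel. f z * cnj (g z)) = cnj (LINT z|lborel. g z * cnj (f z))" .
qed

lemma cinner_add_right: "cinner a (b + c) = cinner a b + cinner a c"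
  by (simp only: cinner_commute[of a] cinner_add_left complex_cnj_add)

lemma cinner_scaleC_right: "cinner a (\<zeta> *\<^sub>C b) = cnj \<zeta> * cinner a b"
  by (simp only: cinner_commute[of a] cinner_scaleC_left complex_cnj_mult)

lemma scaleC_of_real: "complex_of_real r *\<^sub>C a = r *\<^sub>R a"
  by (simp add: scaleR_L2_def)

lemma scaleC_add_right: "\<zeta> *\<^sub>C (a + b) = \<zeta> *\<^sub>C a + \<zeta> *\<^sub>C b"
  by transfer (auto intro!: square_integrable_add square_integrable_scale simp: distrib_left)

lemma scaleC_add_left: "(\<zeta> + \<xi>) *\<^sub>C a = \<zeta> *\<^sub>C a + \<xi> *\<^sub>C a"
  by transfer (auto intro!: square_integrable_add square_integrable_scale simp: distrib_right
      dest: square_integrable_scale)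

lemma scaleC_scaleC: "\<zeta> *\<^sub>C \<xi> *\<^sub>C a = (\<zeta> * \<xi>) *\<^sub>C a"
  by transfer (auto intro!: square_integrable_scale simp: mult.assoc[symmetric] dest: square_integrable_scale)

lemma scaleC_one: "1 *\<^sub>C a = a"
  using scaleC_of_real[of 1 a] by simp

lemma scaleR_scaleC: "r *\<^sub>R \<zeta> *\<^sub>C a = \<zeta> *\<^sub>C r *\<^sub>R a"
  by (simp add: scaleC_of_real[symmetric] scaleC_scaleC mult.commute)

lemma cinner_scaleR_left: "cinner (r *\<^sub>R a) b = r * cinner a b"
  by (simp add: scaleC_of_real[symmetric] cinner_scaleC_left)

lemma cinner_scaleR_right: "cinner a (r *\<^sub>R b) = r * cinner a b"
  by (simp add: scaleC_of_real[symmetric] cinner_scaleC_right)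

lemma Re_cinner: "Re (cinner a b) = inner a b"
  by (simp add: inner_L2_def)

lemma cinner_self: "cinner a a = complex_of_real ((norm a)\<^sup>2)"
proof (rule complex_eqI)
  show "Re (cinner a a) = Re (complex_of_real ((norm a)\<^sup>2))"
    by (simp add: Re_cinner power2_norm_eq_inner del: of_real_power)
  have "Im (cinner a a) = Im (cnj (cinner a a))" using cinner_commute[of a a] by simp
  then show "Im (cinner a a) = Im (complex_of_real ((norm a)\<^sup>2))" by (simp del: of_real_power)
qed

lemma norm_scaleC: "norm (\<zeta> *\<^sub>C a) = cmod \<zeta> * norm a"
proof -
  have "complex_of_real ((norm (\<zeta> *\<^sub>C a))\<^sup>2) = \<zeta> * cnj \<zeta> * cinner a a"
    by (simp only: cinner_self[symmetric] cinner_scaleC_left cinner_scaleC_right mult_ac)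
  also have "\<dots> = complex_of_real ((cmod \<zeta>)\<^sup>2 * (norm a)\<^sup>2)"
    by (simp add: cinner_self complex_norm_square del: of_real_power)
  finally have "(norm (\<zeta> *\<^sub>C a))\<^sup>2 = (cmod \<zeta> * norm a)\<^sup>2"
    by (simp only: of_real_eq_iff power_mult_distrib)
  then show ?thesis by (simp add: power2_eq_iff_nonneg)
qed

lemma Im_cinner: "Im (cinner a b) = inner a (\<i> *\<^sub>C b)"
  by (simp add: Re_cinner[symmetric] cinner_scaleC_right)

lemma norm_cinner: "cmod (cinner a b) \<le> norm a * norm b * 2"
proof -
  have "cmod (cinner a b) \<le> \<bar>Re (cinner a b)\<bar> + \<bar>Im (cinner a b)\<bar>" by (rule cmod_le)
  also have "\<dots> \<le> norm a * norm b + norm a * norm (\<i> *\<^sub>C b)"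
    unfolding Re_cinner Im_cinner by (intro add_mono Cauchy_Schwarz_ineq2)
  finally show ?thesis by (simp add: norm_scaleC)
qed

lemma bounded_bilinear_cinner: "bounded_bilinear (cinner :: 'a::euclidean_space L2 \<Rightarrow> _)"
  by (unfold_locales)
    (auto simp: cinner_add_left cinner_add_right cinner_scaleR_left cinner_scaleR_right scaleR_conv_of_real
      intro!: exI[of _ 2] norm_cinner)

lemma bounded_bilinear_scaleC: "bounded_bilinear ((*\<^sub>C) :: complex \<Rightarrow> 'a::euclidean_space L2 \<Rightarrow> _)"
proof
  show "(r *\<^sub>R a) *\<^sub>C b = r *\<^sub>R a *\<^sub>C (b :: 'a L2)" for a b r
    by (simp add: scaleR_conv_of_real scaleC_scaleC[symmetric] scaleC_of_real)
  show "\<exists>K. \<forall>a b. norm (a *\<^sub>C (b :: 'a L2)) \<le> norm a * norm b * K"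
    by (rule exI[of _ 1]) (simp add: norm_scaleC)
qed (simp_all add: scaleC_add_left scaleC_add_right scaleR_scaleC)

interpretation cinner: bounded_bilinear "cinner :: 'a::euclidean_space L2 \<Rightarrow> _"
  by (rule bounded_bilinear_cinner)

interpretation scaleC: bounded_bilinear "(*\<^sub>C) :: complex \<Rightarrow> 'a::euclidean_space L2 \<Rightarrow> _"
  by (rule bounded_bilinear_scaleC)

lemmas smooth_on_cinner = smooth_on_bounded_bilinear[OF bounded_bilinear_cinner]
  and smooth_on_scaleC = smooth_on_bounded_bilinear[OF bounded_bilinear_scaleC]

text \<open>The representing vector is the minimiser of \<open>J x = \<parallel>x\<parallel>\<^sup>2 / 2 - f x\<close>.  By the parallelogram law minimising
  sequences are Cauchy sequences, and the derivative of \<open>J\<close> vanishes at the minimum.\<close>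

theorem riesz_representation:
  fixes f :: "'v::{real_inner, complete_space} \<Rightarrow> real"
  assumes "bounded_linear f"
  shows "\<exists>g. \<forall>w. f w = inner g w"
proof -
  interpret f: bounded_linear f by (rule assms)
  define J where "J x = (norm x)\<^sup>2 / 2 - f x" for x
  define K where "K = onorm f"
  have J_below: "- (K\<^sup>2 / 2) \<le> J x" for x
  proof -
    have "f x \<le> K * norm x" using onorm[OF assms, of x] by (simp add: K_def)
    moreover have "0 \<le> (norm x - K)\<^sup>2" by simp
    ultimately show ?thesis by (simp add: J_def power2_diff mult.commute)
  qed
  define m where "m = Inf (range J)"
  have bdd: "bdd_below (range J)" using J_below by (auto intro!: bdd_belowI2)
  have m: "m \<le> J x" for x unfolding m_def by (rule cInf_lower[OF _ bdd]) simp
  have "\<exists>x. J x < m + 1 / real (Suc n)" for n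
  proof -
    have "Inf (range J) < m + 1 / real (Suc n)" by (simp add: m_def)
    then show ?thesis using cInf_lessD[of "range J"] by auto
  qed
  then obtain x where x: "\<And>n. J (x n) < m + 1 / real (Suc n)" by metis
  have parallelogram: "(norm (u - v))\<^sup>2 = 4 * (J u + J v) - 8 * J ((1/2) *\<^sub>R (u + v))" for u v
    by (simp add: J_def f.scaleR f.add power2_norm_eq_inner inner_add_left inner_add_right
        inner_diff_left inner_diff_right inner_commute field_simps)
  have close: "(norm (x i - x j))\<^sup>2 \<le> 8 / real (Suc n)" if "i \<ge> n" "j \<ge> n" for i j n
  proof -
    define r where "r k = 1 / real (Suc k)" for k
    have "r i \<le> r n" "r j \<le> r n" using that by (auto simp: r_def intro!: divide_left_mono)
    moreover have "J (x i) < m + r i" "J (x j) < m + r j" using x by (simp_all add: r_def)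
    moreover have "N \<le> 8 * c" if "a < m + p" "b < m + q" "p \<le> c" "q \<le> c" "m \<le> k" "N = 4 * (a + b) - 8 * k"
      for a b c k p q N :: real using that by simp
    ultimately have "(norm (x i - x j))\<^sup>2 \<le> 8 * r n"
      using m parallelogram by blast
    then show ?thesis by (simp add: r_def)
  qed
  have "Cauchy x"
  proof (rule CauchyI)
    fix e :: real assume e: "e > 0"
    obtain n where n: "8 / e\<^sup>2 < real n" using reals_Archimedean2 by blast
    then have "8 < real n * e\<^sup>2" using e by (simp add: field_simps)
    then have "8 / real (Suc n) < e\<^sup>2"
      using e by (simp add: field_simps add_strict_increasing)
    then have "(norm (x i - x j))\<^sup>2 < e\<^sup>2" if "i \<ge> n" "j \<ge> n" for i j
      using close[OF that] by linarith
    then show "\<exists>M. \<forall>i\<ge>M. \<forall>j\<ge>M. norm (x i - x j) < e"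
      using e by (meson power_less_imp_less_base less_imp_le)
  qed
  then obtain g where g: "x \<longlonglongrightarrow> g" using Cauchy_convergent convergent_def by blast
  have "(\<lambda>n. J (x n)) \<longlonglongrightarrow> J g"
    unfolding J_def by (intro tendsto_intros f.tendsto g) simp
  moreover have "(\<lambda>n. m + 1 / real (Suc n)) \<longlonglongrightarrow> m + 0"
    by (intro tendsto_add tendsto_const LIMSEQ_Suc[OF lim_1_over_n])
  ultimately have "J g \<le> m + 0"
    using x by (intro LIMSEQ_le[of "\<lambda>n. J (x n)"]) (auto intro: less_imp_le)
  then have min: "J g \<le> J y" for y using m[of y] by linarith
  have "f w = inner g w" for w
  proof -
    \<comment> \<open>\<open>s\<close> is the derivative of \<open>J\<close> at \<open>g\<close> in the direction \<open>w\<close>; a small step against it would decrease \<open>J\<close>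
      unless \<open>s = 0\<close>.\<close>
    define s q t where "s = inner g w - f w" and "q = (norm w)\<^sup>2" and "t = - s / (q + 1)"
    have q: "q \<ge> 0" by (simp add: q_def)
    have "J (g + t *\<^sub>R w) = J g + t * s + t\<^sup>2 * q / 2"
      by (simp add: J_def s_def q_def f.add f.scaleR power2_norm_eq_inner inner_add_left inner_add_right
          inner_commute)
        (simp add: power2_eq_square field_simps)
    with min[of "g + t *\<^sub>R w"] have "0 \<le> t * s + t\<^sup>2 * q / 2" by simp
    also have "\<dots> = - (s\<^sup>2 * (q + 2) / (2 * (q + 1)\<^sup>2))"
      using q by (simp add: t_def power2_eq_square divide_simps) (simp add: algebra_simps)
    finally have "s\<^sup>2 * (q + 2) / (2 * (q + 1)\<^sup>2) \<le> 0" by simp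
    then have "s\<^sup>2 * (q + 2) \<le> 0" using q by (simp add: divide_le_0_iff)
    then have "s = 0" using q by (auto simp: mult_le_0_iff)
    then show ?thesis by (simp add: s_def)
  qed
  then show ?thesis by blast
qed

section \<open>The unit sphere\<close>

lemma chart_from_inverse:
  assumes "\<And>p. p \<in> cdom c \<Longrightarrow> ccoord c p \<in> R \<and> g (ccoord c p) = p"
    and "\<And>x. x \<in> R \<Longrightarrow> g x \<in> cdom c \<and> ccoord c (g x) = x"
  shows "inj_on (ccoord c) (cdom c)" "crange c = R" "x \<in> R \<Longrightarrow> cinv c x = g x"
proof -
  show inj: "inj_on (ccoord c) (cdom c)" by (rule inj_on_inverseI[of _ g]) (use assms in auto)
  show "crange c = R" unfolding crange_def using assms by force
  show "x \<in> R \<Longrightarrow> cinv c x = g x" unfolding cinv_def using assms inj by (metis inv_into_f_f)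
qed

lemma sphere_chart_simps [simp]:
  "cdom (sphere_chart \<phi>) = {\<alpha>\<in>sphere 0 1. inner \<alpha> \<phi> > 0}"
  "cmodel (sphere_chart \<phi>) = {v. inner v \<phi> = 0}"
  "ccoord (sphere_chart \<phi>) \<alpha> = \<alpha> - inner \<alpha> \<phi> *\<^sub>R \<phi>"
  by (simp_all add: sphere_chart_def)

text \<open>The inverse of the chart of the sphere with pole \<open>\<phi>\<close>.\<close>

definition hemisphere_point :: "'a::euclidean_space L2 \<Rightarrow> 'a L2 \<Rightarrow> 'a L2" where
  "hemisphere_point \<phi> v = v + sqrt (1 - inner v v) *\<^sub>R \<phi>"

lemma norm_1_iff_inner: "norm (x::'v::real_inner) = 1 \<longleftrightarrow> inner x x = 1"
  by (simp add: norm_eq_sqrt_inner)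

lemma norm_less_1_iff_inner: "norm (x::'v::real_inner) < 1 \<longleftrightarrow> inner x x < 1"
  by (simp add: norm_eq_sqrt_inner)

context
  fixes \<phi> :: "'a::euclidean_space L2"
  assumes \<phi>: "norm \<phi> = 1"
begin

lemma sphere_chart_inverse:
  "\<alpha> \<in> cdom (sphere_chart \<phi>) \<Longrightarrow> ccoord (sphere_chart \<phi>) \<alpha> \<in> {v. inner v \<phi> = 0} \<inter> ball 0 1 \<and>
     hemisphere_point \<phi> (ccoord (sphere_chart \<phi>) \<alpha>) = \<alpha>"
  "v \<in> {v. inner v \<phi> = 0} \<inter> ball 0 1 \<Longrightarrow> hemisphere_point \<phi> v \<in> cdom (sphere_chart \<phi>) \<and>
     ccoord (sphere_chart \<phi>) (hemisphere_point \<phi> v) = v"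
proof -
  have \<phi>1: "inner \<phi> \<phi> = 1" using \<phi> by (simp add: norm_1_iff_inner)
  assume "\<alpha> \<in> cdom (sphere_chart \<phi>)"
  then have a: "inner \<alpha> \<alpha> = 1" "inner \<alpha> \<phi> > 0" by (auto simp: norm_1_iff_inner)
  let ?v = "\<alpha> - inner \<alpha> \<phi> *\<^sub>R \<phi>"
  have v: "inner ?v \<phi> = 0" by (simp add: inner_diff_left \<phi>1)
  have vv: "inner ?v ?v = 1 - (inner \<alpha> \<phi>)\<^sup>2"
    by (simp add: inner_diff_left inner_diff_right \<phi>1 a inner_commute power2_eq_square)
  have "?v \<in> ball 0 1" using vv a by (simp add: norm_less_1_iff_inner)
  moreover have "hemisphere_point \<phi> ?v = \<alpha>"
    unfolding hemisphere_point_def vv using a by simp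
  ultimately show "ccoord (sphere_chart \<phi>) \<alpha> \<in> {v. inner v \<phi> = 0} \<inter> ball 0 1 \<and>
     hemisphere_point \<phi> (ccoord (sphere_chart \<phi>) \<alpha>) = \<alpha>" using v by simp
next
  have \<phi>1: "inner \<phi> \<phi> = 1" using \<phi> by (simp add: norm_1_iff_inner)
  assume "v \<in> {v. inner v \<phi> = 0} \<inter> ball 0 1"
  then have v: "inner v \<phi> = 0" "inner v v < 1" by (auto simp: norm_less_1_iff_inner)
  define r where "r = sqrt (1 - inner v v)"
  have r: "r > 0" "r * r = 1 - inner v v" using v by (auto simp: r_def)
  have "inner \<phi> v = 0" using v by (simp add: inner_commute)
  then have "inner (v + r *\<^sub>R \<phi>) (v + r *\<^sub>R \<phi>) = 1" "inner (v + r *\<^sub>R \<phi>) \<phi> = r"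
    by (simp_all add: inner_add_left inner_add_right \<phi>1 v r)
  then show "hemisphere_point \<phi> v \<in> cdom (sphere_chart \<phi>) \<and>
     ccoord (sphere_chart \<phi>) (hemisphere_point \<phi> v) = v"
    using r(1) by (simp add: hemisphere_point_def norm_1_iff_inner flip: r_def)
qed

lemma sphere_chart_inj: "inj_on (ccoord (sphere_chart \<phi>)) (cdom (sphere_chart \<phi>))"
  and crange_sphere_chart: "crange (sphere_chart \<phi>) = {v. inner v \<phi> = 0} \<inter> ball 0 1"
  and cinv_sphere_chart: "v \<in> {v. inner v \<phi> = 0} \<inter> ball 0 1 \<Longrightarrow> cinv (sphere_chart \<phi>) v = hemisphere_point \<phi> v"
  using chart_from_inverse[OF sphere_chart_inverse] by simp_all

lemma smooth_hemisphere_point: "smooth_on UNIV (ball 0 1) (hemisphere_point \<phi>)"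
  unfolding hemisphere_point_def
  by (intro smooth_on_add smooth_on_id smooth_on_scaleR smooth_on_sqrt smooth_on_diff smooth_on_const smooth_on_inner)
    (auto simp: norm_less_1_iff_inner)

text \<open>A function on an open part of the sphere that is the restriction of a smooth function of the ambient
  space is smooth in each chart.  Transition maps, the inclusion and the projection are all of this kind.\<close>

lemma smooth_in_sphere_chart:
  assumes F: "smooth_on UNIV V F" "open V" and f: "\<And>\<alpha>. \<alpha> \<in> sphere 0 1 \<inter> V \<Longrightarrow> f \<alpha> = F \<alpha>"
    and S: "S = ccoord (sphere_chart \<phi>) ` (cdom (sphere_chart \<phi>) \<inter> V)"
  shows "openin (top_of_set (cmodel (sphere_chart \<phi>))) S"
    and "smooth_on (cmodel (sphere_chart \<phi>)) S (f \<circ> cinv (sphere_chart \<phi>))"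
    and "x \<in> S \<Longrightarrow> (f \<circ> cinv (sphere_chart \<phi>)) differentiable (at x within cmodel (sphere_chart \<phi>))"
proof -
  let ?E = "cmodel (sphere_chart \<phi>)"
  define W where "W = ball 0 1 \<inter> hemisphere_point \<phi> -` V"
  have W: "open W"
    unfolding W_def using smooth_on_imp_continuous_on[OF smooth_hemisphere_point] F(2)
    by (intro continuous_open_preimage) auto
  have "smooth_on UNIV W (hemisphere_point \<phi>)"
    by (rule smooth_on_subset[OF smooth_hemisphere_point]) (auto simp: W_def)
  then have FW: "smooth_on UNIV W (\<lambda>v. F (hemisphere_point \<phi> v))"
    by (rule smooth_on_compose[OF _ F(1)]) (auto simp: W_def)
  have SW: "S = ?E \<inter> W"
    unfolding S ccoord_image[OF sphere_chart_inj] crange_sphere_chart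
    using cinv_sphere_chart by (auto simp: W_def)
  have "(f \<circ> cinv (sphere_chart \<phi>)) x = F (hemisphere_point \<phi> x)" if "x \<in> S" for x
  proof -
    have x: "x \<in> {v. inner v \<phi> = 0} \<inter> ball 0 1" "hemisphere_point \<phi> x \<in> V"
      using that SW by (auto simp: W_def)
    with sphere_chart_inverse(2)[OF x(1)] show ?thesis using f cinv_sphere_chart by auto
  qed
  from restriction_of_smooth[OF FW W SW this]
  show "openin (top_of_set ?E) S" "smooth_on ?E S (f \<circ> cinv (sphere_chart \<phi>))"
    "x \<in> S \<Longrightarrow> (f \<circ> cinv (sphere_chart \<phi>)) differentiable (at x within ?E)" by blast+
qed

end

lemma points_sphere_atlas: "points (sphere_atlas :: ('a::euclidean_space L2, 'a L2) chart set) = sphere 0 1"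
  by (auto simp: points_def sphere_atlas_def norm_1_iff_inner intro!: bexI)

lemma charts_at_sphere_atlas:
  "c \<in> charts_at sphere_atlas p \<longleftrightarrow> (\<exists>\<phi>. norm \<phi> = 1 \<and> c = sphere_chart \<phi> \<and> norm p = 1 \<and> inner p \<phi> > 0)"
  by (auto simp: charts_at_def sphere_atlas_def)

lemma open_inner_pos: "open {\<alpha>. inner \<alpha> \<psi> > 0}"
  by (intro open_Collect_less continuous_intros)

lemma smooth_sphere_ccoord: "smooth_on UNIV V (ccoord (sphere_chart \<psi>))"
  unfolding sphere_chart_simps[abs_def]
  by (intro smooth_on_diff smooth_on_id smooth_on_scaleR smooth_on_inner smooth_on_const)

lemma closed_subspace_orthogonal: "subspace {v. inner v \<phi> = 0}" "closed {v. inner v \<phi> = 0}"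
proof -
  show "subspace {v. inner v \<phi> = 0}" by (auto simp: subspace_def inner_add_left)
  show "closed {v. inner v \<phi> = 0}" by (intro closed_Collect_eq continuous_intros)
qed

lemma differentiable_at_sphere_point:
  assumes "smooth_on UNIV V F" "open V" "p \<in> V" "\<And>\<alpha>. \<alpha> \<in> sphere 0 1 \<inter> V \<Longrightarrow> f \<alpha> = F \<alpha>"
  shows "differentiable_at_point sphere_atlas f p"
  unfolding differentiable_at_point_def charts_at_sphere_atlas
proof (intro ballI, unfold charts_at_sphere_atlas, elim exE conjE)
  fix c \<phi> assume "norm \<phi> = 1" "c = sphere_chart \<phi>" "norm p = 1" "inner p \<phi> > 0"
  then show "(f \<circ> cinv c) differentiable (at (ccoord c p) within cmodel c)"
    using smooth_in_sphere_chart(3)[of \<phi> V F f, OF _ assms(1,2,4) refl, of "ccoord c p"] assms(3)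
    by auto
qed

lemma smooth_atlas_sphere: "smooth_atlas (sphere_atlas :: ('a::euclidean_space L2, 'a L2) chart set)"
  unfolding smooth_atlas_def
proof (intro conjI ballI)
  fix c :: "('a L2, 'a L2) chart" assume "c \<in> sphere_atlas"
  then obtain \<phi> where \<phi>: "norm \<phi> = 1" "c = sphere_chart \<phi>" by (auto simp: sphere_atlas_def)
  show "subspace (cmodel c)" "closed (cmodel c)" using closed_subspace_orthogonal \<phi> by auto
  show "inj_on (ccoord c) (cdom c)" using sphere_chart_inj \<phi> by blast
  show "openin (top_of_set (cmodel c)) (crange c)"
    using smooth_in_sphere_chart(1)[OF \<phi>(1) smooth_on_id open_UNIV, of "\<lambda>x. x"] by (simp add: crange_def \<phi>)
  fix d :: "('a L2, 'a L2) chart" assume "d \<in> sphere_atlas"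
  then obtain \<psi> where \<psi>: "norm \<psi> = 1" "d = sphere_chart \<psi>" by (auto simp: sphere_atlas_def)
  have "cdom c \<inter> cdom d = cdom c \<inter> {\<alpha>. inner \<alpha> \<psi> > 0}" using \<phi> \<psi> by auto
  with smooth_in_sphere_chart(1,2)[OF \<phi>(1) smooth_sphere_ccoord open_inner_pos, of \<psi> "ccoord d" \<psi>] \<phi> \<psi>
  show "openin (top_of_set (cmodel c)) (ccoord c ` (cdom c \<inter> cdom d))"
    "smooth_on (cmodel c) (ccoord c ` (cdom c \<inter> cdom d)) (ccoord d \<circ> cinv c)"
    by auto
qed

lemma differentiable_atlas_sphere: "differentiable_atlas (sphere_atlas :: ('a::euclidean_space L2, 'a L2) chart set)"
proof (rule differentiable_atlasI[OF smooth_atlas_sphere])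
  fix p and d :: "('a L2, 'a L2) chart" assume "d \<in> charts_at sphere_atlas p"
  then obtain \<psi> where "d = sphere_chart \<psi>" by (auto simp: charts_at_sphere_atlas)
  then show "differentiable_at_point sphere_atlas (ccoord d) p"
    using differentiable_at_sphere_point[OF smooth_sphere_ccoord open_UNIV UNIV_I refl] by blast
qed

text \<open>The topology of the atlas is the subspace topology: around \<open>p\<close>, the chart with pole \<open>p\<close> is the restriction
  of a continuous map of the ambient space.\<close>

lemma manifold_open_sphere:
  "manifold_open sphere_atlas U \<longleftrightarrow> (\<exists>V. open V \<and> U = sphere 0 1 \<inter> (V :: 'a::euclidean_space L2 set))"
proof
  assume U: "manifold_open sphere_atlas U"
  have "\<exists>V. open V \<and> p \<in> V \<and> sphere 0 1 \<inter> V \<subseteq> U" if p: "p \<in> U" for p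
  proof -
    have p1: "norm p = 1" using U p points_sphere_atlas unfolding manifold_open_def by auto
    let ?c = "sphere_chart p"
    have c: "?c \<in> sphere_atlas" using p1 by (simp add: sphere_atlas_def)
    then have "openin (top_of_set (cmodel ?c)) (ccoord ?c ` (U \<inter> cdom ?c))"
      using U unfolding manifold_open_def by blast
    then obtain W where W: "open W" "ccoord ?c ` (U \<inter> cdom ?c) = cmodel ?c \<inter> W"
      unfolding openin_open by blast
    define V where "V = {\<alpha>. inner \<alpha> p > 0} \<inter> ccoord ?c -` W"
    have "continuous_on UNIV (ccoord ?c)" unfolding sphere_chart_simps[abs_def] by (intro continuous_intros)
    then have "open V" unfolding V_def by (intro open_Int open_inner_pos open_vimage W(1)) 
    moreover have "p \<in> V"
    proof -
      have "p \<in> U \<inter> cdom ?c" using p p1 by (simp add: norm_1_iff_inner)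
      then have "ccoord ?c p \<in> W" using W(2) by blast
      then show ?thesis using p1 by (simp add: V_def norm_1_iff_inner)
    qed
    moreover have "sphere 0 1 \<inter> V \<subseteq> U"
    proof
      fix \<alpha> assume "\<alpha> \<in> sphere 0 1 \<inter> V"
      then have a: "\<alpha> \<in> cdom ?c" "ccoord ?c \<alpha> \<in> W" by (auto simp: V_def)
      then have "ccoord ?c \<alpha> \<in> ccoord ?c ` (U \<inter> cdom ?c)"
        unfolding W(2) using sphere_chart_inverse(1)[OF p1 a(1)] by auto
      then show "\<alpha> \<in> U" using inj_on_image_mem_iff[OF sphere_chart_inj[OF p1] a(1)] by auto
    qed
    ultimately show ?thesis by blast
  qed
  then obtain V where V: "\<And>p. p \<in> U \<Longrightarrow> open (V p) \<and> p \<in> V p \<and> sphere 0 1 \<inter> V p \<subseteq> U" by metis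
  have "U \<subseteq> sphere 0 1" using U points_sphere_atlas unfolding manifold_open_def by auto
  then have "U = sphere 0 1 \<inter> (\<Union>p\<in>U. V p)" using V by blast
  moreover have "open (\<Union>p\<in>U. V p)" using V by blast
  ultimately show "\<exists>V. open V \<and> U = sphere 0 1 \<inter> V" by blast
next
  assume "\<exists>V. open V \<and> U = sphere 0 1 \<inter> V"
  then obtain V where V: "open V" "U = sphere 0 1 \<inter> V" by blast
  show "manifold_open sphere_atlas U"
    unfolding manifold_open_def points_sphere_atlas
  proof (intro conjI ballI)
    show "U \<subseteq> sphere 0 1" using V by auto
    fix c :: "('a L2, 'a L2) chart" assume "c \<in> sphere_atlas"
    then obtain \<phi> where \<phi>: "norm \<phi> = 1" "c = sphere_chart \<phi>" by (auto simp: sphere_atlas_def)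
    have "U \<inter> cdom c = cdom c \<inter> V" using V \<phi> by auto
    then show "openin (top_of_set (cmodel c)) (ccoord c ` (U \<inter> cdom c))"
      using smooth_in_sphere_chart(1)[OF \<phi>(1) smooth_on_id V(1), of "\<lambda>x. x"] \<phi> by simp
  qed
qed

lemma hilbert_manifold_sphere: "hilbert_manifold (sphere 0 1 :: 'a::euclidean_space L2 set) sphere_atlas"
  unfolding hilbert_manifold_def
proof (intro conjI smooth_atlas_sphere points_sphere_atlas ballI impI)
  fix p q :: "'a L2" assume pq: "p \<in> sphere 0 1" "q \<in> sphere 0 1" "p \<noteq> q"
  from hausdorff[OF pq(3)] obtain U V
    where UV: "open U" "open V" "p \<in> U" "q \<in> V" "U \<inter> V = {}" by (elim exE conjE)
  have "manifold_open sphere_atlas (sphere 0 1 \<inter> U)" "manifold_open sphere_atlas (sphere 0 1 \<inter> V)"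
    unfolding manifold_open_sphere using UV(1,2) by blast+
  moreover have "p \<in> sphere 0 1 \<inter> U" "q \<in> sphere 0 1 \<inter> V" "(sphere 0 1 \<inter> U) \<inter> (sphere 0 1 \<inter> V) = {}"
    using pq UV by auto
  ultimately show "\<exists>U V. manifold_open sphere_atlas U \<and> manifold_open sphere_atlas V \<and> p \<in> U \<and> q \<in> V \<and> U \<inter> V = {}"
    by blast
qed

text \<open>A curve through \<open>p\<close> on the sphere, with velocity the projection of \<open>w\<close> to the tangent hyperplane.\<close>

definition sphere_curve :: "'a::euclidean_space L2 \<Rightarrow> 'a L2 \<Rightarrow> real \<Rightarrow> 'a L2" where
  "sphere_curve p w t = sgn (p + t *\<^sub>R w)"

definition sphere_vector :: "'a::euclidean_space L2 \<Rightarrow> 'a L2 \<Rightarrow> ('a L2, 'a L2) tangent" where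
  "sphere_vector p w = velocity sphere_atlas (sphere_curve p w)"

context
  fixes p :: "'a::euclidean_space L2"
  assumes p: "norm p = 1"
begin

lemma sphere_curve_0: "sphere_curve p w 0 = p"
  using p by (simp add: sphere_curve_def sgn_div_norm)

lemma sphere_curve_nonzero: "eventually (\<lambda>t. p + t *\<^sub>R w \<noteq> 0) (nhds 0)"
proof (rule eventually_nhds_in_open[of "- ((\<lambda>t. p + t *\<^sub>R w) -` {0})", THEN eventually_mono])
  show "open (- ((\<lambda>t. p + t *\<^sub>R w) -` {0}))"
    by (intro open_Compl closed_vimage continuous_intros)
qed (use p in auto)

lemma sphere_curve_in_sphere: "eventually (\<lambda>t. sphere_curve p w t \<in> sphere 0 1) (nhds 0)"
  using sphere_curve_nonzero by eventually_elim (simp add: sphere_curve_def norm_sgn)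

lemma sphere_curve_deriv: "(sphere_curve p w has_vector_derivative w - inner p w *\<^sub>R p) (at 0)"
proof -
  have n: "((\<lambda>t. norm (p + t *\<^sub>R w)) has_real_derivative inner p w) (at 0)"
  proof -
    have line: "((\<lambda>t. p + t *\<^sub>R w) has_derivative (\<lambda>t. t *\<^sub>R w)) (at 0)"
      by (auto intro!: derivative_eq_intros)
    have nz: "p + 0 *\<^sub>R w \<noteq> 0" using p by auto
    have "((\<lambda>t. norm (p + t *\<^sub>R w)) has_derivative (\<lambda>t. inner (sgn (p + 0 *\<^sub>R w)) (t *\<^sub>R w))) (at 0)"
      using has_derivative_compose[OF line has_derivative_norm[OF nz]] by (simp add: inner_commute)
    then show ?thesis
      using p by (simp add: has_field_derivative_def sgn_div_norm mult.commute[of _ "inner p w"])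
  qed
  have "((\<lambda>t. inverse (norm (p + t *\<^sub>R w))) has_real_derivative - inner p w) (at 0)"
    using DERIV_inverse'[OF n] p by simp
  moreover have "((\<lambda>t. p + t *\<^sub>R w) has_vector_derivative w) (at 0)"
    by (auto intro!: derivative_eq_intros simp: has_vector_derivative_def)
  ultimately have "((\<lambda>t. inverse (norm (p + t *\<^sub>R w)) *\<^sub>R (p + t *\<^sub>R w)) has_vector_derivative
      inverse (norm (p + 0 *\<^sub>R w)) *\<^sub>R w + (- inner p w) *\<^sub>R (p + 0 *\<^sub>R w)) (at 0)"
    by (rule has_vector_derivative_scaleR)
  then show ?thesis using p by (simp add: sphere_curve_def[abs_def] sgn_div_norm)
qed

lemma sphere_curve_eventually:
  assumes "open V" "p \<in> V"
  shows "eventually (\<lambda>t. sphere_curve p w t \<in> V) (nhds 0)"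
proof -
  have "isCont (sphere_curve p w) 0"
    using sphere_curve_deriv by (rule has_vector_derivative_continuous)
  then show ?thesis
    using assms by (auto simp: continuous_at_open eventually_nhds sphere_curve_0)
qed

lemma differentiable_sphere_curve: "differentiable_curve sphere_atlas (sphere_curve p w)"
  unfolding differentiable_curve_def sphere_curve_0 points_sphere_atlas charts_at_sphere_atlas
proof (intro conjI ballI, unfold charts_at_sphere_atlas)
  show "p \<in> sphere 0 1" using p by simp
next
  fix c assume "\<exists>\<phi>. norm \<phi> = 1 \<and> c = sphere_chart \<phi> \<and> norm p = 1 \<and> inner p \<phi> > 0"
  then obtain \<phi> where c: "norm \<phi> = 1" "c = sphere_chart \<phi>" "inner p \<phi> > 0" by blast
  have "eventually (\<lambda>t. sphere_curve p w t \<in> {\<alpha>. inner \<alpha> \<phi> > 0}) (nhds 0)"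
    by (rule sphere_curve_eventually[OF open_inner_pos]) (use c in simp)
  with sphere_curve_in_sphere[of w] show "eventually (\<lambda>t. sphere_curve p w t \<in> cdom c) (nhds 0)"
    by eventually_elim (simp add: c)
next
  fix c assume "\<exists>\<phi>. norm \<phi> = 1 \<and> c = sphere_chart \<phi> \<and> norm p = 1 \<and> inner p \<phi> > 0"
  then obtain \<phi> where c: "c = sphere_chart \<phi>" by blast
  have "(sphere_curve p w) differentiable (at 0)"
    using sphere_curve_deriv differentiableI_vector by blast
  then show "(\<lambda>t. ccoord c (sphere_curve p w t)) differentiable (at 0)"
    unfolding c sphere_chart_simps by (intro derivative_intros) auto
qed

lemma sphere_vector_tangent: "sphere_vector p w \<in> tangent_space sphere_atlas p"
  using velocity_in_tangent_space[OF differentiable_atlas_sphere differentiable_sphere_curve]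
  by (simp add: sphere_vector_def sphere_curve_0)

lemma dfun_inclusion:
  assumes "inner p w = 0"
  shows "dfun sphere_atlas (\<lambda>\<alpha>. \<alpha>) p (sphere_vector p w) = w"
proof -
  have "differentiable_at_point sphere_atlas (\<lambda>\<alpha>. \<alpha>) p"
    by (rule differentiable_at_sphere_point[OF smooth_on_id open_UNIV]) auto
  then have "(sphere_curve p w has_vector_derivative dfun sphere_atlas (\<lambda>\<alpha>. \<alpha>) p (sphere_vector p w)) (at 0)"
    using dfun_velocity[OF differentiable_atlas_sphere differentiable_sphere_curve, of "\<lambda>\<alpha>. \<alpha>" w]
    by (simp add: sphere_vector_def sphere_curve_0)
  from vector_derivative_unique_at[OF this sphere_curve_deriv] show ?thesis using assms by simp
qed

text \<open>In the chart with pole \<open>p\<close> the coordinate vector of a tangent vector at \<open>p\<close> is the tangent vector itself, as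
  an element of the hyperplane orthogonal to \<open>p\<close>.\<close>

lemma tangent_space_sphere:
  "tangent_space sphere_atlas p = sphere_vector p ` {w. inner p w = 0}"
proof (intro equalityI subsetI)
  fix v assume v: "v \<in> tangent_space sphere_atlas p"
  have c: "sphere_chart p \<in> charts_at sphere_atlas p"
    using p by (auto simp: charts_at_sphere_atlas norm_1_iff_inner)
  define w where "w = v (sphere_chart p)"
  have w: "inner p w = 0" using tangent_in_model[OF v c] by (simp add: w_def inner_commute)
  have "((\<lambda>t. ccoord (sphere_chart p) (sphere_curve p w t)) has_vector_derivative w - inner w p *\<^sub>R p) (at 0)"
    unfolding sphere_chart_simps
    using bounded_linear.has_vector_derivative[OF _ sphere_curve_deriv[of w], of "\<lambda>\<alpha>. \<alpha> - inner \<alpha> p *\<^sub>R p"] w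
    by (simp add: bounded_linear_sub bounded_linear_ident bounded_linear_scaleR_const bounded_linear_inner_left)
  then have "sphere_vector p w (sphere_chart p) = w"
    using c w by (simp add: sphere_vector_def velocity_def sphere_curve_0 vector_derivative_at inner_commute)
  then have "sphere_vector p w = v"
    by (intro tangent_eqI[OF sphere_vector_tangent v c]) (simp add: w_def)
  then show "v \<in> sphere_vector p ` {w. inner p w = 0}" using w by auto
qed (auto intro: sphere_vector_tangent)

end

lemma smooth_embedding_sphere: "smooth_embedding sphere_atlas (\<lambda>\<alpha> :: 'a::euclidean_space L2. \<alpha>)"
  unfolding smooth_embedding_def points_sphere_atlas
proof (intro conjI allI ballI)
  show "smooth_function sphere_atlas (\<lambda>\<alpha> :: 'a L2. \<alpha>)"
    unfolding smooth_function_def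
  proof
    fix c :: "('a L2, 'a L2) chart" assume "c \<in> sphere_atlas"
    then obtain \<phi> where \<phi>: "norm \<phi> = 1" "c = sphere_chart \<phi>" by (auto simp: sphere_atlas_def)
    from smooth_in_sphere_chart(2)[OF \<phi>(1) smooth_on_id open_UNIV, of "\<lambda>x. x"]
    show "smooth_on (cmodel c) (crange c) ((\<lambda>\<alpha>. \<alpha>) \<circ> cinv c)" by (simp add: crange_def \<phi>)
  qed
  show "manifold_open sphere_atlas U \<longleftrightarrow> (\<exists>V. open V \<and> U = sphere 0 1 \<inter> (\<lambda>\<alpha> :: 'a L2. \<alpha>) -` V)" for U
    by (simp add: manifold_open_sphere)
  fix p :: "'a L2" assume "p \<in> sphere 0 1"
  then have p: "norm p = 1" by simp
  show "inj_on (dfun sphere_atlas (\<lambda>\<alpha>. \<alpha>) p) (tangent_space sphere_atlas p)"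
    unfolding tangent_space_sphere[OF p]
  proof (rule inj_onI)
    fix u v assume "u \<in> sphere_vector p ` {w. inner p w = 0}" "v \<in> sphere_vector p ` {w. inner p w = 0}"
      and eq: "dfun sphere_atlas (\<lambda>\<alpha>. \<alpha>) p u = dfun sphere_atlas (\<lambda>\<alpha>. \<alpha>) p v"
    then obtain w w' where "u = sphere_vector p w" "inner p w = 0" "v = sphere_vector p w'" "inner p w' = 0" by blast
    with eq show "u = v" by (simp add: dfun_inclusion[OF p])
  qed
  have "dfun sphere_atlas (\<lambda>\<alpha>. \<alpha>) p ` tangent_space sphere_atlas p = {w. inner p w = 0}"
    unfolding tangent_space_sphere[OF p] by (force simp: image_image dfun_inclusion[OF p] image_iff)
  then show "closed (dfun sphere_atlas (\<lambda>\<alpha>. \<alpha>) p ` tangent_space sphere_atlas p)"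
    using closed_subspace_orthogonal(2)[of p] by (simp add: inner_commute)
qed simp

section \<open>The quotient by the circle action\<close>

lemma orbit_self: "\<alpha> \<in> orbit \<alpha>"
  unfolding orbit_def by (rule image_eqI[of _ _ 1]) (simp_all add: scaleC_one)

lemma orbit_eq_iff: "orbit \<alpha> = orbit \<beta> \<longleftrightarrow> (\<exists>\<zeta>. cmod \<zeta> = 1 \<and> \<beta> = \<zeta> *\<^sub>C \<alpha>)"
proof
  assume "orbit \<alpha> = orbit \<beta>"
  then show "\<exists>\<zeta>. cmod \<zeta> = 1 \<and> \<beta> = \<zeta> *\<^sub>C \<alpha>" using orbit_self[of \<beta>] by (auto simp: orbit_def)
next
  assume "\<exists>\<zeta>. cmod \<zeta> = 1 \<and> \<beta> = \<zeta> *\<^sub>C \<alpha>"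
  then obtain \<zeta> where \<zeta>: "cmod \<zeta> = 1" "\<beta> = \<zeta> *\<^sub>C \<alpha>" by blast
  then have "\<zeta> \<noteq> 0" by auto
  then have "\<xi> *\<^sub>C \<alpha> = (\<xi> * inverse \<zeta>) *\<^sub>C \<beta>" "cmod (\<xi> * inverse \<zeta>) = cmod \<xi>" for \<xi>
    using \<zeta> by (auto simp: scaleC_scaleC norm_mult norm_inverse mult.assoc)
  moreover have "\<xi> *\<^sub>C \<beta> = (\<xi> * \<zeta>) *\<^sub>C \<alpha>" "cmod (\<xi> * \<zeta>) = cmod \<xi>" for \<xi>
    using \<zeta> by (auto simp: scaleC_scaleC norm_mult)
  ultimately show "orbit \<alpha> = orbit \<beta>" unfolding orbit_def by fastforce
qed

lemma orbit_scaleC: "cmod \<zeta> = 1 \<Longrightarrow> orbit (\<zeta> *\<^sub>C \<alpha>) = orbit \<alpha>"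
  using orbit_eq_iff by metis

text \<open>The coordinate map of the affine chart with pole \<open>\<phi>\<close>, on representatives.\<close>

definition affine_coord :: "'a::euclidean_space L2 \<Rightarrow> 'a L2 \<Rightarrow> 'a L2" where
  "affine_coord \<phi> \<alpha> = (1 / cinner \<alpha> \<phi>) *\<^sub>C \<alpha> - \<phi>"

lemma affine_coord_scaleC: "c \<noteq> 0 \<Longrightarrow> affine_coord \<phi> (c *\<^sub>C \<alpha>) = affine_coord \<phi> \<alpha>"
  by (simp add: affine_coord_def cinner_scaleC_left scaleC_scaleC)

lemma quotient_chart_simps [simp]:
  "cdom (quotient_chart \<phi>) = orbit ` (sphere 0 1 \<inter> {\<alpha>. cinner \<alpha> \<phi> \<noteq> 0})"
  "cmodel (quotient_chart \<phi>) = {v. cinner v \<phi> = 0}"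
  "ccoord (quotient_chart \<phi>) (orbit \<alpha>) = affine_coord \<phi> \<alpha>"
proof -
  show "cdom (quotient_chart \<phi>) = orbit ` (sphere 0 1 \<inter> {\<alpha>. cinner \<alpha> \<phi> \<noteq> 0})"
    by (simp add: quotient_chart_def Int_def)
  show "cmodel (quotient_chart \<phi>) = {v. cinner v \<phi> = 0}" by (simp add: quotient_chart_def)
  have "(SOME \<beta>. \<beta> \<in> orbit \<alpha>) \<in> orbit \<alpha>" by (rule someI[where P = "\<lambda>\<beta>. \<beta> \<in> orbit \<alpha>", OF orbit_self])
  then obtain \<zeta> where "cmod \<zeta> = 1" "(SOME \<beta>. \<beta> \<in> orbit \<alpha>) = \<zeta> *\<^sub>C \<alpha>" by (auto simp: orbit_def)
  moreover from this have "\<zeta> \<noteq> 0" by auto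
  ultimately show "ccoord (quotient_chart \<phi>) (orbit \<alpha>) = affine_coord \<phi> \<alpha>"
    using affine_coord_scaleC[of \<zeta> \<phi> \<alpha>] by (auto simp: quotient_chart_def Let_def affine_coord_def)
qed

lemma sgn_scaleC_L2: "sgn \<alpha> = complex_of_real (inverse (norm \<alpha>)) *\<^sub>C (\<alpha> :: 'a::euclidean_space L2)"
  by (simp only: scaleC_of_real sgn_div_norm)

lemma smooth_on_sgn:
  fixes f :: "'b::real_normed_vector \<Rightarrow> 'v::real_inner"
  assumes "smooth_on UNIV U f" "\<And>x. x \<in> U \<Longrightarrow> f x \<noteq> 0"
  shows "smooth_on UNIV U (\<lambda>x. sgn (f x))"
proof -
  have "smooth_on UNIV U (\<lambda>x. inverse (sqrt (inner (f x) (f x))) *\<^sub>R f x)"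
    by (intro smooth_on_scaleR smooth_on_inverse smooth_on_sqrt smooth_on_inner assms) (use assms(2) in auto)
  then show ?thesis by (rule smooth_on_cong) (simp add: sgn_div_norm norm_eq_sqrt_inner)
qed

lemma smooth_affine_coord: "smooth_on UNIV {\<alpha>. cinner \<alpha> \<psi> \<noteq> 0} (affine_coord \<psi>)"
  unfolding affine_coord_def[abs_def] divide_inverse mult_1
  by (intro smooth_on_diff smooth_on_scaleC smooth_on_inverse smooth_on_cinner smooth_on_id smooth_on_const) simp

lemma continuous_on_cinner: "continuous_on S (\<lambda>\<alpha>. cinner \<alpha> \<psi>)"
  by (rule bounded_linear.continuous_on[OF cinner.bounded_linear_left continuous_on_id])

lemma open_cinner_nonzero: "open {\<alpha>. cinner \<alpha> \<psi> \<noteq> 0}"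
  by (intro open_Collect_neq continuous_on_cinner continuous_on_const)

definition circle_invariant :: "'a::euclidean_space L2 set \<Rightarrow> bool" where
  "circle_invariant V \<longleftrightarrow> (\<forall>\<alpha>\<in>V. \<forall>\<zeta>. cmod \<zeta> = 1 \<longrightarrow> \<zeta> *\<^sub>C \<alpha> \<in> V)"

lemma circle_invariant_UNIV: "circle_invariant UNIV"
  by (simp add: circle_invariant_def)

lemma circle_invariant_cinner_nonzero: "circle_invariant {\<alpha>. cinner \<alpha> \<psi> \<noteq> 0}"
  by (auto simp: circle_invariant_def cinner_scaleC_left)

lemma orbit_in_image:
  assumes "circle_invariant V" "norm \<alpha> = 1"
  shows "orbit \<alpha> \<in> orbit ` (sphere 0 1 \<inter> V) \<longleftrightarrow> \<alpha> \<in> V"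
proof
  assume "orbit \<alpha> \<in> orbit ` (sphere 0 1 \<inter> V)"
  then obtain \<beta> where "\<beta> \<in> V" "orbit \<beta> = orbit \<alpha>" by auto
  then show "\<alpha> \<in> V" using assms(1) by (auto simp: orbit_eq_iff circle_invariant_def)
qed (use assms in auto)

context
  fixes \<phi> :: "'a::euclidean_space L2"
  assumes \<phi>: "norm \<phi> = 1"
begin

lemma cinner_self_1: "cinner \<phi> \<phi> = 1"
  using \<phi> by (simp add: cinner_self)

lemma cinner_add_pole: "cinner x \<phi> = 0 \<Longrightarrow> cinner (x + \<phi>) \<phi> = 1"
  by (simp add: cinner_add_left cinner_self_1)

lemma add_pole_nonzero: "cinner x \<phi> = 0 \<Longrightarrow> x + \<phi> \<noteq> 0"
  using cinner_add_pole[of x] cinner.zero_left[of \<phi>] by (metis zero_neq_one)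

lemma quotient_chart_inverse:
  "p \<in> cdom (quotient_chart \<phi>) \<Longrightarrow> ccoord (quotient_chart \<phi>) p \<in> {v. cinner v \<phi> = 0} \<and>
     orbit (sgn (ccoord (quotient_chart \<phi>) p + \<phi>)) = p"
  "x \<in> {v. cinner v \<phi> = 0} \<Longrightarrow> orbit (sgn (x + \<phi>)) \<in> cdom (quotient_chart \<phi>) \<and>
     ccoord (quotient_chart \<phi>) (orbit (sgn (x + \<phi>))) = x"
proof -
  assume "p \<in> cdom (quotient_chart \<phi>)"
  then obtain \<alpha> where \<alpha>: "p = orbit \<alpha>" "norm \<alpha> = 1" "cinner \<alpha> \<phi> \<noteq> 0" by auto
  define c where "c = 1 / cinner \<alpha> \<phi>"
  have c: "c \<noteq> 0" "cinner (c *\<^sub>C \<alpha>) \<phi> = 1" using \<alpha> by (auto simp: c_def cinner_scaleC_left)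
  have x: "affine_coord \<phi> \<alpha> = c *\<^sub>C \<alpha> - \<phi>" by (simp add: affine_coord_def c_def)
  have "sgn (c *\<^sub>C \<alpha>) = (complex_of_real (inverse (cmod c)) * c) *\<^sub>C \<alpha>"
    unfolding sgn_scaleC_L2 by (simp add: norm_scaleC \<alpha> scaleC_scaleC)
  then have "orbit (sgn (c *\<^sub>C \<alpha>)) = orbit \<alpha>" using c by (simp add: orbit_scaleC norm_mult norm_inverse)
  then show "ccoord (quotient_chart \<phi>) p \<in> {v. cinner v \<phi> = 0} \<and>
     orbit (sgn (ccoord (quotient_chart \<phi>) p + \<phi>)) = p"
    using c by (simp add: x \<alpha>(1) cinner.diff_left cinner_self_1)
next
  assume "x \<in> {v. cinner v \<phi> = 0}"
  then have x: "cinner (x + \<phi>) \<phi> = 1" "x + \<phi> \<noteq> 0" using cinner_add_pole add_pole_nonzero by auto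
  have "cinner (sgn (x + \<phi>)) \<phi> \<noteq> 0" "norm (sgn (x + \<phi>)) = 1"
    using x by (auto simp: sgn_scaleC_L2[of "x + \<phi>"] cinner_scaleC_left norm_scaleC norm_inverse)
  moreover have "affine_coord \<phi> (sgn (x + \<phi>)) = x"
    using x by (simp add: sgn_scaleC_L2[of "x + \<phi>"] affine_coord_scaleC) (simp add: affine_coord_def scaleC_one)
  ultimately show "orbit (sgn (x + \<phi>)) \<in> cdom (quotient_chart \<phi>) \<and>
     ccoord (quotient_chart \<phi>) (orbit (sgn (x + \<phi>))) = x" by auto
qed

lemma quotient_chart_inj: "inj_on (ccoord (quotient_chart \<phi>)) (cdom (quotient_chart \<phi>))"
  and crange_quotient_chart: "crange (quotient_chart \<phi>) = {v. cinner v \<phi> = 0}"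
  and cinv_quotient_chart: "x \<in> {v. cinner v \<phi> = 0} \<Longrightarrow> cinv (quotient_chart \<phi>) x = orbit (sgn (x + \<phi>))"
  using chart_from_inverse[OF quotient_chart_inverse] by blast+

text \<open>The counterpart of \<open>smooth_in_sphere_chart\<close>: \<open>x \<mapsto> sgn (x + \<phi>)\<close> is a smooth local section of the projection, so
  a function on the quotient is smooth if it lifts to a smooth function on an open, invariant subset of
  the Hilbert space.\<close>

lemma smooth_in_quotient_chart:
  assumes F: "smooth_on UNIV V F" "open V" "circle_invariant V"
    and f: "\<And>\<alpha>. \<alpha> \<in> sphere 0 1 \<inter> V \<Longrightarrow> f (orbit \<alpha>) = F \<alpha>"
    and S: "S = ccoord (quotient_chart \<phi>) ` (cdom (quotient_chart \<phi>) \<inter> orbit ` (sphere 0 1 \<inter> V))"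
  shows "openin (top_of_set (cmodel (quotient_chart \<phi>))) S"
    and "smooth_on (cmodel (quotient_chart \<phi>)) S (f \<circ> cinv (quotient_chart \<phi>))"
    and "x \<in> S \<Longrightarrow> (f \<circ> cinv (quotient_chart \<phi>)) differentiable (at x within cmodel (quotient_chart \<phi>))"
proof -
  let ?E = "cmodel (quotient_chart \<phi>)"
  let ?s = "\<lambda>x. sgn (x + \<phi>)"
  define V0 where "V0 = - {- \<phi>}"
  have V0: "open V0" unfolding V0_def by (intro open_Compl closed_singleton)
  have s: "smooth_on UNIV V0 ?s"
    by (intro smooth_on_sgn smooth_on_add smooth_on_id smooth_on_const) (auto simp: V0_def add_eq_0_iff2)
  define W where "W = V0 \<inter> ?s -` V"
  have W: "open W"
    unfolding W_def using smooth_on_imp_continuous_on[OF s V0] F(2) V0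
    by (intro continuous_open_preimage) auto
  have "smooth_on UNIV W ?s"
    by (rule smooth_on_subset[OF s]) (auto simp: W_def)
  then have FW: "smooth_on UNIV W (\<lambda>v. F (?s v))"
    by (rule smooth_on_compose[OF _ F(1)]) (auto simp: W_def)
  have norm_s: "norm (?s x) = 1" if "x \<in> ?E" for x
    using add_pole_nonzero[of x] that by (simp add: norm_sgn)
  have "S = {x \<in> ?E. orbit (?s x) \<in> orbit ` (sphere 0 1 \<inter> V)}"
    unfolding S ccoord_image[OF quotient_chart_inj] crange_quotient_chart
    using cinv_quotient_chart by auto
  also have "\<dots> = {x \<in> ?E. ?s x \<in> V}"
    by (rule Collect_cong) (use orbit_in_image[OF F(3) norm_s] in blast)
  also have "\<dots> = ?E \<inter> W"
    using add_pole_nonzero add_pole_nonzero[of "- \<phi>"] by (auto simp: W_def V0_def)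
  finally have SW: "S = ?E \<inter> W" .
  have "(f \<circ> cinv (quotient_chart \<phi>)) x = F (?s x)" if "x \<in> S" for x
    using that f[of "?s x"] cinv_quotient_chart norm_s unfolding SW by (auto simp: W_def)
  from restriction_of_smooth[OF FW W SW this]
  show "openin (top_of_set ?E) S" "smooth_on ?E S (f \<circ> cinv (quotient_chart \<phi>))"
    "x \<in> S \<Longrightarrow> (f \<circ> cinv (quotient_chart \<phi>)) differentiable (at x within ?E)" by blast+
qed

end

lemma points_quotient_atlas: "points (quotient_atlas :: ('a::euclidean_space L2 set, 'a L2) chart set) = orbit ` sphere 0 1"
proof
  show "orbit ` sphere 0 1 \<subseteq> points (quotient_atlas :: ('a L2 set, 'a L2) chart set)"
  proof
    fix q :: "'a L2 set" assume "q \<in> orbit ` sphere 0 1"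
    then obtain \<alpha> where \<alpha>: "norm \<alpha> = 1" "q = orbit \<alpha>" by auto
    then have "q \<in> cdom (quotient_chart \<alpha>)" using cinner_self_1[of \<alpha>] by auto
    then show "q \<in> points quotient_atlas" using \<alpha> by (auto simp: points_def quotient_atlas_def simp del: quotient_chart_simps)
  qed
qed (auto simp: points_def quotient_atlas_def)

lemma charts_at_quotient_atlas:
  assumes "norm \<alpha> = 1"
  shows "c \<in> charts_at quotient_atlas (orbit \<alpha>) \<longleftrightarrow> (\<exists>\<phi>. norm \<phi> = 1 \<and> c = quotient_chart \<phi> \<and> cinner \<alpha> \<phi> \<noteq> 0)"
  using orbit_in_image[OF circle_invariant_cinner_nonzero assms]
  by (auto simp: charts_at_def quotient_atlas_def)

lemma closed_complex_orthogonal: "subspace {v. cinner v \<phi> = 0}" "closed {v. cinner v \<phi> = 0}"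
proof -
  show "subspace {v. cinner v \<phi> = 0}" by (auto simp: subspace_def cinner_add_left cinner_scaleR_left cinner.zero_left)
  show "closed {v. cinner v \<phi> = 0}" by (intro closed_Collect_eq continuous_on_cinner continuous_on_const)
qed

lemma differentiable_at_quotient_point:
  assumes "smooth_on UNIV V F" "open V" "circle_invariant V" "\<alpha> \<in> V" "norm \<alpha> = 1"
    and "\<And>\<alpha>. \<alpha> \<in> sphere 0 1 \<inter> V \<Longrightarrow> f (orbit \<alpha>) = F \<alpha>"
  shows "differentiable_at_point quotient_atlas f (orbit \<alpha>)"
  unfolding differentiable_at_point_def
proof
  fix c assume "c \<in> charts_at quotient_atlas (orbit \<alpha>)"
  then obtain \<phi> where \<phi>: "norm \<phi> = 1" "c = quotient_chart \<phi>" "cinner \<alpha> \<phi> \<noteq> 0"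
    using charts_at_quotient_atlas[OF assms(5)] by blast
  have "orbit \<alpha> \<in> cdom (quotient_chart \<phi>) \<inter> orbit ` (sphere 0 1 \<inter> V)" using \<phi> assms(4,5) by auto
  then show "(f \<circ> cinv c) differentiable (at (ccoord c (orbit \<alpha>)) within cmodel c)"
    unfolding \<phi>(2) using smooth_in_quotient_chart(3)[OF \<phi>(1) assms(1,2,3,6) refl] by blast
qed

lemma smooth_atlas_quotient: "smooth_atlas (quotient_atlas :: ('a::euclidean_space L2 set, 'a L2) chart set)"
  unfolding smooth_atlas_def
proof (intro conjI ballI)
  fix c :: "('a L2 set, 'a L2) chart" assume "c \<in> quotient_atlas"
  then obtain \<phi> where \<phi>: "norm \<phi> = 1" "c = quotient_chart \<phi>" by (auto simp: quotient_atlas_def)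
  show "subspace (cmodel c)" "closed (cmodel c)" using closed_complex_orthogonal \<phi> by auto
  show "inj_on (ccoord c) (cdom c)" using quotient_chart_inj \<phi> by blast
  show "openin (top_of_set (cmodel c)) (crange c)" by (simp add: \<phi> crange_quotient_chart)
  fix d :: "('a L2 set, 'a L2) chart" assume "d \<in> quotient_atlas"
  then obtain \<psi> where \<psi>: "norm \<psi> = 1" "d = quotient_chart \<psi>" by (auto simp: quotient_atlas_def)
  have "cdom d = orbit ` (sphere 0 1 \<inter> {\<alpha>. cinner \<alpha> \<psi> \<noteq> 0})" using \<psi> by simp
  then show "openin (top_of_set (cmodel c)) (ccoord c ` (cdom c \<inter> cdom d))"
    "smooth_on (cmodel c) (ccoord c ` (cdom c \<inter> cdom d)) (ccoord d \<circ> cinv c)"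
    using smooth_in_quotient_chart(1,2)[OF \<phi>(1) smooth_affine_coord open_cinner_nonzero circle_invariant_cinner_nonzero,
      of \<psi> "ccoord d"] \<phi> \<psi> by (metis quotient_chart_simps(3))+
qed

lemma differentiable_atlas_quotient:
  "differentiable_atlas (quotient_atlas :: ('a::euclidean_space L2 set, 'a L2) chart set)"
proof (rule differentiable_atlasI[OF smooth_atlas_quotient])
  fix q and d :: "('a L2 set, 'a L2) chart" assume d: "d \<in> charts_at quotient_atlas q"
  then have "q \<in> orbit ` sphere 0 1" using charts_at_nonempty[of q quotient_atlas] points_quotient_atlas by blast
  then obtain \<alpha> where \<alpha>: "norm \<alpha> = 1" "q = orbit \<alpha>" by auto
  with d obtain \<psi> where \<psi>: "d = quotient_chart \<psi>" "cinner \<alpha> \<psi> \<noteq> 0"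
    using charts_at_quotient_atlas[OF \<alpha>(1)] by blast
  show "differentiable_at_point quotient_atlas (ccoord d) q"
    unfolding \<alpha>(2) \<psi>(1)
    by (rule differentiable_at_quotient_point[OF smooth_affine_coord open_cinner_nonzero circle_invariant_cinner_nonzero])
      (use \<alpha> \<psi> in auto)
qed

text \<open>The case of equality in the Cauchy--Schwarz inequality.\<close>

lemma cmod_cinner_distinct_orbits:
  assumes "norm \<alpha> = 1" "norm \<beta> = 1" "orbit \<alpha> \<noteq> orbit \<beta>"
  shows "cmod (cinner \<alpha> \<beta>) < 1"
proof -
  define c where "c = cinner \<alpha> \<beta>"
  have cc: "c * cnj c = complex_of_real ((cmod c)\<^sup>2)" by (simp only: complex_norm_square)
  have "cinner (\<alpha> - c *\<^sub>C \<beta>) (\<alpha> - c *\<^sub>C \<beta>) = complex_of_real (1 - (cmod c)\<^sup>2)"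
    using cinner_self_1[OF assms(1)] cinner_self_1[OF assms(2)] cinner_commute[of \<beta> \<alpha>] cc
    by (simp add: cinner.diff_left cinner.diff_right cinner_scaleC_left cinner_scaleC_right
        flip: c_def del: of_real_power)
  then have *: "(norm (\<alpha> - c *\<^sub>C \<beta>))\<^sup>2 = 1 - (cmod c)\<^sup>2"
    unfolding cinner_self by (simp only: of_real_eq_iff)
  then have le: "(cmod c)\<^sup>2 \<le> 1" using zero_le_power2[of "norm (\<alpha> - c *\<^sub>C \<beta>)"] by linarith
  have "cmod c \<noteq> 1"
  proof
    assume 1: "cmod c = 1"
    with * have "\<alpha> = c *\<^sub>C \<beta>" by simp
    with 1 assms(3) show False by (simp add: orbit_scaleC)
  qed
  with le show ?thesis by (simp add: c_def[symmetric] abs_square_le_1 less_le)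
qed

lemma hilbert_manifold_quotient:
  "hilbert_manifold (orbit ` (sphere 0 1 :: 'a::euclidean_space L2 set)) quotient_atlas"
  unfolding hilbert_manifold_def
proof (intro conjI smooth_atlas_quotient points_quotient_atlas ballI impI)
  fix p q :: "'a L2 set" assume pq: "p \<in> orbit ` sphere 0 1" "q \<in> orbit ` sphere 0 1" "p \<noteq> q"
  then obtain \<alpha> \<beta> where "p = orbit \<alpha>" "\<alpha> \<in> sphere 0 1" "q = orbit \<beta>" "\<beta> \<in> sphere 0 1"
    by (elim imageE)
  then have ab: "norm \<alpha> = 1" "p = orbit \<alpha>" "norm \<beta> = 1" "q = orbit \<beta>" by simp_all
  \<comment> \<open>Two distinct orbits are separated by the sets of points closer to the one than to the other; closeness is
    measured by the modulus of the inner product, which is maximal on the orbit itself.\<close>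
  define V where "V \<alpha> \<beta> = {\<gamma>. cmod (cinner \<gamma> \<beta>) < cmod (cinner \<gamma> \<alpha>)}" for \<alpha> \<beta> :: "'a L2"
  have inv: "circle_invariant (V \<alpha> \<beta>)" for \<alpha> \<beta>
    by (auto simp: circle_invariant_def V_def cinner_scaleC_left norm_mult)
  have op: "open (V \<alpha> \<beta>)" for \<alpha> \<beta>
    unfolding V_def by (intro open_Collect_less continuous_intros continuous_on_cinner)
  have mo: "manifold_open quotient_atlas (orbit ` (sphere 0 1 \<inter> V \<alpha> \<beta>))" for \<alpha> \<beta>
    unfolding manifold_open_def points_quotient_atlas
  proof (intro conjI ballI)
    fix c :: "('a L2 set, 'a L2) chart" assume "c \<in> quotient_atlas"
    then obtain \<phi> where \<phi>: "norm \<phi> = 1" "c = quotient_chart \<phi>" by (auto simp: quotient_atlas_def)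
    show "openin (top_of_set (cmodel c)) (ccoord c ` (orbit ` (sphere 0 1 \<inter> V \<alpha> \<beta>) \<inter> cdom c))"
      unfolding \<phi>(2) Int_commute[of "orbit ` (sphere 0 1 \<inter> V \<alpha> \<beta>)"]
      by (rule smooth_in_quotient_chart(1)[where f = "\<lambda>_. 0 :: real" and F = "\<lambda>_. 0",
            OF \<phi>(1) smooth_on_const op inv _ refl]) simp
  qed auto
  have lt: "cmod (cinner \<alpha> \<beta>) < 1" "cmod (cinner \<beta> \<alpha>) < 1"
    using cmod_cinner_distinct_orbits ab pq(3) by metis+
  have "p \<in> orbit ` (sphere 0 1 \<inter> V \<alpha> \<beta>)" "q \<in> orbit ` (sphere 0 1 \<inter> V \<beta> \<alpha>)"
    using ab lt cinner_self_1[OF ab(1)] cinner_self_1[OF ab(3)] by (auto simp: V_def)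
  moreover have "orbit ` (sphere 0 1 \<inter> V \<alpha> \<beta>) \<inter> orbit ` (sphere 0 1 \<inter> V \<beta> \<alpha>) = {}"
  proof -
    have "orbit \<gamma> \<notin> orbit ` (sphere 0 1 \<inter> V \<beta> \<alpha>)" if "\<gamma> \<in> sphere 0 1 \<inter> V \<alpha> \<beta>" for \<gamma>
      using that orbit_in_image[OF inv, of \<gamma> \<beta> \<alpha>] by (simp add: V_def)
    then show ?thesis by blast
  qed
  ultimately show "\<exists>U V. manifold_open quotient_atlas U \<and> manifold_open quotient_atlas V \<and> p \<in> U \<and> q \<in> V \<and> U \<inter> V = {}"
    using mo by blast
qed

text \<open>The derivative of \<open>affine_coord \<phi>\<close> at the points \<open>\<alpha>\<close> of its domain.\<close>

definition affine_deriv :: "'a::euclidean_space L2 \<Rightarrow> 'a L2 \<Rightarrow> 'a L2 \<Rightarrow> 'a L2" where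
  "affine_deriv \<phi> \<alpha> w = (1 / cinner \<alpha> \<phi>) *\<^sub>C w - (cinner w \<phi> / (cinner \<alpha> \<phi>)\<^sup>2) *\<^sub>C \<alpha>"

lemma affine_coord_has_derivative:
  assumes "cinner \<alpha> \<phi> \<noteq> 0"
  shows "(affine_coord \<phi> has_derivative affine_deriv \<phi> \<alpha>) (at \<alpha>)"
proof -
  have "((\<lambda>\<alpha>. cinner \<alpha> \<phi>) has_derivative (\<lambda>w. cinner w \<phi>)) (at \<alpha>)"
    by (rule bounded_linear_imp_has_derivative[OF cinner.bounded_linear_left])
  from Deriv.has_derivative_inverse[OF assms this]
  have "((\<lambda>\<alpha>. inverse (cinner \<alpha> \<phi>)) has_derivative
      (\<lambda>w. - (inverse (cinner \<alpha> \<phi>) * cinner w \<phi> * inverse (cinner \<alpha> \<phi>)))) (at \<alpha>)" .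
  from has_derivative_diff[OF scaleC.FDERIV[OF this has_derivative_ident] has_derivative_const[of \<phi>]]
  have "(affine_coord \<phi> has_derivative (\<lambda>w. inverse (cinner \<alpha> \<phi>) *\<^sub>C w +
      (- (inverse (cinner \<alpha> \<phi>) * cinner w \<phi> * inverse (cinner \<alpha> \<phi>))) *\<^sub>C \<alpha> - 0)) (at \<alpha>)"
    by (simp add: affine_coord_def[abs_def] divide_inverse)
  moreover have "inverse (cinner \<alpha> \<phi>) *\<^sub>C w + (- (inverse (cinner \<alpha> \<phi>) * cinner w \<phi> * inverse (cinner \<alpha> \<phi>))) *\<^sub>C \<alpha> - 0
      = affine_deriv \<phi> \<alpha> w" for w
    by (simp add: affine_deriv_def scaleC.minus_left divide_inverse power2_eq_square mult_ac)
  ultimately show ?thesis by (simp only:)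
qed

lemma affine_deriv_add: "affine_deriv \<phi> \<alpha> (v + w) = affine_deriv \<phi> \<alpha> v + affine_deriv \<phi> \<alpha> w"
  by (simp add: affine_deriv_def cinner_add_left scaleC.add_left scaleC.add_right add_divide_distrib)

lemma affine_deriv_scaleC: "affine_deriv \<phi> \<alpha> (\<zeta> *\<^sub>C w) = \<zeta> *\<^sub>C affine_deriv \<phi> \<alpha> w"
  by (simp add: affine_deriv_def cinner_scaleC_left scaleC.diff_right scaleC_scaleC mult.commute)

lemma affine_deriv_self: "affine_deriv \<phi> \<alpha> (\<zeta> *\<^sub>C \<alpha>) = 0"
  by (simp add: affine_deriv_scaleC) (simp add: affine_deriv_def power2_eq_square scaleC.zero_right)

text \<open>The complex line through \<open>\<alpha>\<close> is the kernel of the projection to projective space, so only the horizontal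
  part of \<open>w\<close> contributes.\<close>

lemma affine_deriv_horizontal:
  "affine_deriv \<phi> \<alpha> (w - \<zeta> *\<^sub>C \<alpha>) = affine_deriv \<phi> \<alpha> w"
  using affine_deriv_add[of \<phi> \<alpha> "w - \<zeta> *\<^sub>C \<alpha>" "\<zeta> *\<^sub>C \<alpha>"] by (simp add: affine_deriv_self)

text \<open>The image under the differential of the projection of the part of \<open>w\<close> that is tangent to the sphere.\<close>

definition quotient_vector :: "'a::euclidean_space L2 \<Rightarrow> 'a L2 \<Rightarrow> ('a L2 set, 'a L2) tangent" where
  "quotient_vector \<alpha> w = velocity quotient_atlas (orbit \<circ> sphere_curve \<alpha> w)"

context
  fixes \<alpha> :: "'a::euclidean_space L2"
  assumes \<alpha>: "norm \<alpha> = 1"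
begin

lemma affine_coord_sphere_curve:
  assumes "cinner \<alpha> \<phi> \<noteq> 0"
  shows "((\<lambda>t. affine_coord \<phi> (sphere_curve \<alpha> w t)) has_vector_derivative affine_deriv \<phi> \<alpha> w) (at 0)"
proof -
  have "((\<lambda>t. affine_coord \<phi> (sphere_curve \<alpha> w t)) has_derivative
      (\<lambda>t. affine_deriv \<phi> \<alpha> (t *\<^sub>R (w - inner \<alpha> w *\<^sub>R \<alpha>)))) (at 0)"
    using has_derivative_compose[OF sphere_curve_deriv[OF \<alpha>, of w, unfolded has_vector_derivative_def], of "affine_coord \<phi>"]
      affine_coord_has_derivative[OF assms] by (simp add: sphere_curve_0[OF \<alpha>])
  moreover have "affine_deriv \<phi> \<alpha> (t *\<^sub>R (w - inner \<alpha> w *\<^sub>R \<alpha>)) = t *\<^sub>R affine_deriv \<phi> \<alpha> w" for t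
    by (simp only: scaleC_of_real[symmetric] affine_deriv_scaleC affine_deriv_horizontal)
  ultimately show ?thesis by (simp only: has_vector_derivative_def)
qed

lemma differentiable_orbit_curve: "differentiable_curve quotient_atlas (orbit \<circ> sphere_curve \<alpha> w)"
  unfolding differentiable_curve_def points_quotient_atlas o_apply sphere_curve_0[OF \<alpha>]
proof (intro conjI ballI)
  show "orbit \<alpha> \<in> orbit ` sphere 0 1" using \<alpha> by simp
  fix c assume "c \<in> charts_at quotient_atlas (orbit \<alpha>)"
  then obtain \<phi> where c: "c = quotient_chart \<phi>" "cinner \<alpha> \<phi> \<noteq> 0"
    using charts_at_quotient_atlas[OF \<alpha>] by blast
  have "eventually (\<lambda>t. sphere_curve \<alpha> w t \<in> {\<alpha>. cinner \<alpha> \<phi> \<noteq> 0}) (nhds 0)"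
    by (rule sphere_curve_eventually[OF \<alpha> open_cinner_nonzero]) (use c in simp)
  with sphere_curve_in_sphere[OF \<alpha>, of w] show "eventually (\<lambda>t. orbit (sphere_curve \<alpha> w t) \<in> cdom c) (nhds 0)"
    by eventually_elim (simp add: c)
  show "(\<lambda>t. ccoord c (orbit (sphere_curve \<alpha> w t))) differentiable (at 0)"
    using differentiableI_vector[OF affine_coord_sphere_curve[OF c(2)]] by (simp add: c(1))
qed

lemma quotient_vector_tangent: "quotient_vector \<alpha> w \<in> tangent_space quotient_atlas (orbit \<alpha>)"
  using velocity_in_tangent_space[OF differentiable_atlas_quotient differentiable_orbit_curve, of w]
  by (simp add: quotient_vector_def sphere_curve_0[OF \<alpha>])

lemma quotient_vector_coord:
  assumes "norm \<phi> = 1" "cinner \<alpha> \<phi> \<noteq> 0"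
  shows "quotient_vector \<alpha> w (quotient_chart \<phi>) = affine_deriv \<phi> \<alpha> w"
  using assms charts_at_quotient_atlas[OF \<alpha>] vector_derivative_at[OF affine_coord_sphere_curve[OF assms(2), of w]]
  by (auto simp: quotient_vector_def velocity_def sphere_curve_0[OF \<alpha>])

text \<open>The chart with pole \<open>\<alpha>\<close> reads off the horizontal lift at \<open>\<alpha>\<close>.\<close>

lemma quotient_vector_horizontal: "quotient_vector \<alpha> w (quotient_chart \<alpha>) = w - cinner w \<alpha> *\<^sub>C \<alpha>"
  using quotient_vector_coord[OF \<alpha>, of w] cinner_self_1[OF \<alpha>] by (simp add: affine_deriv_def scaleC_one)

lemma pole_chart_at: "quotient_chart \<alpha> \<in> charts_at quotient_atlas (orbit \<alpha>)"
  using charts_at_quotient_atlas[OF \<alpha>] \<alpha> cinner_self_1[OF \<alpha>] by force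

lemma quotient_vector_of_tangent:
  assumes v: "v \<in> tangent_space quotient_atlas (orbit \<alpha>)"
  shows "quotient_vector \<alpha> (v (quotient_chart \<alpha>)) = v" "cinner (v (quotient_chart \<alpha>)) \<alpha> = 0"
proof -
  show *: "cinner (v (quotient_chart \<alpha>)) \<alpha> = 0" using tangent_in_model[OF v pole_chart_at] by simp
  then have "quotient_vector \<alpha> (v (quotient_chart \<alpha>)) (quotient_chart \<alpha>) = v (quotient_chart \<alpha>)"
    by (simp add: quotient_vector_horizontal scaleC.zero_left)
  then show "quotient_vector \<alpha> (v (quotient_chart \<alpha>)) = v"
    by (rule tangent_eqI[OF quotient_vector_tangent v pole_chart_at])
qed

lemma quotient_vector_add: "quotient_vector \<alpha> (v + w) = tangent_add (quotient_vector \<alpha> v) (quotient_vector \<alpha> w)"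
proof
  fix c
  show "quotient_vector \<alpha> (v + w) c = tangent_add (quotient_vector \<alpha> v) (quotient_vector \<alpha> w) c"
  proof (cases "c \<in> charts_at quotient_atlas (orbit \<alpha>)")
    case True
    then show ?thesis using charts_at_quotient_atlas[OF \<alpha>]
      by (auto simp: tangent_add_def quotient_vector_coord affine_deriv_add)
  next
    case False
    then show ?thesis using tangent_outside[OF quotient_vector_tangent] by (simp add: tangent_add_def)
  qed
qed

lemma quotient_vector_scale: "quotient_vector \<alpha> (r *\<^sub>R w) = tangent_scale r (quotient_vector \<alpha> w)"
proof
  fix c
  show "quotient_vector \<alpha> (r *\<^sub>R w) c = tangent_scale r (quotient_vector \<alpha> w) c"
  proof (cases "c \<in> charts_at quotient_atlas (orbit \<alpha>)")
    case True
    then show ?thesis using charts_at_quotient_atlas[OF \<alpha>]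
      by (auto simp: tangent_scale_def quotient_vector_coord affine_deriv_scaleC simp flip: scaleC_of_real)
  next
    case False
    then show ?thesis using tangent_outside[OF quotient_vector_tangent] by (simp add: tangent_scale_def)
  qed
qed

lemma dmap_orbit: "dmap sphere_atlas quotient_atlas orbit \<alpha> (sphere_vector \<alpha> w) = quotient_vector \<alpha> w"
proof -
  have "differentiable_at_point sphere_atlas (ccoord d \<circ> orbit) \<alpha>"
    if "d \<in> charts_at quotient_atlas (orbit \<alpha>)" for d
  proof -
    from that obtain \<psi> where \<psi>: "d = quotient_chart \<psi>" "cinner \<alpha> \<psi> \<noteq> 0"
      using charts_at_quotient_atlas[OF \<alpha>] by blast
    show ?thesis
      by (rule differentiable_at_sphere_point[OF smooth_affine_coord open_cinner_nonzero]) (use \<psi> in auto)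
  qed
  then show ?thesis
    using dmap_velocity[OF differentiable_atlas_sphere differentiable_sphere_curve[OF \<alpha>], of quotient_atlas orbit w]
    by (simp add: sphere_vector_def quotient_vector_def sphere_curve_0[OF \<alpha>])
qed

end

lemma smooth_submersion_orbit:
  "smooth_submersion sphere_atlas quotient_atlas (orbit :: 'a::euclidean_space L2 \<Rightarrow> 'a L2 set)"
  unfolding smooth_submersion_def smooth_map_def points_sphere_atlas points_quotient_atlas
proof (intro conjI ballI)
  fix c :: "('a L2, 'a L2) chart" and d :: "('a L2 set, 'a L2) chart"
  assume "c \<in> sphere_atlas" "d \<in> quotient_atlas"
  then obtain \<phi> \<psi> where \<phi>: "norm \<phi> = 1" "c = sphere_chart \<phi>" and \<psi>: "norm \<psi> = 1" "d = quotient_chart \<psi>"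
    by (auto simp: sphere_atlas_def quotient_atlas_def)
  have "cdom c \<inter> orbit -` cdom d = cdom c \<inter> {\<alpha>. cinner \<alpha> \<psi> \<noteq> 0}"
    using orbit_in_image[OF circle_invariant_cinner_nonzero[of \<psi>]] by (auto simp: \<phi> \<psi> simp del: mem_Collect_eq)
  with smooth_in_sphere_chart(1,2)[OF \<phi>(1) smooth_affine_coord open_cinner_nonzero, of \<psi> "ccoord d \<circ> orbit"]
  show "openin (top_of_set (cmodel c)) (ccoord c ` (cdom c \<inter> orbit -` cdom d))"
    "smooth_on (cmodel c) (ccoord c ` (cdom c \<inter> orbit -` cdom d)) (ccoord d \<circ> orbit \<circ> cinv c)"
    by (simp_all only: \<phi> \<psi> o_apply quotient_chart_simps)
next
  fix p :: "'a L2" assume "p \<in> sphere 0 1"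
  then have p: "norm p = 1" by simp
  show "dmap sphere_atlas quotient_atlas orbit p ` tangent_space sphere_atlas p = tangent_space quotient_atlas (orbit p)"
  proof (intro equalityI subsetI)
    fix v assume "v \<in> tangent_space quotient_atlas (orbit p)"
    note v = quotient_vector_of_tangent[OF p this]
    have "inner p (v (quotient_chart p)) = 0" using v(2) Re_cinner[of "v (quotient_chart p)" p] by (simp add: inner_commute)
    moreover have "dmap sphere_atlas quotient_atlas orbit p (sphere_vector p (v (quotient_chart p))) = v"
      by (simp add: dmap_orbit[OF p] v)
    ultimately show "v \<in> dmap sphere_atlas quotient_atlas orbit p ` tangent_space sphere_atlas p"
      unfolding tangent_space_sphere[OF p] by force
  qed (auto simp: tangent_space_sphere[OF p] dmap_orbit[OF p] quotient_vector_tangent[OF p])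
qed auto

section \<open>The reduced symplectic form\<close>

text \<open>The value of \<open>\<omega>\<close> on the horizontal lifts at some point \<open>\<alpha>\<close> of the orbit; these lifts are the coordinate
  vectors in the chart with pole \<open>\<alpha>\<close>.\<close>

definition reduced_form :: "('a::euclidean_space L2 set, 'a L2) form2" where
  "reduced_form q v w =
     (if q \<in> points quotient_atlas \<and> v \<in> tangent_space quotient_atlas q \<and> w \<in> tangent_space quotient_atlas q
      then let \<alpha> = (SOME \<alpha>. norm \<alpha> = 1 \<and> orbit \<alpha> = q)
        in omega (v (quotient_chart \<alpha>)) (w (quotient_chart \<alpha>))
      else 0)"

text \<open>Changing the point in the orbit by \<open>\<zeta>\<close> multiplies horizontal lifts by \<open>\<zeta>\<close>; together with the invariance of
  \<open>\<omega>\<close> under \<open>\<zeta>\<close> this makes \<open>reduced_form\<close> independent of the chosen point.\<close>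

lemma affine_deriv_rotated_pole:
  assumes \<alpha>: "norm \<alpha> = 1" and \<zeta>: "cmod \<zeta> = 1"
  shows "affine_deriv (\<zeta> *\<^sub>C \<alpha>) \<alpha> w = \<zeta> *\<^sub>C (w - cinner w \<alpha> *\<^sub>C \<alpha>)"
proof -
  have 1: "\<zeta> * cnj \<zeta> = 1" using \<zeta> by (simp add: complex_norm_square[symmetric])
  then have i: "inverse (cnj \<zeta>) = \<zeta>" by (metis inverse_unique mult.commute)
  have nz: "\<zeta> \<noteq> 0" using \<zeta> by auto
  have "1 / cinner \<alpha> (\<zeta> *\<^sub>C \<alpha>) = \<zeta>"
    using i by (simp add: cinner_scaleC_right cinner_self_1[OF \<alpha>] divide_inverse)
  moreover have "cinner w (\<zeta> *\<^sub>C \<alpha>) / (cinner \<alpha> (\<zeta> *\<^sub>C \<alpha>))\<^sup>2 = \<zeta> * cinner w \<alpha>"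
    using i nz 1 by (simp add: cinner_scaleC_right cinner_self_1[OF \<alpha>] divide_inverse power2_eq_square mult_ac)
  ultimately show ?thesis by (simp add: affine_deriv_def scaleC.diff_right scaleC_scaleC)
qed

lemma omega_scaleC: "cmod \<zeta> = 1 \<Longrightarrow> omega (\<zeta> *\<^sub>C v) (\<zeta> *\<^sub>C w) = omega v w"
proof -
  assume "cmod \<zeta> = 1"
  then have "\<zeta> * cnj \<zeta> = 1" by (simp add: complex_norm_square[symmetric])
  then have "cinner (\<zeta> *\<^sub>C v) (\<zeta> *\<^sub>C w) = cinner v w"
    by (metis cinner_scaleC_left cinner_scaleC_right mult.assoc mult.left_neutral)
  then show ?thesis by (simp add: omega_def)
qed

text \<open>For arbitrary \<open>v\<close> and \<open>w\<close> the right-hand side is \<open>\<omega>\<close> on their horizontal parts.\<close>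

lemma reduced_form_eq:
  assumes \<alpha>: "norm \<alpha> = 1"
  shows "reduced_form (orbit \<alpha>) (quotient_vector \<alpha> v) (quotient_vector \<alpha> w)
    = Im (cinner v w - cinner v \<alpha> * cinner \<alpha> w)"
proof -
  define \<beta> where "\<beta> = (SOME \<beta>. norm \<beta> = 1 \<and> orbit \<beta> = orbit \<alpha>)"
  have \<beta>: "norm \<beta> = 1 \<and> orbit \<beta> = orbit \<alpha>"
    unfolding \<beta>_def by (rule someI[where P = "\<lambda>\<beta>. norm \<beta> = 1 \<and> orbit \<beta> = orbit \<alpha>" and x = \<alpha>]) (simp add: \<alpha>)
  then obtain \<zeta> where \<zeta>: "cmod \<zeta> = 1" "\<beta> = \<zeta> *\<^sub>C \<alpha>" using orbit_eq_iff by metis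
  have "quotient_vector \<alpha> x (quotient_chart \<beta>) = \<zeta> *\<^sub>C (x - cinner x \<alpha> *\<^sub>C \<alpha>)" for x
  proof -
    have "cinner \<alpha> \<beta> \<noteq> 0" using \<zeta> by (auto simp: cinner_scaleC_right cinner_self_1[OF \<alpha>])
    then show ?thesis using \<beta> quotient_vector_coord[OF \<alpha>, of \<beta>] \<zeta> affine_deriv_rotated_pole[OF \<alpha> \<zeta>(1)] by metis
  qed
  moreover have "reduced_form (orbit \<alpha>) (quotient_vector \<alpha> v) (quotient_vector \<alpha> w) =
      omega (quotient_vector \<alpha> v (quotient_chart \<beta>)) (quotient_vector \<alpha> w (quotient_chart \<beta>))"
    using \<alpha> quotient_vector_tangent[OF \<alpha>] by (simp add: reduced_form_def points_quotient_atlas Let_def flip: \<beta>_def)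
  ultimately have "reduced_form (orbit \<alpha>) (quotient_vector \<alpha> v) (quotient_vector \<alpha> w) =
      omega (v - cinner v \<alpha> *\<^sub>C \<alpha>) (w - cinner w \<alpha> *\<^sub>C \<alpha>)" using omega_scaleC[OF \<zeta>(1)] by simp
  also have "\<dots> = Im (cinner v w - cinner v \<alpha> * cinner \<alpha> w)"
    using cinner_commute[of w \<alpha>]
    by (simp add: omega_def cinner.diff_left cinner.diff_right cinner_scaleC_left cinner_scaleC_right
        cinner_self_1[OF \<alpha>])
  finally show ?thesis .
qed

lemma quotient_tangent_cases:
  assumes "q \<in> points quotient_atlas"
  obtains \<alpha> where "norm \<alpha> = 1" "q = orbit \<alpha>"
    "\<And>v. v \<in> tangent_space quotient_atlas q \<Longrightarrow> \<exists>a. cinner a \<alpha> = 0 \<and> v = quotient_vector \<alpha> a"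
proof -
  from assms obtain \<alpha> where \<alpha>: "norm \<alpha> = 1" "q = orbit \<alpha>" unfolding points_quotient_atlas by auto
  then show ?thesis using quotient_vector_of_tangent[OF \<alpha>(1)] by (intro that[of \<alpha>]) metis+
qed

lemma reduced_form_nondegenerate:
  assumes q: "q \<in> points quotient_atlas" and v: "v \<in> tangent_space quotient_atlas q" "v' \<in> tangent_space quotient_atlas q"
    and eq: "\<And>w. w \<in> tangent_space quotient_atlas q \<Longrightarrow> reduced_form q v w = reduced_form q v' w"
  shows "v = v'"
proof -
  obtain \<alpha> where \<alpha>: "norm \<alpha> = 1" "q = orbit \<alpha>"
    "\<And>v. v \<in> tangent_space quotient_atlas q \<Longrightarrow> \<exists>a. cinner a \<alpha> = 0 \<and> v = quotient_vector \<alpha> a"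
    using quotient_tangent_cases[OF q] by blast
  obtain a b where a: "cinner a \<alpha> = 0" "v = quotient_vector \<alpha> a" and b: "cinner b \<alpha> = 0" "v' = quotient_vector \<alpha> b"
    using \<alpha>(3)[OF v(1)] \<alpha>(3)[OF v(2)] by blast
  \<comment> \<open>Both \<open>a - b\<close> and \<open>\<i> (a - b)\<close> are horizontal, and \<open>Im \<langle>a - b, \<i> (a - b)\<rangle> = - \<parallel>a - b\<parallel>\<^sup>2\<close>.\<close>
  let ?w = "\<i> *\<^sub>C (a - b)"
  have "reduced_form q v (quotient_vector \<alpha> ?w) = reduced_form q v' (quotient_vector \<alpha> ?w)"
    unfolding \<alpha>(2) by (rule eq[unfolded \<alpha>(2)]) (rule quotient_vector_tangent[OF \<alpha>(1)])
  then have "Im (cinner (a - b) ?w) = 0"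
    using a b by (simp add: \<alpha> reduced_form_eq cinner.diff_left)
  then have "a - b = 0"
    by (simp only: cinner_scaleC_right cinner_self) simp
  then show ?thesis using a b by simp
qed

lemma reduced_form_pullback:
  "pullback_const_form sphere_atlas (\<lambda>\<alpha>. \<alpha>) omega =
     pullback_form sphere_atlas quotient_atlas orbit (reduced_form :: ('a::euclidean_space L2 set, 'a L2) form2)"
proof (intro ext)
  fix p :: "'a L2" and v w
  show "pullback_const_form sphere_atlas (\<lambda>\<alpha>. \<alpha>) omega p v w =
     pullback_form sphere_atlas quotient_atlas orbit reduced_form p v w"
  proof (cases "p \<in> points sphere_atlas \<and> v \<in> tangent_space sphere_atlas p \<and> w \<in> tangent_space sphere_atlas p")
    case True
    then have p: "norm p = 1" by (simp add: points_sphere_atlas)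
    from True obtain a b where a: "v = sphere_vector p a" "inner p a = 0" and b: "w = sphere_vector p b" "inner p b = 0"
      unfolding tangent_space_sphere[OF p] by blast
    \<comment> \<open>The correction term \<open>\<langle>a, p\<rangle> \<langle>p, b\<rangle>\<close> is a product of two imaginary numbers, hence real.\<close>
    have "Re (cinner a p) = 0" "Re (cinner p b) = 0" using a b by (simp_all add: Re_cinner inner_commute)
    then have "omega a b = reduced_form (orbit p) (quotient_vector p a) (quotient_vector p b)"
      by (simp add: reduced_form_eq[OF p] omega_def)
    then show ?thesis using True a b
      by (simp add: pullback_const_form_def pullback_form_def dfun_inclusion[OF p] dmap_orbit[OF p])
  qed (auto simp: pullback_const_form_def pullback_form_def)
qed

text \<open>The differential of the projection is onto at every point, and forms vanish off the tangent spaces.\<close>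

lemma form_unique_by_pullback:
  fixes \<omega>1 \<omega>2 :: "('a::euclidean_space L2 set, 'a L2) form2"
  assumes s: "smooth_2form quotient_atlas \<omega>1" "smooth_2form quotient_atlas \<omega>2"
    and eq: "pullback_form sphere_atlas quotient_atlas orbit \<omega>1 = pullback_form sphere_atlas quotient_atlas orbit \<omega>2"
  shows "\<omega>1 = \<omega>2"
proof (intro ext)
  fix q v w
  show "\<omega>1 q v w = \<omega>2 q v w"
  proof (cases "q \<in> points quotient_atlas \<and> v \<in> tangent_space quotient_atlas q \<and> w \<in> tangent_space quotient_atlas q")
    case True
    then obtain p where p: "norm p = 1" "q = orbit p" unfolding points_quotient_atlas by auto
    then have pp: "p \<in> points sphere_atlas" by (simp add: points_sphere_atlas)
    with smooth_submersion_orbit p have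
      "dmap sphere_atlas quotient_atlas orbit p ` tangent_space sphere_atlas p = tangent_space quotient_atlas q"
      unfolding smooth_submersion_def by blast
    with True obtain v' w' where v: "v' \<in> tangent_space sphere_atlas p" "v = dmap sphere_atlas quotient_atlas orbit p v'"
      and w: "w' \<in> tangent_space sphere_atlas p" "w = dmap sphere_atlas quotient_atlas orbit p w'" by blast
    from fun_cong[OF fun_cong[OF fun_cong[OF eq]], of p v' w'] show ?thesis
      using pp v w p by (simp add: pullback_form_def)
  next
    case False
    then show ?thesis using s unfolding smooth_2form_def by metis
  qed
qed

definition fubini_study :: "'a::euclidean_space L2 \<Rightarrow> 'a L2 \<Rightarrow> 'a L2 \<Rightarrow> real" where
  "fubini_study x u v = Im (cinner u v) * inverse (1 + inner x x)
     - Im (cinner u x * cinner x v) * (inverse (1 + inner x x))\<^sup>2"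

lemma affine_chart_point:
  assumes \<phi>: "norm \<phi> = 1" and x: "cinner x \<phi> = 0"
  defines "N \<equiv> norm (x + \<phi>)" and "\<alpha> \<equiv> sgn (x + \<phi>)"
  shows "N > 0" "N\<^sup>2 = 1 + inner x x" "\<alpha> = inverse N *\<^sub>R (x + \<phi>)" "norm \<alpha> = 1" "cinner \<alpha> \<phi> = inverse N"
proof -
  have nz: "x + \<phi> \<noteq> 0" using add_pole_nonzero[OF \<phi> x] .
  then show N: "N > 0" by (simp add: N_def)
  show \<alpha>: "\<alpha> = inverse N *\<^sub>R (x + \<phi>)" by (simp add: \<alpha>_def N_def sgn_div_norm)
  show "norm \<alpha> = 1" using nz by (simp add: \<alpha>_def norm_sgn)
  show "cinner \<alpha> \<phi> = inverse N" by (simp add: \<alpha> cinner_scaleR_left cinner_add_pole[OF \<phi> x])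
  have "inner x \<phi> = 0" using x Re_cinner[of x \<phi>] by simp
  then show "N\<^sup>2 = 1 + inner x x" 
    using \<phi> by (simp add: N_def power2_norm_eq_inner inner_add_left inner_add_right inner_commute norm_1_iff_inner)
qed

text \<open>The point with coordinate \<open>x\<close> is the orbit of \<open>\<alpha> = (x + \<phi>) / N\<close> with \<open>N\<^sup>2 = 1 + \<parallel>x\<parallel>\<^sup>2\<close>, and the vector with
  coordinate \<open>u\<close> is the image of \<open>u / N\<close>.\<close>

lemma local_reduced_form:
  assumes \<phi>: "norm \<phi> = 1" and x: "cinner x \<phi> = 0" and u: "cinner u \<phi> = 0" and v: "cinner v \<phi> = 0"
  shows "local_form quotient_atlas reduced_form (quotient_chart \<phi>) x u v = fubini_study x u v"
proof -
  define N where "N = norm (x + \<phi>)"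
  define \<alpha> where "\<alpha> = sgn (x + \<phi>)"
  note * = affine_chart_point[OF \<phi> x, folded N_def \<alpha>_def]
  have nz: "cinner \<alpha> \<phi> \<noteq> 0" using * by simp
  have c: "quotient_chart \<phi> \<in> charts_at quotient_atlas (orbit \<alpha>)"
    using charts_at_quotient_atlas[OF *(4)] \<phi> nz by blast
  have coord: "tangent_of_coord quotient_atlas (quotient_chart \<phi>) (orbit \<alpha>) w = quotient_vector \<alpha> (inverse N *\<^sub>R w)"
    if "cinner w \<phi> = 0" for w
  proof -
    have "quotient_vector \<alpha> (inverse N *\<^sub>R w) (quotient_chart \<phi>) = w"
      unfolding quotient_vector_coord[OF *(4) \<phi> nz] affine_deriv_def
    proof -
      have "1 / complex_of_real (inverse N) = complex_of_real N" by (simp add: divide_inverse)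
      then show "(1 / cinner \<alpha> \<phi>) *\<^sub>C inverse N *\<^sub>R w - (cinner (inverse N *\<^sub>R w) \<phi> / (cinner \<alpha> \<phi>)\<^sup>2) *\<^sub>C \<alpha> = w"
        unfolding *(5) using *(1) that by (simp add: cinner_scaleR_left scaleC.zero_left scaleC_of_real)
    qed
    then show ?thesis using tangent_of_coord_eq[OF quotient_vector_tangent[OF *(4), of "inverse N *\<^sub>R w"] c] by simp
  qed
  have "cinner u \<alpha> = inverse N * cinner u x" "cinner \<alpha> v = inverse N * cinner x v"
    using u v cinner_commute[of v \<phi>]
    by (auto simp: *(3) cinner_scaleR_left cinner_scaleR_right cinner_add_left cinner_add_right)
  then have "local_form quotient_atlas reduced_form (quotient_chart \<phi>) x u v =
      Im (inverse N * inverse N * cinner u v - (inverse N * inverse N) * (inverse N * inverse N) * (cinner u x * cinner x v))"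
    unfolding local_form_def using x
    by (simp add: cinv_quotient_chart[OF \<phi>] coord u v reduced_form_eq[OF *(4)] cinner_scaleR_left cinner_scaleR_right
        mult_ac flip: \<alpha>_def)
  also have "inverse N * inverse N = inverse (1 + inner x x)"
    by (simp add: *(2)[symmetric] power2_eq_square)
  finally show ?thesis
    by (simp add: fubini_study_def power2_eq_square mult.commute del: of_real_inverse of_real_mult)
qed

lemma smooth_fubini_study:
  assumes f: "smooth_on UNIV U f" and g: "smooth_on UNIV U g" and h: "smooth_on UNIV U h"
  shows "smooth_on UNIV U (\<lambda>z. fubini_study (f z) (g z) (h z))"
proof -
  have pos: "1 + inner x x \<noteq> 0" for x :: "'b L2"
    using inner_ge_zero[of x] by linarith
  show ?thesis
    unfolding fubini_study_def power2_eq_square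
    by (intro smooth_on_diff smooth_on_mult smooth_on_bounded_linear[OF bounded_linear_Im] smooth_on_cinner smooth_on_inverse
        smooth_on_add smooth_on_const smooth_on_inner f g h pos)
qed

lemma fubini_study_has_derivative:
  fixes x v w :: "'a::euclidean_space L2"
  defines "r \<equiv> inverse (1 + inner x x)"
  shows "((\<lambda>y. fubini_study y v w) has_derivative (\<lambda>h.
     - 2 * inner x h * r\<^sup>2 * Im (cinner v w)
     - Im (cinner v h * cinner x w + cinner v x * cinner h w) * r\<^sup>2
     + 4 * inner x h * r ^ 3 * Im (cinner v x * cinner x w))) (at x)"
proof -
  have pos: "1 + inner x x \<noteq> 0"
    using inner_ge_zero[of x] by linarith
  have r: "((\<lambda>y. inverse (1 + inner y y)) has_derivative (\<lambda>h. - 2 * inner x h * r\<^sup>2)) (at x)"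
    using pos by (auto intro!: derivative_eq_intros simp: r_def power2_eq_square inner_commute)
  have c: "((\<lambda>y. Im (cinner v y * cinner y w)) has_derivative (\<lambda>h. Im (cinner v x * cinner h w + cinner v h * cinner x w))) (at x)"
    by (intro bounded_linear.has_derivative[OF bounded_linear_Im] has_derivative_mult
        bounded_linear_imp_has_derivative cinner.bounded_linear_left cinner.bounded_linear_right)
  have "((\<lambda>y. fubini_study y v w) has_derivative (\<lambda>h. Im (cinner v w) * (- 2 * inner x h * r\<^sup>2) -
      (Im (cinner v x * cinner x w) * (of_nat 2 * (- 2 * inner x h * r\<^sup>2) * r ^ (2 - 1))
        + Im (cinner v x * cinner h w + cinner v h * cinner x w) * r\<^sup>2))) (at x)"
    unfolding fubini_study_def
    using has_derivative_diff[OF has_derivative_mult[OF has_derivative_const[of "Im (cinner v w)"] r]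
        has_derivative_mult[OF c has_derivative_power[OF r, of 2]]]
    by (simp flip: r_def)
  moreover have "Im (cinner v w) * (- 2 * inner x h * r\<^sup>2) -
      (Im (cinner v x * cinner x w) * (of_nat 2 * (- 2 * inner x h * r\<^sup>2) * r ^ (2 - 1))
        + Im (cinner v x * cinner h w + cinner v h * cinner x w) * r\<^sup>2) =
     - 2 * inner x h * r\<^sup>2 * Im (cinner v w)
     - Im (cinner v h * cinner x w + cinner v x * cinner h w) * r\<^sup>2
     + 4 * inner x h * r ^ 3 * Im (cinner v x * cinner x w)" for h
    by (simp add: power2_eq_square power3_eq_cube algebra_simps)
  ultimately show ?thesis by (simp only:)
qed

text \<open>The exterior derivative in a chart is the cyclic sum of the derivatives of the Fubini--Study form.  Written
  in real and imaginary parts of the inner products of \<open>x, u, v, w\<close>, it is a polynomial identity.\<close>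

lemma closed_reduced_form: "closed_2form quotient_atlas (reduced_form :: ('a::euclidean_space L2 set, 'a L2) form2)"
  unfolding closed_2form_def
proof (intro ballI)
  fix c :: "('a L2 set, 'a L2) chart" and x u v w :: "'a L2"
  assume "c \<in> quotient_atlas" and x: "x \<in> crange c" and uvw: "u \<in> cmodel c" "v \<in> cmodel c" "w \<in> cmodel c"
  then obtain \<phi> where \<phi>: "norm \<phi> = 1" "c = quotient_chart \<phi>" by (auto simp: quotient_atlas_def)
  have E: "cmodel c = {v. cinner v \<phi> = 0}" by (simp add: \<phi>)
  have x': "x \<in> cmodel c" using x by (simp add: \<phi> crange_quotient_chart)
  define r where "r = inverse (1 + inner x x)"
  have D: "frechet_derivative (\<lambda>y. local_form quotient_atlas reduced_form c y b b') (at x within cmodel c) a =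
     - 2 * inner x a * r\<^sup>2 * Im (cinner b b')
     - Im (cinner b a * cinner x b' + cinner b x * cinner a b') * r\<^sup>2
     + 4 * inner x a * r ^ 3 * Im (cinner b x * cinner x b')"
    if "a \<in> cmodel c" "b \<in> cmodel c" "b' \<in> cmodel c" for a b b'
  proof (rule frechet_derivative_within_subspace)
    show "subspace (cmodel c)" unfolding E by (rule closed_complex_orthogonal)
    show "((\<lambda>y. local_form quotient_atlas reduced_form c y b b') has_derivative
      (\<lambda>a. - 2 * inner x a * r\<^sup>2 * Im (cinner b b')
     - Im (cinner b a * cinner x b' + cinner b x * cinner a b') * r\<^sup>2
     + 4 * inner x a * r ^ 3 * Im (cinner b x * cinner x b'))) (at x within cmodel c)"
    proof (rule has_derivative_transform[OF x'])
      fix y assume "y \<in> cmodel c"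
      then show "local_form quotient_atlas reduced_form c y b b' = fubini_study y b b'"
        using that local_reduced_form[OF \<phi>(1)] by (simp add: \<phi>)
    qed (rule has_derivative_at_withinI, unfold r_def, rule fubini_study_has_derivative)
  qed (use x' that in auto)
  have *: "cinner u x = cnj (cinner x u)" "cinner v x = cnj (cinner x v)" "cinner w x = cnj (cinner x w)"
    "cinner v u = cnj (cinner u v)" "cinner w u = cnj (cinner u w)" "cinner w v = cnj (cinner v w)"
    by (rule cinner_commute)+
  show "local_ext_deriv quotient_atlas reduced_form c x u v w = 0"
    unfolding local_ext_deriv_def D[OF uvw(1,2,3)] D[OF uvw(2,1,3)] D[OF uvw(3,1,2)] Re_cinner[symmetric]
    by (simp add: * algebra_simps)
qed

lemma symplectic_reduced_form: "symplectic_form quotient_atlas (reduced_form :: ('a::euclidean_space L2 set, 'a L2) form2)"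
  unfolding symplectic_form_def
proof (intro conjI closed_reduced_form ballI impI)
  show "smooth_2form quotient_atlas (reduced_form :: ('a L2 set, 'a L2) form2)"
    unfolding smooth_2form_def
  proof (intro conjI allI impI ballI)
    fix c :: "('a L2 set, 'a L2) chart" assume "c \<in> quotient_atlas"
    then obtain \<phi> where \<phi>: "norm \<phi> = 1" "c = quotient_chart \<phi>" by (auto simp: quotient_atlas_def)
    have "smooth_on UNIV (crange c \<times> cmodel c \<times> cmodel c) (\<lambda>z. fubini_study (fst z) (fst (snd z)) (snd (snd z)) )"
      by (intro smooth_fubini_study smooth_on_linear bounded_linear_compose[OF bounded_linear_fst bounded_linear_snd]
          bounded_linear_compose[OF bounded_linear_snd bounded_linear_snd] bounded_linear_fst)
    then have "smooth_on (cmodel c \<times> cmodel c \<times> cmodel c) (crange c \<times> cmodel c \<times> cmodel c)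
        (\<lambda>z. fubini_study (fst z) (fst (snd z)) (snd (snd z)))"
      by (rule smooth_on_subset) auto
    then show "smooth_on (cmodel c \<times> cmodel c \<times> cmodel c) (crange c \<times> cmodel c \<times> cmodel c)
        (\<lambda>(x, u, v). local_form quotient_atlas reduced_form c x u v)"
      by (rule smooth_on_cong) (auto simp: \<phi> crange_quotient_chart local_reduced_form)
  next
    fix q :: "'a L2 set" and u v w :: "('a L2 set, 'a L2) tangent" and r :: real
    assume q: "q \<in> points quotient_atlas" and t: "u \<in> tangent_space quotient_atlas q"
      "v \<in> tangent_space quotient_atlas q" "w \<in> tangent_space quotient_atlas q"
    obtain \<alpha> where \<alpha>: "norm \<alpha> = 1" "q = orbit \<alpha>"
      "\<And>v. v \<in> tangent_space quotient_atlas q \<Longrightarrow> \<exists>a. cinner a \<alpha> = 0 \<and> v = quotient_vector \<alpha> a"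
      using quotient_tangent_cases[OF q] by blast
    obtain a b d where abd: "cinner a \<alpha> = 0" "u = quotient_vector \<alpha> a" "cinner b \<alpha> = 0" "v = quotient_vector \<alpha> b"
      "cinner d \<alpha> = 0" "w = quotient_vector \<alpha> d"
      using \<alpha>(3)[OF t(1)] \<alpha>(3)[OF t(2)] \<alpha>(3)[OF t(3)] by blast
    show "reduced_form q v w = - reduced_form q w v"
      using cinner_commute[of b d] by (simp add: abd \<alpha> reduced_form_eq)
    show "reduced_form q (tangent_add u v) w = reduced_form q u w + reduced_form q v w"
      using abd by (simp add: \<alpha> reduced_form_eq cinner_add_left flip: quotient_vector_add)
    show "reduced_form q (tangent_scale r v) w = r * reduced_form q v w"
      using abd by (simp add: \<alpha> reduced_form_eq cinner_scaleR_left flip: quotient_vector_scale)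
  qed (unfold reduced_form_def, rule if_not_P)
  fix q :: "'a L2 set" and v assume q: "q \<in> points quotient_atlas" and v: "v \<in> tangent_space quotient_atlas q"
    and deg: "\<forall>w\<in>tangent_space quotient_atlas q. reduced_form q v w = 0"
  obtain \<alpha> where \<alpha>: "norm \<alpha> = 1" "q = orbit \<alpha>" using quotient_tangent_cases[OF q] by blast
  have zero: "quotient_vector \<alpha> 0 = (\<lambda>_. 0)"
    using quotient_vector_scale[OF \<alpha>(1), of 0 0] by (simp add: tangent_scale_def)
  have "reduced_form q (quotient_vector \<alpha> 0) w = 0" if w: "w \<in> tangent_space quotient_atlas q" for w
    using quotient_vector_of_tangent(1)[OF \<alpha>(1), of w] w reduced_form_eq[OF \<alpha>(1), of 0 "w (quotient_chart \<alpha>)"]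
    by (simp add: \<alpha>(2) cinner.zero_left)
  then show "v = (\<lambda>_. 0)"
    using reduced_form_nondegenerate[OF q v quotient_vector_tangent[OF \<alpha>(1), of 0, folded \<alpha>(2)]] deg zero by simp
qed

section \<open>Hamiltonian vector fields\<close>

lemma inner_scaleC_ii: "inner (\<i> *\<^sub>C v) w = - omega v w"
  by (simp add: omega_def cinner_scaleC_left flip: Re_cinner)

lemma bounded_bilinear_omega: "bounded_bilinear (omega :: 'a::euclidean_space L2 \<Rightarrow> _)"
  unfolding omega_def[abs_def]
  by (intro bounded_bilinear.intro) 
    (auto simp: cinner_add_left cinner_add_right cinner_scaleR_left cinner_scaleR_right
      intro!: exI[of _ 2] order_trans[OF abs_Im_le_cmod norm_cinner])

interpretation omega: bounded_bilinear "omega :: 'a::euclidean_space L2 \<Rightarrow> _"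
  by (rule bounded_bilinear_omega)

lemma omega_nondegenerate: "(\<And>w. omega v w = 0) \<Longrightarrow> v = 0"
  using inner_scaleC_ii[of v "\<i> *\<^sub>C v"] by (metis inner_eq_zero_iff minus_zero norm_scaleC norm_eq_zero norm_ii mult_1)

lemma symplectic_vector_space_L2: "symplectic_vector_space (omega :: 'a::euclidean_space L2 \<Rightarrow> 'a L2 \<Rightarrow> real)"
  unfolding symplectic_vector_space_def
proof (intro conjI allI impI bounded_bilinear_omega)
  show "omega v w = - omega w v" for v w :: "'a L2"
    using cinner_commute[of v w] by (simp add: omega_def)
qed (use omega_nondegenerate in blast)

lemma half_norm_sq_eq: "half_norm_sq = (\<lambda>v :: 'a::euclidean_space L2. 1 / 2 * inner v v)"
  by (simp add: half_norm_sq_def fun_eq_iff power2_norm_eq_inner)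

lemma half_norm_sq_has_derivative: "(half_norm_sq has_derivative inner v) (at v)"
  unfolding half_norm_sq_eq by (auto intro!: derivative_eq_intros simp: inner_commute)

lemma regular_value_half_norm_sq: "regular_value (half_norm_sq :: 'a::euclidean_space L2 \<Rightarrow> real) (1 / 2)"
  unfolding regular_value_def
proof (intro allI impI exI conjI)
  fix x :: "'a L2" assume "half_norm_sq x = 1 / 2"
  then have "x \<noteq> 0" by (auto simp: half_norm_sq_def)
  show "(half_norm_sq has_derivative inner x) (at x)" by (rule half_norm_sq_has_derivative)
  show "surj (inner x)"
    by (rule surjI[of _ "\<lambda>y. (y / inner x x) *\<^sub>R x"]) (use \<open>x \<noteq> 0\<close> in simp)
qed

lemma exp_ii_has_vector_derivative:
  "((\<lambda>t. exp (- \<i> * complex_of_real (t * \<xi>)) *\<^sub>C v) has_vector_derivative (- \<i> * complex_of_real \<xi>) *\<^sub>C v) (at 0)"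
proof -
  have "((\<lambda>t. - \<i> * complex_of_real (t * \<xi>)) has_derivative (\<lambda>t. - \<i> * complex_of_real (t * \<xi>))) (at 0)"
    by (intro bounded_linear_imp_has_derivative bounded_linear_const_mult
        bounded_linear_compose[OF bounded_linear_of_real] bounded_linear_mult_left)
  from has_derivative_compose[OF this, of exp "(*) 1"] DERIV_exp[of "0 :: complex"]
  have "((\<lambda>t. exp (- \<i> * complex_of_real (t * \<xi>))) has_derivative (\<lambda>t. t *\<^sub>R (- \<i> * complex_of_real \<xi>))) (at 0)"
    by (simp add: has_field_derivative_def scaleR_conv_of_real mult_ac)
  from bounded_linear.has_derivative[OF scaleC.bounded_linear_left this]
  show ?thesis unfolding has_vector_derivative_def scaleC.scaleR_left .
qed

lemma circle_moment_map_half_norm_sq: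
  "circle_moment_map (omega :: 'a::euclidean_space L2 \<Rightarrow> 'a L2 \<Rightarrow> real) (*\<^sub>C) half_norm_sq"
  unfolding circle_moment_map_def
proof (intro conjI allI impI)
  show "smooth_on UNIV UNIV (half_norm_sq :: 'a L2 \<Rightarrow> real)"
    unfolding half_norm_sq_eq by (intro smooth_on_mult smooth_on_const smooth_on_inner smooth_on_id)
  show "half_norm_sq (\<zeta> *\<^sub>C v) = half_norm_sq v" if "cmod \<zeta> = 1" for \<zeta> and v :: "'a L2"
    using that by (simp add: half_norm_sq_def norm_scaleC)
  fix \<xi> :: real
  show "\<exists>Z. (\<forall>v :: 'a L2. ((\<lambda>t. exp (- \<i> * complex_of_real (t * \<xi>)) *\<^sub>C v) has_vector_derivative Z v) (at 0)) \<and>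
      hamiltonian_field_vs omega (\<lambda>v. \<xi> * half_norm_sq v) Z"
  proof (intro exI[of _ "\<lambda>v. (- \<i> * complex_of_real \<xi>) *\<^sub>C v"] conjI allI exp_ii_has_vector_derivative)
    have "- omega ((- \<i> * complex_of_real \<xi>) *\<^sub>C v) w = \<xi> * inner v w" for v w :: "'a L2"
      by (simp add: omega_def cinner_scaleC_left Re_cinner)
    then show "hamiltonian_field_vs omega (\<lambda>v :: 'a L2. \<xi> * half_norm_sq v) (\<lambda>v. (- \<i> * complex_of_real \<xi>) *\<^sub>C v)"
      unfolding hamiltonian_field_vs_def
      using has_derivative_mult_right[OF half_norm_sq_has_derivative] by (auto simp: mult.commute)
  qed
qed

text \<open>If \<open>g\<close> is the gradient of \<open>H\<close>, then \<open>- \<i> g\<close> is the value of the Hamiltonian vector field.\<close>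

lemma ex1_hamiltonian_field_vs:
  fixes H :: "'a::euclidean_space L2 \<Rightarrow> real"
  assumes "\<And>v. H differentiable (at v)"
  shows "\<exists>!X. hamiltonian_field_vs omega H X"
proof -
  have "\<exists>a. (H has_derivative (\<lambda>w. - omega a w)) (at v)" for v
  proof -
    obtain D where D: "(H has_derivative D) (at v)" using assms by (auto simp: differentiable_def)
    then obtain g where "D = inner g"
      using riesz_representation[OF has_derivative_bounded_linear[OF D]] by blast
    moreover have "inner g = (\<lambda>w. - omega ((- \<i>) *\<^sub>C g) w)"
      by (simp add: omega_def cinner_scaleC_left Re_cinner fun_eq_iff)
    ultimately show ?thesis using D by metis
  qed
  then obtain X where "hamiltonian_field_vs omega H X" unfolding hamiltonian_field_vs_def by metis
  moreover have "X = Y" if "hamiltonian_field_vs omega H X" "hamiltonian_field_vs omega H Y" for X Y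
  proof
    fix v
    have "(\<lambda>w. - omega (X v) w) = (\<lambda>w. - omega (Y v) w)"
      using that unfolding hamiltonian_field_vs_def by (blast intro: has_derivative_unique)
    then have "omega (X v - Y v) w = 0" for w by (simp add: omega.diff_left fun_eq_iff)
    then show "X v = Y v" using omega_nondegenerate[of "X v - Y v"] by simp
  qed
  ultimately show ?thesis by blast
qed

context
  fixes H :: "'a::euclidean_space L2 \<Rightarrow> real" and H' :: "'a L2 set \<Rightarrow> real" and X :: "'a L2 \<Rightarrow> 'a L2"
  assumes H: "smooth_on UNIV UNIV H" and inv: "\<And>\<zeta> \<alpha>. cmod \<zeta> = 1 \<Longrightarrow> H (\<zeta> *\<^sub>C \<alpha>) = H \<alpha>"
    and H': "\<And>\<alpha>. norm \<alpha> = 1 \<Longrightarrow> H \<alpha> = H' (orbit \<alpha>)"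
    and X: "hamiltonian_field_vs omega H X"
begin

lemma H_has_derivative: "(H has_derivative (\<lambda>w. - omega (X v) w)) (at v)"
  using X by (simp add: hamiltonian_field_vs_def)

lemma smooth_reduced_hamiltonian: "smooth_function quotient_atlas H'"
  unfolding smooth_function_def
proof
  fix c :: "('a L2 set, 'a L2) chart" assume "c \<in> quotient_atlas"
  then obtain \<phi> where \<phi>: "norm \<phi> = 1" "c = quotient_chart \<phi>" by (auto simp: quotient_atlas_def)
  have "cdom c \<inter> orbit ` (sphere 0 1 \<inter> UNIV) = cdom c" by (auto simp: \<phi>)
  then show "smooth_on (cmodel c) (crange c) (H' \<circ> cinv c)"
    using smooth_in_quotient_chart(2)[OF \<phi>(1) H open_UNIV circle_invariant_UNIV _ refl, of H'] H'
    by (simp add: crange_def \<phi>(2) del: quotient_chart_simps)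
qed

text \<open>\<open>H\<close> is constant along \<open>t \<mapsto> exp (- \<i> t) \<alpha>\<close>, so its derivative, \<open>- \<omega> (X \<alpha>)\<close>, vanishes on \<open>- \<i> \<alpha>\<close>.\<close>

lemma hamiltonian_field_tangent: "inner \<alpha> (X \<alpha>) = 0"
proof -
  have H_curve: "((\<lambda>t. H (exp (- \<i> * complex_of_real (t * 1)) *\<^sub>C \<alpha>)) has_derivative
      (\<lambda>t. - omega (X \<alpha>) (t *\<^sub>R ((- \<i> * complex_of_real 1) *\<^sub>C \<alpha>)))) (at 0)"
    using has_derivative_compose[OF exp_ii_has_vector_derivative[of 1 \<alpha>, unfolded has_vector_derivative_def], of H]
      H_has_derivative[of \<alpha>] by (simp add: scaleC_one)
  moreover have "(\<lambda>t. H (exp (- \<i> * complex_of_real (t * 1)) *\<^sub>C \<alpha>)) = (\<lambda>t. H \<alpha>)"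
    using inv by (simp add: norm_exp_eq_Re)
  ultimately have "(\<lambda>t. - omega (X \<alpha>) (t *\<^sub>R ((- \<i> * complex_of_real 1) *\<^sub>C \<alpha>))) = (\<lambda>t. 0)"
    using has_derivative_unique has_derivative_const by metis
  from fun_cong[OF this, of 1] have "omega (X \<alpha>) ((- \<i>) *\<^sub>C \<alpha>) = 0" by simp
  then show ?thesis by (simp add: omega_def cinner_scaleC_right Re_cinner inner_commute)
qed

text \<open>Both sides are the derivative at \<open>0\<close> of \<open>H\<close> along \<open>sphere_curve \<alpha> w\<close>.\<close>

lemma dfun_reduced_hamiltonian:
  assumes \<alpha>: "norm \<alpha> = 1" and w: "cinner w \<alpha> = 0"
  shows "dfun quotient_atlas H' (orbit \<alpha>) (quotient_vector \<alpha> w) = - omega (X \<alpha>) w"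
proof -
  have w': "inner \<alpha> w = 0" using w Re_cinner[of w \<alpha>] by (simp add: inner_commute)
  have "differentiable_at_point quotient_atlas H' (orbit \<alpha>)"
    by (rule differentiable_at_quotient_point[OF H open_UNIV circle_invariant_UNIV _ \<alpha>]) (use H' in auto)
  then have 1: "((\<lambda>t. H' (orbit (sphere_curve \<alpha> w t))) has_vector_derivative
      dfun quotient_atlas H' (orbit \<alpha>) (quotient_vector \<alpha> w)) (at 0)"
    using dfun_velocity[OF differentiable_atlas_quotient differentiable_orbit_curve[OF \<alpha>], of H' w]
    by (simp add: quotient_vector_def sphere_curve_0[OF \<alpha>])
  have "((\<lambda>t. H (sphere_curve \<alpha> w t)) has_derivative (\<lambda>t. - omega (X \<alpha>) (t *\<^sub>R w))) (at 0)"
    using has_derivative_compose[OF sphere_curve_deriv[OF \<alpha>, of w, unfolded has_vector_derivative_def], of H]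
      H_has_derivative[of \<alpha>] by (simp add: sphere_curve_0[OF \<alpha>] w')
  then have "((\<lambda>t. H (sphere_curve \<alpha> w t)) has_vector_derivative - omega (X \<alpha>) w) (at 0)"
    by (simp add: has_vector_derivative_def omega.scaleR_right)
  moreover have "eventually (\<lambda>t. t \<in> UNIV \<longrightarrow> H (sphere_curve \<alpha> w t) = H' (orbit (sphere_curve \<alpha> w t))) (nhds 0)"
    using sphere_curve_in_sphere[OF \<alpha>, of w] by eventually_elim (simp add: H')
  ultimately have "((\<lambda>t. H' (orbit (sphere_curve \<alpha> w t))) has_vector_derivative - omega (X \<alpha>) w) (at 0)"
    by (subst (asm) has_vector_derivative_cong_ev) (simp_all add: sphere_curve_0[OF \<alpha>] H' \<alpha>)
  from vector_derivative_unique_at[OF 1 this] show ?thesis .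
qed

lemma reduced_hamiltonian_equation:
  assumes \<alpha>: "norm \<alpha> = 1" and v: "v \<in> tangent_space quotient_atlas (orbit \<alpha>)"
  shows "dfun quotient_atlas H' (orbit \<alpha>) v = - reduced_form (orbit \<alpha>) (quotient_vector \<alpha> (X \<alpha>)) v"
proof -
  define w where "w = v (quotient_chart \<alpha>)"
  have w: "v = quotient_vector \<alpha> w" "cinner w \<alpha> = 0"
    using quotient_vector_of_tangent[OF \<alpha> v] by (simp_all add: w_def)
  then have "cinner \<alpha> w = 0" using cinner_commute[of \<alpha> w] by simp
  then show ?thesis by (simp add: w(1) dfun_reduced_hamiltonian[OF \<alpha> w(2)] reduced_form_eq[OF \<alpha>] omega_def)
qed

text \<open>Every representative \<open>\<alpha>\<close> of the orbit yields a solution of the same nondegenerate linear equation; in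
  particular the solution does not depend on \<open>\<alpha>\<close>.\<close>

lemma reduced_hamiltonian_field_unique:
  assumes Y: "hamiltonian_field quotient_atlas reduced_form H' Y" and \<alpha>: "norm \<alpha> = 1"
  shows "Y (orbit \<alpha>) = quotient_vector \<alpha> (X \<alpha>)"
proof (rule reduced_form_nondegenerate[of "orbit \<alpha>"])
  show p: "orbit \<alpha> \<in> points quotient_atlas" using \<alpha> by (simp add: points_quotient_atlas)
  show "Y (orbit \<alpha>) \<in> tangent_space quotient_atlas (orbit \<alpha>)"
    using Y p unfolding hamiltonian_field_def vector_field_def by blast
  show "quotient_vector \<alpha> (X \<alpha>) \<in> tangent_space quotient_atlas (orbit \<alpha>)" by (rule quotient_vector_tangent[OF \<alpha>])
  fix v assume "v \<in> tangent_space quotient_atlas (orbit \<alpha>)"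
  then show "reduced_form (orbit \<alpha>) (Y (orbit \<alpha>)) v = reduced_form (orbit \<alpha>) (quotient_vector \<alpha> (X \<alpha>)) v"
    using Y p reduced_hamiltonian_equation[OF \<alpha>, of v] unfolding hamiltonian_field_def by simp
qed

lemma ex1_reduced_hamiltonian_field: "\<exists>!Y. hamiltonian_field quotient_atlas reduced_form H' Y"
proof -
  define Y where "Y q = (if q \<in> points quotient_atlas
    then let \<alpha> = (SOME \<alpha>. norm \<alpha> = 1 \<and> q = orbit \<alpha>) in quotient_vector \<alpha> (X \<alpha>) else (\<lambda>_. 0))" for q :: "'a L2 set"
  have Y: "\<exists>\<alpha>. norm \<alpha> = 1 \<and> q = orbit \<alpha> \<and> Y q = quotient_vector \<alpha> (X \<alpha>)" if "q \<in> points quotient_atlas" for q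
  proof -
    have "\<exists>\<alpha>. norm \<alpha> = 1 \<and> q = orbit \<alpha>" using that unfolding points_quotient_atlas by auto
    from someI_ex[OF this] show ?thesis using that by (auto simp: Y_def Let_def)
  qed
  have "hamiltonian_field quotient_atlas reduced_form H' Y"
    unfolding hamiltonian_field_def vector_field_def
  proof (intro conjI ballI allI impI)
    fix q :: "'a L2 set" assume "q \<in> points quotient_atlas"
    then obtain \<alpha> where \<alpha>: "norm \<alpha> = 1" "q = orbit \<alpha>" "Y q = quotient_vector \<alpha> (X \<alpha>)" using Y by blast
    show "Y q \<in> tangent_space quotient_atlas q" unfolding \<alpha>(3) unfolding \<alpha>(2) by (rule quotient_vector_tangent[OF \<alpha>(1)])
    fix v assume "v \<in> tangent_space quotient_atlas q"
    then show "dfun quotient_atlas H' q v = - reduced_form q (Y q) v"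
      unfolding \<alpha>(3) unfolding \<alpha>(2) by (rule reduced_hamiltonian_equation[OF \<alpha>(1)])
  qed (simp add: Y_def)
  moreover have "Z = Y" if Z: "hamiltonian_field quotient_atlas reduced_form H' Z" for Z
  proof
    fix q
    show "Z q = Y q"
    proof (cases "q \<in> points quotient_atlas")
      case True
      then obtain \<alpha> where "norm \<alpha> = 1" "q = orbit \<alpha>" "Y q = quotient_vector \<alpha> (X \<alpha>)" using Y by blast
      then show ?thesis using reduced_hamiltonian_field_unique[OF Z] by simp
    next
      case False
      then show ?thesis using Z by (simp add: Y_def hamiltonian_field_def vector_field_def)
    qed
  qed
  ultimately show ?thesis by blast
qed

lemma pushforward_of_hamiltonian_field:
  assumes Y: "hamiltonian_field quotient_atlas reduced_form H' Y"
  shows "\<exists>XS. vector_field sphere_atlas XS \<and> (\<forall>\<alpha>\<in>sphere 0 1.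
      dfun sphere_atlas (\<lambda>\<alpha>. \<alpha>) \<alpha> (XS \<alpha>) = X \<alpha> \<and>
      Y (orbit \<alpha>) = pushforward_field sphere_atlas quotient_atlas orbit XS (orbit \<alpha>) \<and>
      pushforward_field sphere_atlas quotient_atlas orbit XS (orbit \<alpha>)
        = dmap sphere_atlas quotient_atlas orbit \<alpha> (XS \<alpha>))"
proof -
  define XS where "XS \<alpha> = (if norm \<alpha> = 1 then sphere_vector \<alpha> (X \<alpha>) else (\<lambda>_. 0))" for \<alpha>
  have dXS: "dmap sphere_atlas quotient_atlas orbit \<alpha> (XS \<alpha>) = Y (orbit \<alpha>)" if "norm \<alpha> = 1" for \<alpha>
    using that by (simp add: XS_def dmap_orbit reduced_hamiltonian_field_unique[OF Y])
  have push: "pushforward_field sphere_atlas quotient_atlas orbit XS (orbit \<alpha>) = Y (orbit \<alpha>)" if "norm \<alpha> = 1" for \<alpha>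
  proof -
    have "\<exists>p. p \<in> points sphere_atlas \<and> orbit p = orbit \<alpha>" using that by (auto simp: points_sphere_atlas)
    from someI_ex[OF this] show ?thesis
      using dXS[of "SOME p. p \<in> points sphere_atlas \<and> orbit p = orbit \<alpha>"]
      by (simp add: pushforward_field_def Let_def points_sphere_atlas)
  qed
  have "vector_field sphere_atlas XS"
    by (auto simp: vector_field_def points_sphere_atlas XS_def sphere_vector_tangent)
  moreover have "dfun sphere_atlas (\<lambda>\<alpha>. \<alpha>) \<alpha> (XS \<alpha>) = X \<alpha>" if "norm \<alpha> = 1" for \<alpha>
    using that dfun_inclusion[OF that hamiltonian_field_tangent] by (simp add: XS_def)
  ultimately show ?thesis using dXS push by (intro exI[of _ XS]) auto
qed

end

theorem proposition2p5:
  shows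
    "symplectic_vector_space (omega :: 'd L2z \<Rightarrow> 'd L2z \<Rightarrow> real) \<and>
     circle_moment_map (omega :: 'd L2z \<Rightarrow> 'd L2z \<Rightarrow> real) (*\<^sub>C) half_norm_sq \<and>
     regular_value (half_norm_sq :: 'd::finite L2z \<Rightarrow> real) (1 / 2) \<and>
     hilbert_manifold (sphere 0 1 :: 'd L2z set) sphere_atlas \<and>
     smooth_embedding sphere_atlas (\<lambda>\<alpha> :: 'd L2z. \<alpha>) \<and>
     hilbert_manifold (orbit ` (sphere 0 1 :: 'd L2z set)) quotient_atlas \<and>
     smooth_submersion sphere_atlas quotient_atlas (orbit :: 'd L2z \<Rightarrow> 'd L2z set) \<and>
     (\<exists>!\<omega>' :: ('d L2z set, 'd L2z) form2.
        symplectic_form quotient_atlas \<omega>' \<and>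
        pullback_const_form sphere_atlas (\<lambda>\<alpha>. \<alpha>) omega
          = pullback_form sphere_atlas quotient_atlas orbit \<omega>') \<and>
     (\<forall>(\<omega>' :: ('d L2z set, 'd L2z) form2) (H :: 'd L2z \<Rightarrow> real) (H' :: 'd L2z set \<Rightarrow> real).
        symplectic_form quotient_atlas \<omega>' \<and>
        pullback_const_form sphere_atlas (\<lambda>\<alpha>. \<alpha>) omega
          = pullback_form sphere_atlas quotient_atlas orbit \<omega>' \<and>
        smooth_on UNIV UNIV H \<and>
        (\<forall>\<zeta> \<alpha>. cmod \<zeta> = 1 \<longrightarrow> H (\<zeta> *\<^sub>C \<alpha>) = H \<alpha>) \<and>
        (\<forall>\<alpha>\<in>sphere 0 1. H \<alpha> = H' (orbit \<alpha>)) \<longrightarrow>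
        smooth_function quotient_atlas H' \<and>
        (\<exists>!X. hamiltonian_field_vs omega H X) \<and>
        (\<exists>!Y. hamiltonian_field quotient_atlas \<omega>' H' Y) \<and>
        (\<forall>X Y. hamiltonian_field_vs omega H X \<and> hamiltonian_field quotient_atlas \<omega>' H' Y \<longrightarrow>
          (\<exists>XS. vector_field sphere_atlas XS \<and>
            (\<forall>\<alpha>\<in>sphere 0 1.
              dfun sphere_atlas (\<lambda>\<alpha>. \<alpha>) \<alpha> (XS \<alpha>) = X \<alpha> \<and>
              Y (orbit \<alpha>) = pushforward_field sphere_atlas quotient_atlas orbit XS (orbit \<alpha>) \<and>
              pushforward_field sphere_atlas quotient_atlas orbit XS (orbit \<alpha>)
                = dmap sphere_atlas quotient_atlas orbit \<alpha> (XS \<alpha>)))))"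
proof -
  have unique: "\<omega>' = reduced_form"
    if "symplectic_form quotient_atlas \<omega>'" "pullback_const_form sphere_atlas (\<lambda>\<alpha>. \<alpha>) omega
          = pullback_form sphere_atlas quotient_atlas orbit \<omega>'" for \<omega>' :: "('d L2z set, 'd L2z) form2"
  proof (rule form_unique_by_pullback)
    show "smooth_2form quotient_atlas \<omega>'" "smooth_2form quotient_atlas (reduced_form :: ('d L2z set, 'd L2z) form2)"
      using that(1) symplectic_reduced_form unfolding symplectic_form_def by blast+
    show "pullback_form sphere_atlas quotient_atlas orbit \<omega>' = pullback_form sphere_atlas quotient_atlas orbit reduced_form"
      using that(2) reduced_form_pullback by metis
  qed
  show ?thesis
  proof (intro conjI symplectic_vector_space_L2 circle_moment_map_half_norm_sq regular_value_half_norm_sq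
      hilbert_manifold_sphere smooth_embedding_sphere hilbert_manifold_quotient smooth_submersion_orbit, goal_cases)
    case 1
    show ?case
      by (rule ex1I[of _ reduced_form]) (use symplectic_reduced_form reduced_form_pullback unique in blast)+
  next
    case 2
    show ?case
    proof (intro allI impI, elim conjE, goal_cases)
      case (1 \<omega>' H H')
      have \<omega>': "\<omega>' = reduced_form" using unique 1(1,2) by blast
      note H = 1(3)
      have inv: "H (\<zeta> *\<^sub>C \<alpha>) = H \<alpha>" if "cmod \<zeta> = 1" for \<zeta> \<alpha> using 1(4) that by blast
      have H': "H \<alpha> = H' (orbit \<alpha>)" if "norm \<alpha> = 1" for \<alpha> using 1(5) that by simp
      have ex: "\<exists>!X. hamiltonian_field_vs omega H X"
        using smooth_on_imp_differentiable[OF H open_UNIV] by (intro ex1_hamiltonian_field_vs) simp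
      then obtain X where X: "hamiltonian_field_vs omega H X" by blast
      show ?case
        unfolding \<omega>' using smooth_reduced_hamiltonian[OF H inv H' X] ex
          ex1_reduced_hamiltonian_field[OF H inv H' X] pushforward_of_hamiltonian_field[OF H inv H'] by blast
    qed
  qed
qed

end
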